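(* Let $P$ carry a variational and definite path geometry (over the contact manifold $M^3$) with invariant $W_2$ identically zero, and let $(\sigma,\theta_0,\theta_1,\theta_2,\theta_3)$ be a fixed canonical coframe on $P$. Then the paths in $P$ project to be geodesics in $M$ for the sub-Riemannian metric $g=\sigma^2+(\theta_1)^2$ on the contact planes of $M$ if and only if $G_1=2W_0$ identically on $P$.
   Context: Everything is smooth and local. A Pfaffian system is a subbundle of the cotangent bundle; $\{\alpha_1,\dots,\alpha_k\}$ denotes the span of the given 1-forms. The first derived system $\mathcal{S}'$ of $\mathcal{S}$ consists of those $\alpha\in\mathcal{S}$ with $d\alpha\equiv0$ modulo the ideal generated by $\mathcal{S}$. The retracting space (Cartan system) of $\mathcal{S}$ is the annihilator of its Cauchy characteristic vectors (vectors $v$ annihilated by $\mathcal{S}$ with $v\lrcorner d\alpha\in\mathcal{S}$ for all $\alpha\in\mathcal{S}$). $L^\perp$ is the annihilator of $L$. Contact path geometry: Let $M^3$ be a contact manifold, $\rho:P\to M$ a fibration with two-dimensional fibres (so $\dim P=5$), and $L$ a line field on $P$ transverse to the fibres of $\rho$. Let $\mathcal{I}$ be the Pfaffian system on $P$ annihilating $L$ and the fibres of $\rho$, and $\mathcal{J}$ the intersection of the retracting space of $\mathcal{I}$ with $L^\perp$. Then $(P,L,\rho)$ is a contact path geometry on $M$ if (i) $\rho_*(v)$ is tangent to a contact plane for any $v\in L$; (ii) $\mathcal{I}'$ is one-dimensional at each point; (iii) $\mathcal{J}'=\mathcal{I}$ at each point. The paths in $P$ are the integral curves of $L$; they project via $\rho$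 to contact curves in $M$. 0-adapted coframes: local coframes $(\sigma,\theta_0,\theta_1,\theta_2,\theta_3)$ on $P$ such that $v\in TP$ projects to a contact direction iff $\theta_0(v)=0$; $\mathcal{I}=\{\theta_0,\theta_1\}$; $\mathcal{J}=\{\theta_0,\theta_1,\theta_2\}$; $L^\perp=\{\theta_0,\theta_1,\theta_2,\theta_3\}$; and $d\theta_i\equiv\sigma\wedge\theta_{i+1}$ mod $\theta_0,\dots,\theta_i$ for $0\le i\le 2$. They are the sections of a principal bundle $B_0\to P$. Canonical structure $B_1$ (a known theorem of Fels): there is a canonical sub-bundle $B_1\subset B_0$ with three-dimensional structure group $G_1$ consisting of the matrices (acting on the column $(\sigma,\theta_0,\theta_1,\theta_2,\theta_3)^T$) $$\mathrm{diag}(a,b,a^{-1}b,a^{-2}b,a^{-3}b)\cdot\exp\begin{pmatrix}0&0&0&0&0\\0&0&0&0&0\\0&c&0&0&0\\0&0&\tfrac43c&0&0\\0&0&0&c&0\end{pmatrix},$$ on which there is a unique equivariant connection, with connection 1-forms $\alpha,\beta,\gamma$, satisfying $$\begin{aligned} d\sigma&=\alpha\wedge\sigma+\theta_0\wedge(T_1\theta_1+T_2\theta_2+T_3\theta_3)+\theta_1\wedge(T_4\theta_2+T_5\theta_3)\\ d\theta_0&=\beta\wedge\theta_0+\sigma\wedge\theta_1\\ d\theta_1&=(\beta-\alpha)\wedge\theta_1+\gamma\wedge\theta_0+\sigma\wedge\theta_2\\ d\theta_2&=(\beta-2\alpha)\wedge\theta_2+\tfrac43\gamma\wedge\theta_1+\sigma\wedge\theta_3\\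 d\theta_3&=(\beta-3\alpha)\wedge\theta_3+\gamma\wedge\theta_2+\sigma\wedge(I_0\theta_0+I_1\theta_1)+T_6\theta_0\wedge\theta_1+T_7\theta_0\wedge\theta_2+T_8\theta_1\wedge\theta_2,\end{aligned}$$ where $\sigma,\theta_0,\dots,\theta_3$ denote the tautological 1-forms on $B_1$ and $I_0,I_1,T_1,\dots,T_8$ are functions on $B_1$ (torsion components). (The group $G_1$ is not to be confused with the function $G_1$ below.) The path geometry is called variational if $I_1,T_5,T_8$ vanish identically on $B_1$; a variational path geometry is called definite if $T_4$ is negative everywhere. In the variational case $3\alpha-2\beta$ is closed and $T_3=-\tfrac35T_4$. For a definite variational path geometry, let $B_2\subset B_1$ be the sub-bundle on which $T_2=0$ and $T_4=-1$. On $B_2$ there are smooth functions $W_0,W_1,W_2,G_0,G_1,G_2,G_3,H$ with $$\beta=2\alpha+W_0\theta_0+W_1\theta_1+W_2\theta_2,\qquad \gamma=H\sigma-3(G_0\theta_0+G_1\theta_1+G_2\theta_2+G_3\theta_3).$$ The group $\mathbb{R}^*$ acts on sections of $B_2$ by $(\sigma,\theta_0,\theta_1,\theta_2,\theta_3)\mapsto(\lambda\sigma,\lambda^2\theta_0,\lambda\theta_1,\theta_2,\lambda^{-1}\theta_3)$; under this action $W_2$ and the ratio $G_1:W_0$ are invariant. A canonical coframe on $P$ (canonical section of $B_2$) is a section of $B_2$ along which $3\alpha-2\beta=0$; forms and functions on $B_2$ (in particular $W_0$, $W_2$ and $G_1$) are pulled back to $P$ by it. When $W_2\equiv0$, the quadratic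 form $g=\sigma^2+(\theta_1)^2$ (taken modulo $\theta_0$) descends to a well-defined sub-Riemannian metric, i.e. a metric on the contact planes of $M$. Geodesics of a sub-Riemannian metric on a contact three-manifold are the contact curves that are extremal for arclength among contact curves (under compactly supported variations through contact curves); on a contact three-manifold these are exactly the curves produced by the Griffiths formalism. *)

theory Defs
  imports "HOL-Analysis.Analysis"
begin

text \<open>
  Everything is local: manifolds are open subsets of Euclidean spaces, a 1-form is a map
  \<^typ>\<open>'a \<Rightarrow> 'a \<Rightarrow>\<^sub>L real\<close>, and a distribution or a Pfaffian system assigns to each point a
  set of tangent vectors or of covectors.
\<close>

type_synonym 'a covector = "'a \<Rightarrow>\<^sub>L real"
type_synonym 'a bicovector = "'a \<Rightarrow>\<^sub>L 'a \<Rightarrow>\<^sub>L real"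

section \<open>Smooth maps and differential forms\<close>

primrec Ck_on :: "nat \<Rightarrow> 'a::real_normed_vector set \<Rightarrow> ('a \<Rightarrow> 'b::real_normed_vector) \<Rightarrow> bool" where
  "Ck_on 0 S f \<longleftrightarrow> continuous_on S f"
| "Ck_on (Suc k) S f \<longleftrightarrow>
     (\<forall>x\<in>S. f differentiable (at x)) \<and> (\<forall>v. Ck_on k S (\<lambda>x. frechet_derivative f (at x) v))"

text \<open>Only used for open \<open>S\<close> in a finite-dimensional space, where directional derivatives suffice.\<close>

definition smooth_on :: "'a::real_normed_vector set \<Rightarrow> ('a \<Rightarrow> 'b::real_normed_vector) \<Rightarrow> bool" where
  "smooth_on S f \<longleftrightarrow> (\<forall>k. Ck_on k S f)"

text \<open>Smoothness of a function on a submanifold \<open>B\<close>.\<close>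

definition smooth_along :: "'a::real_normed_vector set \<Rightarrow> ('a \<Rightarrow> 'b::real_normed_vector) \<Rightarrow> bool" where
  "smooth_along B f \<longleftrightarrow>
     (\<forall>x\<in>B. \<exists>U F. open U \<and> x \<in> U \<and> smooth_on U F \<and> (\<forall>y\<in>U \<inter> B. F y = f y))"

definition wedge :: "'a::real_normed_vector covector \<Rightarrow> 'a covector \<Rightarrow> 'a bicovector"
    (infixr "\<and>\<^sub>w" 68) where
  "\<phi> \<and>\<^sub>w \<psi> = Blinfun (\<lambda>u. \<phi> u *\<^sub>R \<psi> - \<psi> u *\<^sub>R \<phi>)"

definition ext_d :: "('a::real_normed_vector \<Rightarrow> 'a covector) \<Rightarrow> 'a \<Rightarrow> 'a bicovector" where
  "ext_d \<omega> x = Blinfun (\<lambda>u. Blinfun (\<lambda>v.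
     blinfun_apply (frechet_derivative \<omega> (at x) u) v - blinfun_apply (frechet_derivative \<omega> (at x) v) u))"

lemma wedge_apply:
  "blinfun_apply (blinfun_apply (\<phi> \<and>\<^sub>w \<psi>) u) v
     = blinfun_apply \<phi> u * blinfun_apply \<psi> v - blinfun_apply \<psi> u * blinfun_apply \<phi> v"
proof -
  have "bounded_linear (\<lambda>u. blinfun_apply \<phi> u *\<^sub>R \<psi> - blinfun_apply \<psi> u *\<^sub>R \<phi>)"
    by (intro bounded_linear_sub bounded_linear_scaleR_const blinfun.bounded_linear_right)
  then show ?thesis
    by (simp add: wedge_def bounded_linear_Blinfun_apply blinfun.diff_left blinfun.scaleR_left)
qed

lemma ext_d_apply:
  fixes \<omega> :: "'a::euclidean_space \<Rightarrow> 'a covector"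
  assumes "\<omega> differentiable (at x)"
  shows "blinfun_apply (blinfun_apply (ext_d \<omega> x) u) v
     = blinfun_apply (frechet_derivative \<omega> (at x) u) v - blinfun_apply (frechet_derivative \<omega> (at x) v) u"
proof -
  let ?D = "frechet_derivative \<omega> (at x)"
  have lin: "linear ?D"
    by (rule linear_frechet_derivative[OF assms])
  have 1: "bounded_linear (\<lambda>v. blinfun_apply (?D u) v - blinfun_apply (?D v) u)" for u
    by (intro linear_conv_bounded_linear[THEN iffD1] linearI)
      (simp_all add: linear_add[OF lin] linear_scale[OF lin] blinfun.add_left blinfun.add_right
        blinfun.scaleR_left blinfun.scaleR_right algebra_simps)
  define B where "B u = Blinfun (\<lambda>v. blinfun_apply (?D u) v - blinfun_apply (?D v) u)" for u
  have B: "blinfun_apply (B u) v = blinfun_apply (?D u) v - blinfun_apply (?D v) u" for u v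
    by (simp add: B_def bounded_linear_Blinfun_apply[OF 1])
  have 2: "bounded_linear B"
    by (intro linear_conv_bounded_linear[THEN iffD1] linearI blinfun_eqI)
      (simp_all add: B linear_add[OF lin] linear_scale[OF lin]
        blinfun.add_left blinfun.add_right blinfun.scaleR_left blinfun.scaleR_right algebra_simps)
  have "ext_d \<omega> x = Blinfun B"
    unfolding ext_d_def B_def ..
  then show ?thesis
    by (simp add: bounded_linear_Blinfun_apply[OF 2] B)
qed

section \<open>Pfaffian systems\<close>

definition annihilator :: "'a::real_normed_vector set \<Rightarrow> 'a covector set" where
  "annihilator V = {\<phi>. \<forall>v\<in>V. blinfun_apply \<phi> v = 0}"

text \<open>Degree-two part, at a point, of the ideal generated by a set of covectors.\<close>

definition ideal2 :: "'a::real_normed_vector covector set \<Rightarrow> 'a bicovector set" where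
  "ideal2 S = span {\<phi> \<and>\<^sub>w \<psi> |\<phi> \<psi>. \<phi> \<in> S}"

definition local_section ::
    "'a::real_normed_vector set \<Rightarrow> ('a \<Rightarrow> 'a covector set) \<Rightarrow> 'a \<Rightarrow> 'a set \<Rightarrow> ('a \<Rightarrow> 'a covector) \<Rightarrow> bool" where
  "local_section P S p V \<omega> \<longleftrightarrow>
     open V \<and> p \<in> V \<and> V \<subseteq> P \<and> smooth_on V \<omega> \<and> (\<forall>q\<in>V. \<omega> q \<in> S q)"

definition derived_system ::
    "'a::real_normed_vector set \<Rightarrow> ('a \<Rightarrow> 'a covector set) \<Rightarrow> 'a \<Rightarrow> 'a covector set" where
  "derived_system P S p =
     {\<omega> p |\<omega> V. local_section P S p V \<omega> \<and> ext_d \<omega> p \<in> ideal2 (S p)}"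

definition cauchy_characteristics ::
    "'a::real_normed_vector set \<Rightarrow> ('a \<Rightarrow> 'a covector set) \<Rightarrow> 'a \<Rightarrow> 'a set" where
  "cauchy_characteristics P S p =
     {v. (\<forall>\<phi>\<in>S p. blinfun_apply \<phi> v = 0) \<and>
         (\<forall>\<omega> V. local_section P S p V \<omega> \<longrightarrow> blinfun_apply (ext_d \<omega> p) v \<in> S p)}"

definition retracting_space ::
    "'a::real_normed_vector set \<Rightarrow> ('a \<Rightarrow> 'a covector set) \<Rightarrow> 'a \<Rightarrow> 'a covector set" where
  "retracting_space P S p = annihilator (cauchy_characteristics P S p)"

section \<open>Contact path geometries\<close>

text \<open>A contact structure, as a plane field that is locally the kernel of a contact form.\<close>

definition contact_form_at :: "(real^3 \<Rightarrow> (real^3) covector) \<Rightarrow> real^3 \<Rightarrow> bool" where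
  "contact_form_at \<eta> x \<longleftrightarrow>
     (\<exists>u v w. blinfun_apply (\<eta> x) u * blinfun_apply (blinfun_apply (ext_d \<eta> x) v) w
            + blinfun_apply (\<eta> x) v * blinfun_apply (blinfun_apply (ext_d \<eta> x) w) u
            + blinfun_apply (\<eta> x) w * blinfun_apply (blinfun_apply (ext_d \<eta> x) u) v \<noteq> 0)"

definition contact_structure :: "(real^3) set \<Rightarrow> (real^3 \<Rightarrow> (real^3) set) \<Rightarrow> bool" where
  "contact_structure M D \<longleftrightarrow> open M \<and>
     (\<forall>x\<in>M. \<exists>U \<eta>. open U \<and> x \<in> U \<and> U \<subseteq> M \<and> smooth_on U \<eta> \<and>
        (\<forall>y\<in>U. contact_form_at \<eta> y \<and> D y = {w. blinfun_apply (\<eta> y) w = 0}))"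

text \<open>Fibres are connected, as is needed for forms on \<open>P\<close> to descend to \<open>M\<close>.\<close>

definition fibration :: "(real^5) set \<Rightarrow> (real^3) set \<Rightarrow> (real^5 \<Rightarrow> real^3) \<Rightarrow> bool" where
  "fibration P M \<rho> \<longleftrightarrow> open P \<and> smooth_on P \<rho> \<and> \<rho> ` P = M \<and>
     (\<forall>p\<in>P. surj (frechet_derivative \<rho> (at p))) \<and>
     (\<forall>x\<in>M. connected {p\<in>P. \<rho> p = x})"

definition vertical :: "(real^5 \<Rightarrow> real^3) \<Rightarrow> real^5 \<Rightarrow> (real^5) set" where
  "vertical \<rho> p = {v. frechet_derivative \<rho> (at p) v = 0}"

definition line_field :: "(real^5) set \<Rightarrow> (real^5 \<Rightarrow> (real^5) set) \<Rightarrow> bool" where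
  "line_field P L \<longleftrightarrow>
     (\<forall>p\<in>P. \<exists>U X. open U \<and> p \<in> U \<and> U \<subseteq> P \<and> smooth_on U X \<and> (\<forall>q\<in>U. X q \<noteq> 0 \<and> L q = span {X q}))"

definition sysI :: "(real^5 \<Rightarrow> real^3) \<Rightarrow> (real^5 \<Rightarrow> (real^5) set) \<Rightarrow> real^5 \<Rightarrow> (real^5) covector set" where
  "sysI \<rho> L p = annihilator (L p \<union> vertical \<rho> p)"

definition sysJ ::
    "(real^5) set \<Rightarrow> (real^5 \<Rightarrow> real^3) \<Rightarrow> (real^5 \<Rightarrow> (real^5) set) \<Rightarrow> real^5 \<Rightarrow> (real^5) covector set" where
  "sysJ P \<rho> L p = retracting_space P (sysI \<rho> L) p \<inter> annihilator (L p)"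

definition contact_path_geometry ::
    "(real^5) set \<Rightarrow> (real^3) set \<Rightarrow> (real^3 \<Rightarrow> (real^3) set) \<Rightarrow> (real^5 \<Rightarrow> real^3)
      \<Rightarrow> (real^5 \<Rightarrow> (real^5) set) \<Rightarrow> bool" where
  "contact_path_geometry P M D \<rho> L \<longleftrightarrow>
     contact_structure M D \<and> fibration P M \<rho> \<and> line_field P L \<and>
     (\<forall>p\<in>P. L p \<inter> vertical \<rho> p = {0}) \<and>
     (\<forall>p\<in>P. \<forall>v\<in>L p. frechet_derivative \<rho> (at p) v \<in> D (\<rho> p)) \<and>
     (\<forall>p\<in>P. dim (derived_system P (sysI \<rho> L) p) = 1) \<and>
     (\<forall>p\<in>P. derived_system P (sysJ P \<rho> L) p = sysI \<rho> L p)"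

definition path_in ::
    "(real^5) set \<Rightarrow> (real^5 \<Rightarrow> (real^5) set) \<Rightarrow> real set \<Rightarrow> (real \<Rightarrow> real^5) \<Rightarrow> bool" where
  "path_in P L J c \<longleftrightarrow> open J \<and> is_interval J \<and> smooth_on J c \<and>
     (\<forall>t\<in>J. c t \<in> P \<and> vector_derivative c (at t) \<noteq> 0 \<and> vector_derivative c (at t) \<in> L (c t))"

section \<open>Adapted coframes\<close>

text \<open>
  A coframe at a point is the column \<open>(\<sigma>, \<theta>\<^sub>0, \<theta>\<^sub>1, \<theta>\<^sub>2, \<theta>\<^sub>3)\<close>, in this order, with entries indexed
  by \<open>1, \<dots>, 5\<close> (and \<open>5 = 0\<close> in the index type).
\<close>

definition sigma :: "('a \<Rightarrow> 'b^5) \<Rightarrow> 'a \<Rightarrow> 'b" where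
  "sigma e x = e x $ 1"

definition theta :: "('a \<Rightarrow> 'b^5) \<Rightarrow> nat \<Rightarrow> 'a \<Rightarrow> 'b" where
  "theta e i x = e x $ of_nat (i + 2)"

definition adapted_coframe ::
    "(real^5) set \<Rightarrow> (real^3 \<Rightarrow> (real^3) set) \<Rightarrow> (real^5 \<Rightarrow> real^3) \<Rightarrow> (real^5 \<Rightarrow> (real^5) set)
      \<Rightarrow> (real^5 \<Rightarrow> ((real^5) covector)^5) \<Rightarrow> bool" where
  "adapted_coframe P D \<rho> L e \<longleftrightarrow> smooth_on P e \<and>
     (\<forall>p\<in>P.
        span (range (\<lambda>i. e p $ i)) = UNIV \<and>
        (\<forall>v. frechet_derivative \<rho> (at p) v \<in> D (\<rho> p) \<longleftrightarrow> blinfun_apply (theta e 0 p) v = 0) \<and>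
        sysI \<rho> L p = span {theta e 0 p, theta e 1 p} \<and>
        sysJ P \<rho> L p = span {theta e 0 p, theta e 1 p, theta e 2 p} \<and>
        annihilator (L p) = span {theta e 0 p, theta e 1 p, theta e 2 p, theta e 3 p} \<and>
        (\<forall>i\<le>2. ext_d (theta e i) p - sigma e p \<and>\<^sub>w theta e (i + 1) p
                  \<in> ideal2 {theta e j p |j. j \<le> i}))"

section \<open>The structure group \<open>G\<^sub>1\<close>\<close>

definition diag5 :: "real list \<Rightarrow> real^5^5" where
  "diag5 xs = (\<chi> i j. if i = j then vector xs $ i else 0)"

definition nilp :: "real \<Rightarrow> real^5^5" where
  "nilp c = vector
     [vector [0, 0, 0,         0, 0],
      vector [0, 0, 0,         0, 0],
      vector [0, c, 0,         0, 0],
      vector [0, 0, 4 / 3 * c, 0, 0],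
      vector [0, 0, 0,         c, 0]]"

definition mat_exp :: "real^'n^'n \<Rightarrow> real^'n^'n" where
  "mat_exp A = (\<Sum>k. (1 / fact k) *\<^sub>R (((**) A ^^ k) (mat 1)))"

text \<open>The group is parametrised by the triples \<open>(a, b, c)\<close> with \<open>a, b \<noteq> 0\<close>.\<close>

definition G1_params :: "(real \<times> real \<times> real) set" where
  "G1_params = (UNIV - {0}) \<times> (UNIV - {0}) \<times> UNIV"

definition G1_mat :: "real \<times> real \<times> real \<Rightarrow> real^5^5" where
  "G1_mat = (\<lambda>(a, b, c). diag5 [a, b, b / a, b / a^2, b / a^3] ** mat_exp (nilp c))"

text \<open>Multiplication of the matrices \<open>G1_mat\<close>, written in the parameters.\<close>

definition G1_mult :: "real \<times> real \<times> real \<Rightarrow> real \<times> real \<times> real \<Rightarrow> real \<times> real \<times> real" where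
  "G1_mult = (\<lambda>(a', b', c') (a, b, c). (a' * a, b' * b, c + a * c'))"

definition lie_G1 :: "real \<Rightarrow> real \<Rightarrow> real \<Rightarrow> real^5^5" where
  "lie_G1 a b c = diag5 [a, b, b - a, b - 2 * a, b - 3 * a] + nilp c"

definition mat_col :: "real^5^5 \<Rightarrow> 'b::real_vector^5 \<Rightarrow> 'b^5" where
  "mat_col A e = (\<chi> i. \<Sum>j\<in>UNIV. A $ i $ j *\<^sub>R e $ j)"

section \<open>The canonical structure\<close>

text \<open>
  A section \<open>s\<close> of \<open>B\<^sub>1\<close> over \<open>P\<close> identifies \<open>B\<^sub>1 = {(p, g s(p)) | p \<in> P, g \<in> G\<^sub>1}\<close> with the open set
  \<open>P \<times> G\<^sub>1\<close> of the following 8-dimensional space; forms and functions on \<open>B\<^sub>1\<close> are forms and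
  functions on that open set.
\<close>

type_synonym total = "(real^5) \<times> real \<times> real \<times> real"

definition B1 :: "(real^5) set \<Rightarrow> total set" where
  "B1 P = P \<times> G1_params"

definition coframe_at :: "(real^5 \<Rightarrow> ((real^5) covector)^5) \<Rightarrow> total \<Rightarrow> ((real^5) covector)^5" where
  "coframe_at s x = mat_col (G1_mat (snd x)) (s (fst x))"

definition tautological :: "(real^5 \<Rightarrow> ((real^5) covector)^5) \<Rightarrow> total \<Rightarrow> (total covector)^5" where
  "tautological s x = (\<chi> i. (coframe_at s x $ i) o\<^sub>L fst_blinfun)"

definition G1_act :: "real \<times> real \<times> real \<Rightarrow> total \<Rightarrow> total" where
  "G1_act h x = (fst x, G1_mult h (snd x))"

definition conn_mat ::
    "(total \<Rightarrow> total covector) \<Rightarrow> (total \<Rightarrow> total covector) \<Rightarrow> (total \<Rightarrow> total covector)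
      \<Rightarrow> total \<Rightarrow> total \<Rightarrow> real^5^5" where
  "conn_mat \<alpha> \<beta> \<gamma> x v =
     lie_G1 (blinfun_apply (\<alpha> x) v) (blinfun_apply (\<beta> x) v) (blinfun_apply (\<gamma> x) v)"

text \<open>
  \<open>G\<^sub>1\<close> acts on coframes from the left, so a connection restricts to \<open>dg g\<^sup>-\<^sup>1\<close> on the fibres and
  satisfies \<open>h\<^sup>*\<phi> = h \<phi> h\<^sup>-\<^sup>1\<close>; both conditions are stated with the inverse moved to the other side.
\<close>

definition equivariant_connection ::
    "(real^5) set \<Rightarrow> (total \<Rightarrow> total covector) \<Rightarrow> (total \<Rightarrow> total covector) \<Rightarrow> (total \<Rightarrow> total covector) \<Rightarrow> bool" where
  "equivariant_connection P \<alpha> \<beta> \<gamma> \<longleftrightarrow>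
     smooth_on (B1 P) \<alpha> \<and> smooth_on (B1 P) \<beta> \<and> smooth_on (B1 P) \<gamma> \<and>
     (\<forall>x\<in>B1 P. \<forall>w.
        conn_mat \<alpha> \<beta> \<gamma> x (0, w) ** G1_mat (snd x) = frechet_derivative G1_mat (at (snd x)) w) \<and>
     (\<forall>x\<in>B1 P. \<forall>h\<in>G1_params. \<forall>v.
        conn_mat \<alpha> \<beta> \<gamma> (G1_act h x) (frechet_derivative (G1_act h) (at x) v) ** G1_mat h
          = G1_mat h ** conn_mat \<alpha> \<beta> \<gamma> x v)"

definition structure_equations ::
    "'a::real_normed_vector set \<Rightarrow> ('a \<Rightarrow> 'a covector) \<Rightarrow> (nat \<Rightarrow> 'a \<Rightarrow> 'a covector)
      \<Rightarrow> ('a \<Rightarrow> 'a covector) \<Rightarrow> ('a \<Rightarrow> 'a covector) \<Rightarrow> ('a \<Rightarrow> 'a covector)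
      \<Rightarrow> (nat \<Rightarrow> 'a \<Rightarrow> real) \<Rightarrow> (nat \<Rightarrow> 'a \<Rightarrow> real) \<Rightarrow> bool" where
  "structure_equations X \<sigma> \<theta> \<alpha> \<beta> \<gamma> I T \<longleftrightarrow> (\<forall>x\<in>X.
     ext_d \<sigma> x = \<alpha> x \<and>\<^sub>w \<sigma> x
       + \<theta> 0 x \<and>\<^sub>w (T 1 x *\<^sub>R \<theta> 1 x + T 2 x *\<^sub>R \<theta> 2 x + T 3 x *\<^sub>R \<theta> 3 x)
       + \<theta> 1 x \<and>\<^sub>w (T 4 x *\<^sub>R \<theta> 2 x + T 5 x *\<^sub>R \<theta> 3 x) \<and>
     ext_d (\<theta> 0) x = \<beta> x \<and>\<^sub>w \<theta> 0 x + \<sigma> x \<and>\<^sub>w \<theta> 1 x \<and>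
     ext_d (\<theta> 1) x = (\<beta> x - \<alpha> x) \<and>\<^sub>w \<theta> 1 x + \<gamma> x \<and>\<^sub>w \<theta> 0 x + \<sigma> x \<and>\<^sub>w \<theta> 2 x \<and>
     ext_d (\<theta> 2) x = (\<beta> x - 2 *\<^sub>R \<alpha> x) \<and>\<^sub>w \<theta> 2 x + (4 / 3) *\<^sub>R \<gamma> x \<and>\<^sub>w \<theta> 1 x + \<sigma> x \<and>\<^sub>w \<theta> 3 x \<and>
     ext_d (\<theta> 3) x = (\<beta> x - 3 *\<^sub>R \<alpha> x) \<and>\<^sub>w \<theta> 3 x + \<gamma> x \<and>\<^sub>w \<theta> 2 x
       + \<sigma> x \<and>\<^sub>w (I 0 x *\<^sub>R \<theta> 0 x + I 1 x *\<^sub>R \<theta> 1 x)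
       + T 6 x *\<^sub>R (\<theta> 0 x \<and>\<^sub>w \<theta> 1 x) + T 7 x *\<^sub>R (\<theta> 0 x \<and>\<^sub>w \<theta> 2 x) + T 8 x *\<^sub>R (\<theta> 1 x \<and>\<^sub>w \<theta> 2 x))"

definition canonical_structure ::
    "(real^5) set \<Rightarrow> (real^3 \<Rightarrow> (real^3) set) \<Rightarrow> (real^5 \<Rightarrow> real^3) \<Rightarrow> (real^5 \<Rightarrow> (real^5) set)
      \<Rightarrow> (real^5 \<Rightarrow> ((real^5) covector)^5)
      \<Rightarrow> (total \<Rightarrow> total covector) \<Rightarrow> (total \<Rightarrow> total covector) \<Rightarrow> (total \<Rightarrow> total covector)
      \<Rightarrow> (nat \<Rightarrow> total \<Rightarrow> real) \<Rightarrow> (nat \<Rightarrow> total \<Rightarrow> real) \<Rightarrow> bool" where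
  "canonical_structure P D \<rho> L s \<alpha> \<beta> \<gamma> I T \<longleftrightarrow>
     adapted_coframe P D \<rho> L s \<and> equivariant_connection P \<alpha> \<beta> \<gamma> \<and>
     (\<forall>i\<in>{0, 1}. smooth_on (B1 P) (I i)) \<and> (\<forall>i\<in>{1..8}. smooth_on (B1 P) (T i)) \<and>
     structure_equations (B1 P) (sigma (tautological s)) (theta (tautological s)) \<alpha> \<beta> \<gamma> I T"

definition variational :: "(real^5) set \<Rightarrow> (nat \<Rightarrow> total \<Rightarrow> real) \<Rightarrow> (nat \<Rightarrow> total \<Rightarrow> real) \<Rightarrow> bool" where
  "variational P I T \<longleftrightarrow> (\<forall>x\<in>B1 P. I 1 x = 0 \<and> T 5 x = 0 \<and> T 8 x = 0)"

definition definite :: "(real^5) set \<Rightarrow> (nat \<Rightarrow> total \<Rightarrow> real) \<Rightarrow> bool" where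
  "definite P T \<longleftrightarrow> (\<forall>x\<in>B1 P. T 4 x < 0)"

section \<open>The reduction \<open>B\<^sub>2\<close>\<close>

definition B2 :: "(real^5) set \<Rightarrow> (nat \<Rightarrow> total \<Rightarrow> real) \<Rightarrow> total set" where
  "B2 P T = {x \<in> B1 P. T 2 x = 0 \<and> T 4 x = -1}"

text \<open>\<open>B\<^sub>2\<close> is a regular level set of \<open>(T\<^sub>2, T\<^sub>4)\<close>, with tangent spaces the common kernels.\<close>

definition tangent_B2 :: "(nat \<Rightarrow> total \<Rightarrow> real) \<Rightarrow> total \<Rightarrow> total set" where
  "tangent_B2 T x = {v. frechet_derivative (T 2) (at x) v = 0 \<and> frechet_derivative (T 4) (at x) v = 0}"

text \<open>Identities between 1-forms on \<open>B\<^sub>2\<close> hold on tangent vectors of \<open>B\<^sub>2\<close> only.\<close>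

definition B2_functions ::
    "(real^5) set \<Rightarrow> (real^5 \<Rightarrow> ((real^5) covector)^5)
      \<Rightarrow> (total \<Rightarrow> total covector) \<Rightarrow> (total \<Rightarrow> total covector) \<Rightarrow> (total \<Rightarrow> total covector)
      \<Rightarrow> (nat \<Rightarrow> total \<Rightarrow> real) \<Rightarrow> (nat \<Rightarrow> total \<Rightarrow> real) \<Rightarrow> (nat \<Rightarrow> total \<Rightarrow> real) \<Rightarrow> (total \<Rightarrow> real) \<Rightarrow> bool" where
  "B2_functions P s \<alpha> \<beta> \<gamma> T W G H \<longleftrightarrow>
     (\<forall>i\<le>2. smooth_along (B2 P T) (W i)) \<and> (\<forall>i\<le>3. smooth_along (B2 P T) (G i)) \<and>
     smooth_along (B2 P T) H \<and>
     (\<forall>x\<in>B2 P T. \<forall>v\<in>tangent_B2 T x.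
        blinfun_apply (\<beta> x) v =
          blinfun_apply (2 *\<^sub>R \<alpha> x + (\<Sum>i\<le>2. W i x *\<^sub>R theta (tautological s) i x)) v \<and>
        blinfun_apply (\<gamma> x) v =
          blinfun_apply (H x *\<^sub>R sigma (tautological s) x
                         - 3 *\<^sub>R (\<Sum>i\<le>3. G i x *\<^sub>R theta (tautological s) i x)) v)"

text \<open>A section of \<open>B\<^sub>1\<close> is given by its \<open>G\<^sub>1\<close>-component \<open>k\<close>, and the coframe by \<open>section_coframe s k\<close>.\<close>

definition section_of :: "(real^5 \<Rightarrow> real \<times> real \<times> real) \<Rightarrow> real^5 \<Rightarrow> total" where
  "section_of k p = (p, k p)"

definition section_coframe ::
    "(real^5 \<Rightarrow> ((real^5) covector)^5) \<Rightarrow> (real^5 \<Rightarrow> real \<times> real \<times> real)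
      \<Rightarrow> real^5 \<Rightarrow> ((real^5) covector)^5" where
  "section_coframe s k p = coframe_at s (section_of k p)"

definition canonical_section ::
    "(real^5) set \<Rightarrow> (total \<Rightarrow> total covector) \<Rightarrow> (total \<Rightarrow> total covector) \<Rightarrow> (nat \<Rightarrow> total \<Rightarrow> real)
      \<Rightarrow> (real^5 \<Rightarrow> real \<times> real \<times> real) \<Rightarrow> bool" where
  "canonical_section P \<alpha> \<beta> T k \<longleftrightarrow> smooth_on P k \<and>
     (\<forall>p\<in>P. section_of k p \<in> B2 P T \<and>
        (\<forall>v. blinfun_apply (3 *\<^sub>R \<alpha> (section_of k p) - 2 *\<^sub>R \<beta> (section_of k p))
               (frechet_derivative (section_of k) (at p) v) = 0))"

section \<open>Sub-Riemannian geodesics\<close>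

text \<open>
  The quadratic form on contact planes to which \<open>\<sigma>\<^sup>2 + (\<theta>\<^sub>1)\<^sup>2\<close> descends. The value does not depend
  on the representatives \<open>p\<close>, \<open>v\<close> when \<open>W\<^sub>2 = 0\<close>, as the fibres of \<open>\<rho>\<close> are connected.
\<close>

definition descended_metric ::
    "(real^5) set \<Rightarrow> (real^5 \<Rightarrow> real^3) \<Rightarrow> (real^5 \<Rightarrow> ((real^5) covector)^5)
      \<Rightarrow> real^3 \<Rightarrow> real^3 \<Rightarrow> real" where
  "descended_metric P \<rho> e x w =
     (THE r. \<exists>p\<in>P. \<exists>v. \<rho> p = x \<and> blinfun_apply (theta e 0 p) v = 0 \<and>
        frechet_derivative \<rho> (at p) v = w \<and>
        r = (blinfun_apply (sigma e p) v)\<^sup>2 + (blinfun_apply (theta e 1 p) v)\<^sup>2)"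

definition contact_curve ::
    "(real^3) set \<Rightarrow> (real^3 \<Rightarrow> (real^3) set) \<Rightarrow> real set \<Rightarrow> (real \<Rightarrow> real^3) \<Rightarrow> bool" where
  "contact_curve M D J c \<longleftrightarrow> open J \<and> is_interval J \<and> smooth_on J c \<and>
     (\<forall>t\<in>J. c t \<in> M \<and> vector_derivative c (at t) \<in> D (c t))"

definition arclength :: "(real^3 \<Rightarrow> real^3 \<Rightarrow> real) \<Rightarrow> real \<Rightarrow> real \<Rightarrow> (real \<Rightarrow> real^3) \<Rightarrow> real" where
  "arclength g a b c = integral {a..b} (\<lambda>t. sqrt (g (c t) (vector_derivative c (at t))))"

text \<open>A variation of \<open>c\<close> through contact curves, with support in \<open>{a..b}\<close>.\<close>

definition contact_variation ::
    "(real^3) set \<Rightarrow> (real^3 \<Rightarrow> (real^3) set) \<Rightarrow> real set \<Rightarrow> (real \<Rightarrow> real^3)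
      \<Rightarrow> real \<Rightarrow> real \<Rightarrow> real \<Rightarrow> (real \<times> real \<Rightarrow> real^3) \<Rightarrow> bool" where
  "contact_variation M D J c a b \<epsilon> F \<longleftrightarrow> a < b \<and> {a..b} \<subseteq> J \<and> 0 < \<epsilon> \<and>
     smooth_on (J \<times> {-\<epsilon><..<\<epsilon>}) F \<and>
     (\<forall>s\<in>{-\<epsilon><..<\<epsilon>}. contact_curve M D J (\<lambda>t. F (t, s))) \<and>
     (\<forall>t\<in>J. F (t, 0) = c t) \<and>
     (\<forall>s\<in>{-\<epsilon><..<\<epsilon>}. \<forall>t\<in>J - {a..b}. F (t, s) = c t)"

definition sub_riemannian_geodesic ::
    "(real^3) set \<Rightarrow> (real^3 \<Rightarrow> (real^3) set) \<Rightarrow> (real^3 \<Rightarrow> real^3 \<Rightarrow> real)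
      \<Rightarrow> real set \<Rightarrow> (real \<Rightarrow> real^3) \<Rightarrow> bool" where
  "sub_riemannian_geodesic M D g J c \<longleftrightarrow> contact_curve M D J c \<and>
     (\<forall>t\<in>J. vector_derivative c (at t) \<noteq> 0) \<and>
     (\<forall>a b \<epsilon> F. contact_variation M D J c a b \<epsilon> F \<longrightarrow>
        ((\<lambda>s. arclength g a b (\<lambda>t. F (t, s))) has_real_derivative 0) (at 0))"

end

theory Submission
  imports Defs
begin

text \<open>
  Pulled back by the canonical section, \<open>\<alpha> = -2(W\<^sub>0\<theta>\<^sub>0 + W\<^sub>1\<theta>\<^sub>1)\<close> and \<open>\<beta> = -3(W\<^sub>0\<theta>\<^sub>0 + W\<^sub>1\<theta>\<^sub>1)\<close>. Lift a
  contact variation of a projected path to \<open>P\<close>, starting from the path itself, with variation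
  field \<open>V\<close>. On the path \<open>\<theta>\<^sub>1 = 0\<close>, so the length varies like the integral of \<open>\<sigma>\<close>; Cartan's
  formula, together with \<open>d(\<theta>\<^sub>0(V)) = \<theta>\<^sub>1(V) \<sigma>\<close> along the path, turns its derivative into the
  integral of \<open>-2(W\<^sub>0 - X W\<^sub>1) \<theta>\<^sub>0(V)\<close>, where \<open>X\<close> is the vector field dual to \<open>\<sigma>\<close>. Since
  \<open>d(d\<theta>\<^sub>0) = 0\<close> gives \<open>X W\<^sub>1 = G\<^sub>1 - W\<^sub>0\<close>, the integrand is \<open>2(G\<^sub>1 - 2W\<^sub>0) \<theta>\<^sub>0(V)\<close>. It vanishes if
  \<open>G\<^sub>1 = 2W\<^sub>0\<close>; conversely, a contact variation with \<open>\<theta>\<^sub>0(V)\<close> a nonnegative bump is obtained by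
  straightening a Legendrian vector field transverse to the path.
\<close>

section \<open>Calculus of smooth maps\<close>

text \<open>The variation lives on \<open>M\<close>, the forms live on \<open>P\<close>, and a lift
  of the variation is available only near each point of the path. No gluing is required:
  \<open>\<sigma>\<close>, \<open>\<theta>\<^sub>0\<close>, \<open>\<theta>\<^sub>1\<close> vanish
  on vertical vectors, so their values on \<open>V\<close> are the same for all lifts, and
  \<open>Z = \<sigma>(V) - 2 w1 \<theta>\<^sub>0(V)\<close>, with \<open>w1\<close> the pullback of
  \<open>W\<^sub>1\<close>, is one function on the whole interval whose derivative can be computed
  in any local lift. Its second term comes from an integration by parts. The length sees the
  absolute value of \<open>\<sigma>\<close> on the path, but \<open>\<sigma>\<close> has no zero
  there, so this is a constant sign. For the converse, the contact condition is in general a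
  differential equation, whose solution need not return to the path where the bump ends. In
  straightened coordinates the unknown enters without its derivative: it is found pointwise by the
  implicit function theorem and is zero wherever nothing is perturbed. Straightening uses a smooth
  flow, hence smooth dependence of solutions of differential equations on their initial
  values.\<close>

abbreviation fderiv :: "('a::real_normed_vector \<Rightarrow> 'b::real_normed_vector) \<Rightarrow> 'a \<Rightarrow> 'a \<Rightarrow> 'b" where
  "fderiv f x \<equiv> frechet_derivative f (at x)"

lemma frechet_derivative_cong_open:
  assumes "open S" "x \<in> S" "\<And>y. y \<in> S \<Longrightarrow> f y = g y"
  shows "fderiv f x = fderiv g x"
proof -
  have "(f has_derivative D) (at x) \<longleftrightarrow> (g has_derivative D) (at x)" for D
    using assms has_derivative_transform_within_open[of f D x UNIV S g]
      has_derivative_transform_within_open[of g D x UNIV S f] by (metis at_within_open)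
  then show ?thesis by (simp add: frechet_derivative_def)
qed

lemma differentiable_has_fderiv:
  "f differentiable (at x) \<Longrightarrow> (f has_derivative fderiv f x) (at x)"
  by (simp add: frechet_derivative_works)

lemma Ck_on_cong:
  assumes "open S" "\<And>x. x \<in> S \<Longrightarrow> f x = g x" "Ck_on k S f"
  shows "Ck_on k S g"
  using assms(2,3)
proof (induction k arbitrary: f g)
  case 0 then show ?case using continuous_on_cong by force
next
  case (Suc k)
  have D: "fderiv f x = fderiv g x" if "x \<in> S" for x
    using frechet_derivative_cong_open[OF assms(1) that Suc.prems(1)] .
  have "g differentiable (at x)" if "x \<in> S" for x
  proof -
    have "(f has_derivative fderiv f x) (at x)"
      using Suc.prems(2) that differentiable_has_fderiv by auto
    then have "(g has_derivative fderiv f x) (at x)"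
      using has_derivative_transform_within_open[OF _ assms(1) that] Suc.prems(1) by blast
    then show ?thesis unfolding differentiable_def by blast
  qed
  moreover have "Ck_on k S (\<lambda>x. fderiv g x v)" for v
    by (rule Suc.IH[of "\<lambda>x. fderiv f x v"]) (use D Suc.prems in auto)
  ultimately show ?case by simp
qed

lemma Ck_on_SucI:
  assumes "open S" "\<And>x. x \<in> S \<Longrightarrow> (f has_derivative f' x) (at x)"
    and "\<And>v. Ck_on k S (\<lambda>x. f' x v)"
  shows "Ck_on (Suc k) S f"
proof -
  have "Ck_on k S (\<lambda>x. fderiv f x v)" for v
    by (rule Ck_on_cong[OF assms(1) _ assms(3)[of v]])
      (use frechet_derivative_at[OF assms(2)] in auto)
  then show ?thesis using assms(2) by (auto simp: differentiable_def)
qed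

lemma Ck_on_SucD:
  assumes "Ck_on (Suc k) S f"
  shows "x \<in> S \<Longrightarrow> (f has_derivative fderiv f x) (at x)" "Ck_on k S (\<lambda>x. fderiv f x v)"
  using assms differentiable_has_fderiv by auto

lemma Ck_on_Suc_imp: "Ck_on (Suc k) S f \<Longrightarrow> Ck_on k S f"
proof (induction k arbitrary: f)
  case 0 then show ?case
    by (auto intro!: continuous_at_imp_continuous_on differentiable_imp_continuous_within)
next
  case (Suc k) then show ?case by (metis Ck_on.simps(2))
qed

lemma Ck_on_le: "Ck_on k S f \<Longrightarrow> j \<le> k \<Longrightarrow> Ck_on j S f"
  by (induction k) (auto simp: le_Suc_eq simp del: Ck_on.simps dest: Ck_on_Suc_imp)

lemma Ck_on_subset: "Ck_on k S f \<Longrightarrow> T \<subseteq> S \<Longrightarrow> Ck_on k T f"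
  by (induction k arbitrary: f) (auto intro: continuous_on_subset)

lemma Ck_on_UN:
  assumes "\<And>x. x \<in> S \<Longrightarrow> \<exists>U. open U \<and> x \<in> U \<and> Ck_on k U f"
  shows "Ck_on k S f"
  using assms
proof (induction k arbitrary: f)
  case 0 then show ?case
    by (auto intro!: continuous_at_imp_continuous_on) (metis continuous_on_eq_continuous_at)
next
  case (Suc k)
  have "f differentiable (at x)" if "x \<in> S" for x
    using Suc.prems[OF that] by auto
  moreover have "Ck_on k S (\<lambda>x. fderiv f x v)" for v
    by (rule Suc.IH) (use Suc.prems in fastforce)
  ultimately show ?case by simp
qed

lemma Ck_on_const [simp, intro]: "Ck_on k S (\<lambda>x. c)"
  by (induction k arbitrary: c) auto

lemma Ck_on_linear: "bounded_linear f \<Longrightarrow> Ck_on k S f"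
proof (cases k)
  case (Suc j)
  assume f: "bounded_linear f"
  have "fderiv f x = f" for x
    using frechet_derivative_at[OF bounded_linear_imp_has_derivative[OF f]] by metis
  moreover have "f differentiable (at x)" for x
    using bounded_linear_imp_differentiable[OF f] .
  ultimately show ?thesis using Suc by simp
qed (auto simp: linear_continuous_on)

lemma Ck_on_bounded_linear:
  assumes "bounded_linear L" "open S" "Ck_on k S f"
  shows "Ck_on k S (\<lambda>x. L (f x))"
  using assms(3)
proof (induction k arbitrary: f)
  case 0 then show ?case using bounded_linear.continuous_on[OF assms(1)] by auto
next
  case (Suc k)
  show ?case
    by (rule Ck_on_SucI[OF assms(2), where f'="\<lambda>x v. L (fderiv f x v)"])
      (auto intro!: bounded_linear.has_derivative[OF assms(1)] Ck_on_SucD[OF Suc.prems] Suc.IH)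
qed

lemma Ck_on_add:
  assumes "open S" "Ck_on k S f" "Ck_on k S g"
  shows "Ck_on k S (\<lambda>x. f x + g x)"
  using assms(2,3)
proof (induction k arbitrary: f g)
  case 0 then show ?case by (auto intro: continuous_intros)
next
  case (Suc k)
  show ?case
    by (rule Ck_on_SucI[OF assms(1), where f'="\<lambda>x v. fderiv f x v + fderiv g x v"])
      (auto intro!: has_derivative_add Ck_on_SucD[OF Suc.prems(1)] Ck_on_SucD[OF Suc.prems(2)] Suc.IH)
qed

lemma Ck_on_bilinear:
  assumes B: "bounded_bilinear B" and "open S" "Ck_on k S f" "Ck_on k S g"
  shows "Ck_on k S (\<lambda>x. B (f x) (g x))"
  using assms(3,4)
proof (induction k arbitrary: f g)
  case 0 then show ?case using bounded_bilinear.continuous_on[OF B] by auto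
next
  case (Suc k)
  show ?case
  proof (rule Ck_on_SucI[OF assms(2), where f'="\<lambda>x v. B (f x) (fderiv g x v) + B (fderiv f x v) (g x)"])
    show "((\<lambda>x. B (f x) (g x)) has_derivative (\<lambda>v. B (f x) (fderiv g x v) + B (fderiv f x v) (g x))) (at x)"
      if "x \<in> S" for x
      using bounded_bilinear.FDERIV[OF B Ck_on_SucD(1)[OF Suc.prems(1) that] Ck_on_SucD(1)[OF Suc.prems(2) that]] .
    show "Ck_on k S (\<lambda>x. B (f x) (fderiv g x v) + B (fderiv f x v) (g x))" for v
      by (intro Ck_on_add assms(2) Suc.IH Ck_on_SucD[OF Suc.prems(1)] Ck_on_SucD[OF Suc.prems(2)]
          Ck_on_Suc_imp[OF Suc.prems(1)] Ck_on_Suc_imp[OF Suc.prems(2)])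
  qed
qed

lemma Ck_on_sum:
  assumes "open S" "\<And>i. i \<in> A \<Longrightarrow> Ck_on k S (f i)"
  shows "Ck_on k S (\<lambda>x. \<Sum>i\<in>A. f i x)"
proof (cases "finite A")
  case True
  then show ?thesis using assms(2) by (induction A) (auto intro: Ck_on_add assms(1))
qed simp

lemma linear_euclidean_expand:
  fixes f :: "'a::euclidean_space \<Rightarrow> 'b::real_vector"
  assumes "linear f"
  shows "f x = (\<Sum>b\<in>Basis. (x \<bullet> b) *\<^sub>R f b)"
proof -
  have "f x = f (\<Sum>b\<in>Basis. (x \<bullet> b) *\<^sub>R b)" by (simp add: euclidean_representation)
  also have "\<dots> = (\<Sum>b\<in>Basis. (x \<bullet> b) *\<^sub>R f b)"
    by (simp add: linear_sum[OF assms] linear_scale[OF assms])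
  finally show ?thesis .
qed

text \<open>\<open>Ck_on\<close> differentiates in fixed directions only. A direction that moves
  with the point is expanded in the basis, which leaves sums of products with fixed directions; this
  makes the chain rule iterate.\<close>

lemma Ck_on_linear_family:
  fixes A :: "'p::real_normed_vector \<Rightarrow> 'a::euclidean_space \<Rightarrow> 'b::real_normed_vector"
  assumes "open S" "\<And>y. y \<in> S \<Longrightarrow> linear (A y)" "\<And>b. b \<in> Basis \<Longrightarrow> Ck_on k S (\<lambda>y. A y b)" "Ck_on k S w"
  shows "Ck_on k S (\<lambda>y. A y (w y))"
proof (rule Ck_on_cong[OF assms(1)])
  show "(\<Sum>b\<in>Basis. (w y \<bullet> b) *\<^sub>R A y b) = A y (w y)" if "y \<in> S" for y
    using linear_euclidean_expand[OF assms(2)[OF that], of "w y"] by simp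
  show "Ck_on k S (\<lambda>y. \<Sum>b\<in>Basis. (w y \<bullet> b) *\<^sub>R A y b)"
    by (intro Ck_on_sum assms(1) Ck_on_bilinear[OF bounded_bilinear_scaleR] assms(3)
        Ck_on_bounded_linear[OF bounded_linear_inner_left] assms(4))
qed

lemma Ck_on_compose:
  fixes g :: "'b::euclidean_space \<Rightarrow> 'c::real_normed_vector"
  assumes "open S" "open T" "Ck_on k S f" "f ` S \<subseteq> T" "Ck_on k T g"
  shows "Ck_on k S (\<lambda>x. g (f x))"
  using assms(3-5)
proof (induction k arbitrary: g f)
  case 0 then show ?case by (auto intro: continuous_on_compose2)
next
  case (Suc k)
  note f = Ck_on_SucD[OF Suc.prems(1)] and g = Ck_on_SucD[OF Suc.prems(3)]
  show ?case
  proof (rule Ck_on_SucI[OF assms(1), where f'="\<lambda>x v. fderiv g (f x) (fderiv f x v)"])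
    show "((\<lambda>x. g (f x)) has_derivative (\<lambda>v. fderiv g (f x) (fderiv f x v))) (at x)" if "x \<in> S" for x
      using has_derivative_compose[OF f(1)[OF that] g(1)] Suc.prems(2) that by auto
    show "Ck_on k S (\<lambda>x. fderiv g (f x) (fderiv f x v))" for v
    proof (rule Ck_on_linear_family[OF assms(1)])
      show "linear (fderiv g (f y))" if "y \<in> S" for y
        using g(1)[of "f y"] Suc.prems(2) that has_derivative_linear by blast
      show "Ck_on k S (\<lambda>y. fderiv g (f y) b)" for b
        by (rule Suc.IH[OF Ck_on_Suc_imp[OF Suc.prems(1)] Suc.prems(2) g(2)])
    qed (rule f(2))
  qed
qed

lemma smooth_onI: "(\<And>k. Ck_on k S f) \<Longrightarrow> smooth_on S f"
  by (simp add: smooth_on_def)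

lemma smooth_onD: "smooth_on S f \<Longrightarrow> Ck_on k S f"
  by (simp add: smooth_on_def)

lemma smooth_on_has_derivative:
  "smooth_on S f \<Longrightarrow> x \<in> S \<Longrightarrow> (f has_derivative fderiv f x) (at x)"
  by (meson Ck_on_SucD(1) smooth_onD)

lemma smooth_on_differentiable: "smooth_on S f \<Longrightarrow> x \<in> S \<Longrightarrow> f differentiable (at x)"
  using smooth_on_has_derivative differentiable_def by blast

lemma smooth_on_linear_fderiv: "smooth_on S f \<Longrightarrow> x \<in> S \<Longrightarrow> linear (fderiv f x)"
  using smooth_on_has_derivative has_derivative_linear by blast

lemma smooth_on_fderiv_dir: "smooth_on S f \<Longrightarrow> smooth_on S (\<lambda>x. fderiv f x v)"
  unfolding smooth_on_def using Ck_on_SucD(2) by blast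

lemma smooth_on_continuous: "smooth_on S f \<Longrightarrow> continuous_on S f"
  using smooth_onD[of S f 0] by simp

lemma smooth_on_subset: "smooth_on S f \<Longrightarrow> T \<subseteq> S \<Longrightarrow> smooth_on T f"
  by (meson Ck_on_subset smooth_on_def)

lemma smooth_on_cong:
  "open S \<Longrightarrow> (\<And>x. x \<in> S \<Longrightarrow> f x = g x) \<Longrightarrow> smooth_on S f \<Longrightarrow> smooth_on S g"
  by (meson Ck_on_cong smooth_on_def)

text \<open>The derivatives in \<open>Ck_on\<close> are full derivatives at the points of
  \<open>S\<close>, so a cover by open sets suffices even if \<open>S\<close> is not open. This
  serves a closed time interval times an open parameter interval.\<close>

lemma smooth_on_local:
  assumes "\<And>x. x \<in> S \<Longrightarrow> \<exists>U. open U \<and> x \<in> U \<and> smooth_on U f"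
  shows "smooth_on S f"
  using assms by (meson Ck_on_UN smooth_on_def)

lemma smooth_on_const [simp, intro]: "smooth_on S (\<lambda>x. c)"
  by (simp add: smooth_on_def)

lemma smooth_on_bounded_linear:
  "bounded_linear L \<Longrightarrow> open S \<Longrightarrow> smooth_on S f \<Longrightarrow> smooth_on S (\<lambda>x. L (f x))"
  by (simp add: Ck_on_bounded_linear smooth_on_def)

lemma smooth_on_linear: "bounded_linear L \<Longrightarrow> smooth_on S L"
  by (meson Ck_on_linear smooth_on_def)

lemma smooth_on_id: "smooth_on S (\<lambda>x. x)"
  by (rule smooth_on_linear[OF bounded_linear_ident])

lemma smooth_on_add: "open S \<Longrightarrow> smooth_on S f \<Longrightarrow> smooth_on S g \<Longrightarrow> smooth_on S (\<lambda>x. f x + g x)"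
  by (simp add: Ck_on_add smooth_on_def)

lemma smooth_on_bilinear:
  "bounded_bilinear B \<Longrightarrow> open S \<Longrightarrow> smooth_on S f \<Longrightarrow> smooth_on S g \<Longrightarrow> smooth_on S (\<lambda>x. B (f x) (g x))"
  by (simp add: Ck_on_bilinear smooth_on_def)

lemmas smooth_on_scaleR = smooth_on_bilinear[OF bounded_bilinear_scaleR]
lemmas smooth_on_mult = smooth_on_bilinear[OF bounded_bilinear_mult]
  for f g :: "_ \<Rightarrow> real"
lemmas smooth_on_blinfun_apply = smooth_on_bilinear[OF bounded_bilinear_blinfun_apply]

lemma smooth_on_minus: "open S \<Longrightarrow> smooth_on S f \<Longrightarrow> smooth_on S (\<lambda>x. - f x)"
  by (rule smooth_on_bounded_linear[OF bounded_linear_minus[OF bounded_linear_ident]])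

lemma smooth_on_diff: "open S \<Longrightarrow> smooth_on S f \<Longrightarrow> smooth_on S g \<Longrightarrow> smooth_on S (\<lambda>x. f x - g x)"
  using smooth_on_add[OF _ _ smooth_on_minus] by fastforce

lemma smooth_on_Pair:
  assumes "open S" "smooth_on S f" "smooth_on S g"
  shows "smooth_on S (\<lambda>x. (f x, g x))"
proof -
  have "smooth_on S (\<lambda>x. (f x, 0) + (0, g x))"
    by (intro smooth_on_add assms smooth_on_bounded_linear[OF bounded_linear_Pair[OF bounded_linear_ident bounded_linear_zero]]
        smooth_on_bounded_linear[OF bounded_linear_Pair[OF bounded_linear_zero bounded_linear_ident]])
  then show ?thesis by simp
qed

lemma smooth_on_compose:
  fixes g :: "'b::euclidean_space \<Rightarrow> 'c::real_normed_vector"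
  assumes "open S" "open T" "smooth_on S f" "f ` S \<subseteq> T" "smooth_on T g"
  shows "smooth_on S (\<lambda>x. g (f x))"
  using assms by (simp add: Ck_on_compose[OF assms(1,2)] smooth_on_def)

lemma smooth_on_linear_family:
  fixes A :: "'p::real_normed_vector \<Rightarrow> 'a::euclidean_space \<Rightarrow> 'b::real_normed_vector"
  assumes "open S" "\<And>y. y \<in> S \<Longrightarrow> linear (A y)" "\<And>b. b \<in> Basis \<Longrightarrow> smooth_on S (\<lambda>y. A y b)" "smooth_on S w"
  shows "smooth_on S (\<lambda>y. A y (w y))"
  using assms by (simp add: Ck_on_linear_family smooth_on_def)

lemma smooth_on_fderiv:
  fixes f :: "'a::euclidean_space \<Rightarrow> 'b::real_normed_vector"
  assumes "open S" "open T" "smooth_on T f" "smooth_on S g" "g ` S \<subseteq> T" "smooth_on S w"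
  shows "smooth_on S (\<lambda>x. fderiv f (g x) (w x))"
proof (rule smooth_on_linear_family[OF assms(1)])
  show "linear (fderiv f (g y))" if "y \<in> S" for y
    using smooth_on_linear_fderiv[OF assms(3)] assms(5) that by auto
  show "smooth_on S (\<lambda>y. fderiv f (g y) b)" for b
    by (rule smooth_on_compose[OF assms(1,2,4,5) smooth_on_fderiv_dir[OF assms(3)]])
qed (rule assms(6))

lemma vector_derivative_bound:
  fixes \<phi> :: "real \<Rightarrow> 'a::real_normed_vector"
  assumes "a \<le> b" "\<And>r. r \<in> {a..b} \<Longrightarrow> (\<phi> has_vector_derivative \<phi>' r) (at r within {a..b})"
    "\<And>r. r \<in> {a..b} \<Longrightarrow> norm (\<phi>' r) \<le> B"
  shows "norm (\<phi> b - \<phi> a) \<le> B * (b - a)"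
proof -
  have "norm (\<phi> b - \<phi> a) \<le> B * norm (b - a)"
  proof (rule differentiable_bound[of "{a..b}" \<phi> "\<lambda>r t. t *\<^sub>R \<phi>' r"])
    show "(\<phi> has_derivative (\<lambda>t. t *\<^sub>R \<phi>' r)) (at r within {a..b})" if "r \<in> {a..b}" for r
      using assms(2)[OF that] unfolding has_vector_derivative_def .
    show "onorm (\<lambda>t. t *\<^sub>R \<phi>' r) \<le> B" if "r \<in> {a..b}" for r
      by (rule onorm_le) (use mult_right_mono[OF assms(3)[OF that] abs_ge_zero] in \<open>simp add: mult.commute\<close>)
  qed (use assms(1) in auto)
  then show ?thesis using assms(1) by simp
qed

lemma smooth_on_vector_derivative:
  assumes "smooth_on J c" "t \<in> J"
  shows "(c has_vector_derivative fderiv c t 1) (at t)" "vector_derivative c (at t) = fderiv c t 1"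
proof -
  have D: "(c has_derivative fderiv c t) (at t)" using smooth_on_has_derivative[OF assms] .
  have "fderiv c t = (\<lambda>r. r *\<^sub>R fderiv c t 1)"
  proof
    fix r show "fderiv c t r = r *\<^sub>R fderiv c t 1"
      by (metis linear_scale[OF has_derivative_linear[OF D]] mult.right_neutral real_scaleR_def)
  qed
  with D show *: "(c has_vector_derivative fderiv c t 1) (at t)"
    unfolding has_vector_derivative_def by metis
  show "vector_derivative c (at t) = fderiv c t 1" by (rule vector_derivative_at[OF *])
qed

section \<open>Symmetry of second derivatives\<close>

text \<open>With \<open>G\<close> the derivative of \<open>f\<close> in direction \<open>v\<close>,
  the mean value inequality along \<open>v\<close> reduces the second difference to increments of
  \<open>G\<close>, and differentiability of \<open>G\<close> at \<open>x\<close> alone controls the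
  error. The second difference is symmetric in \<open>u\<close> and \<open>v\<close>, which is its
  purpose.\<close>

lemma second_difference:
  fixes f :: "'a::real_normed_vector \<Rightarrow> 'b::real_normed_vector"
  assumes "open S" "smooth_on S f" "x \<in> S" "e > 0"
  shows "\<exists>d>0. \<forall>h. 0 < h \<and> h < d \<longrightarrow>
    norm (f (x + h *\<^sub>R u + h *\<^sub>R v) - f (x + h *\<^sub>R u) - f (x + h *\<^sub>R v) + f x
      - h\<^sup>2 *\<^sub>R fderiv (\<lambda>y. fderiv f y v) x u) \<le> e * h\<^sup>2"
proof -
  define G where "G y = fderiv f y v" for y
  define N where "N = norm u + norm v + 1"
  have N: "N > 0" using norm_ge_zero[of u] norm_ge_zero[of v] by (simp add: N_def add_nonneg_pos)
  have G: "(G has_derivative fderiv G x) (at x)"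
    unfolding G_def using smooth_on_has_derivative[OF smooth_on_fderiv_dir[OF assms(2)] assms(3)] .
  note linG = has_derivative_linear[OF G]
  \<comment> \<open>Two increments of \<open>G\<close> over distances at most \<open>h * N\<close>
    occur, each multiplied by \<open>h\<close>; the errors add up to
    \<open>2 * h * e' * h * N = e * h^2\<close>.\<close>
  define e' where "e' = e / (2 * N)"
  have e': "e' > 0" using assms(4) N by (simp add: e'_def)
  obtain d1 where d1: "d1 > 0" "\<And>y. norm (y - x) < d1 \<Longrightarrow>
      norm (G y - G x - fderiv G x (y - x)) \<le> e' * norm (y - x)"
    using G e' unfolding has_derivative_at_alt by blast
  obtain d2 where d2: "d2 > 0" "ball x d2 \<subseteq> S" using assms(1,3) openE by blast
  define d where "d = min d1 d2 / N"
  have "d > 0" using d1 d2 N by (simp add: d_def)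
  moreover have "norm (f (x + h *\<^sub>R u + h *\<^sub>R v) - f (x + h *\<^sub>R u) - f (x + h *\<^sub>R v) + f x
      - h\<^sup>2 *\<^sub>R fderiv G x u) \<le> e * h\<^sup>2" if h: "0 < h" "h < d" for h
  proof -
    have hN: "h * N < d1" "h * N < d2" using h N by (auto simp: d_def field_simps)
    have nrm: "norm (a *\<^sub>R u + (r * h) *\<^sub>R v) \<le> h * N" if "0 \<le> r" "r \<le> 1" "a = h \<or> a = 0" for r a
    proof -
      have "norm (a *\<^sub>R u + (r * h) *\<^sub>R v) \<le> \<bar>a\<bar> * norm u + \<bar>r * h\<bar> * norm v"
        using norm_triangle_ineq[of "a *\<^sub>R u" "(r * h) *\<^sub>R v"] by simp
      also have "\<dots> \<le> h * norm u + h * norm v"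
        using that h(1) by (intro add_mono mult_right_mono) (auto simp: abs_mult mult_left_le_one_le)
      also have "\<dots> \<le> h * N" using h(1) by (simp add: N_def algebra_simps)
      finally show ?thesis .
    qed
    have inS: "x + (a *\<^sub>R u + (r * h) *\<^sub>R v) \<in> S" if "0 \<le> r" "r \<le> 1" "a = h \<or> a = 0" for r a
    proof -
      have "dist x (x + (a *\<^sub>R u + (r * h) *\<^sub>R v)) < d2"
        using nrm[OF that] hN norm_minus_cancel[of "a *\<^sub>R u + (r * h) *\<^sub>R v"] by (simp add: dist_norm)
      then show ?thesis using d2(2) by (meson mem_ball subsetD)
    qed
    \<comment> \<open>The difference in direction \<open>u\<close>, carried along \<open>v\<close>
      from \<open>r = 0\<close> to \<open>r = 1\<close>. The trivial term
      \<open>0 *\<^sub>R u\<close> brings both values of \<open>f\<close> into the form covered by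
      \<open>der\<close>.\<close>
    define \<phi> where "\<phi> r = f (x + (h *\<^sub>R u + (r * h) *\<^sub>R v)) - f (x + (0 *\<^sub>R u + (r * h) *\<^sub>R v)) - r *\<^sub>R h\<^sup>2 *\<^sub>R fderiv G x u" for r
    define \<phi>' where "\<phi>' r = h *\<^sub>R G (x + (h *\<^sub>R u + (r * h) *\<^sub>R v)) - h *\<^sub>R G (x + (0 *\<^sub>R u + (r * h) *\<^sub>R v)) - h\<^sup>2 *\<^sub>R fderiv G x u" for r
    have der: "((\<lambda>r. f (x + (a *\<^sub>R u + (r * h) *\<^sub>R v))) has_vector_derivative h *\<^sub>R G (x + (a *\<^sub>R u + (r * h) *\<^sub>R v))) (at r)"
      if "0 \<le> r" "r \<le> 1" "a = h \<or> a = 0" for r a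
    proof -
      have fD: "(f has_derivative fderiv f (x + (a *\<^sub>R u + (r * h) *\<^sub>R v))) (at (x + (a *\<^sub>R u + (r * h) *\<^sub>R v)))"
        using smooth_on_has_derivative[OF assms(2) inS[OF that]] .
      have "((\<lambda>r. x + (a *\<^sub>R u + (r * h) *\<^sub>R v)) has_derivative (\<lambda>t. (t * h) *\<^sub>R v)) (at r)"
        by (auto intro!: derivative_eq_intros)
      from has_derivative_compose[OF this fD]
      show ?thesis unfolding has_vector_derivative_def G_def
        using linear_scale[OF has_derivative_linear[OF fD]] by simp
    qed
    have "norm (\<phi> 1 - \<phi> 0) \<le> e * h\<^sup>2 * (1 - 0)"
    proof (rule vector_derivative_bound)
      show "(\<phi> has_vector_derivative \<phi>' r) (at r within {0..1})" if "r \<in> {0..1}" for r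
        unfolding \<phi>_def \<phi>'_def
        using that by (rule_tac has_vector_derivative_at_within, intro has_vector_derivative_diff der)
          (auto intro!: derivative_eq_intros simp: has_vector_derivative_def)
      show "norm (\<phi>' r) \<le> e * h\<^sup>2" if "r \<in> {0..1}" for r
      proof -
        define p where "p = h *\<^sub>R u + (r * h) *\<^sub>R v"
        define q where "q = 0 *\<^sub>R u + (r * h) *\<^sub>R v"
        have np: "norm p \<le> h * N" and nq: "norm q \<le> h * N"
          using nrm[of r h] nrm[of r 0] that unfolding p_def q_def by auto
        have "\<phi>' r = h *\<^sub>R ((G (x + p) - G x - fderiv G x p) - (G (x + q) - G x - fderiv G x q))"
        proof -
          have "fderiv G x p - fderiv G x q = h *\<^sub>R fderiv G x u"
            by (simp add: p_def q_def linear_add[OF linG] linear_scale[OF linG])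
          then show ?thesis unfolding \<phi>'_def p_def[symmetric] q_def[symmetric]
            by (simp add: algebra_simps power2_eq_square)
        qed
        also have "norm \<dots> \<le> h * (norm (G (x + p) - G x - fderiv G x p) + norm (G (x + q) - G x - fderiv G x q))"
          unfolding norm_scaleR using h(1)
          by (intro mult_mono norm_triangle_ineq4) auto
        also have "\<dots> \<le> h * (e' * (h * N) + e' * (h * N))"
        proof (intro mult_left_mono add_mono)
          show "norm (G (x + p) - G x - fderiv G x p) \<le> e' * (h * N)"
            using d1(2)[of "x + p"] np hN e' by (auto elim!: order_trans)
          show "norm (G (x + q) - G x - fderiv G x q) \<le> e' * (h * N)"
            using d1(2)[of "x + q"] nq hN e' by (auto elim!: order_trans)
        qed (use h in simp)
        also have "\<dots> = e * h\<^sup>2" using N by (simp add: e'_def power2_eq_square field_simps)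
        finally show ?thesis .
      qed
    qed simp
    moreover have "\<phi> 1 - \<phi> 0 = f (x + h *\<^sub>R u + h *\<^sub>R v) - f (x + h *\<^sub>R u) - f (x + h *\<^sub>R v) + f x
      - h\<^sup>2 *\<^sub>R fderiv G x u"
      by (simp add: \<phi>_def algebra_simps)
    ultimately show ?thesis by simp
  qed
  ultimately show ?thesis unfolding G_def by blast
qed

text \<open>Both iterated derivatives are approximated by the same second difference divided by
  \<open>h^2\<close>.\<close>

lemma fderiv_symmetric:
  fixes f :: "'a::real_normed_vector \<Rightarrow> 'b::real_normed_vector"
  assumes "open S" "smooth_on S f" "x \<in> S"
  shows "fderiv (\<lambda>y. fderiv f y v) x u = fderiv (\<lambda>y. fderiv f y u) x v"
proof (rule ccontr)
  let ?A = "fderiv (\<lambda>y. fderiv f y v) x u" and ?B = "fderiv (\<lambda>y. fderiv f y u) x v"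
  assume "?A \<noteq> ?B"
  \<comment> \<open>A third of the gap: two errors of size \<open>e\<close> cannot bridge
    \<open>3 * e\<close>.\<close>
  define e where "e = norm (?A - ?B) / 3"
  have e: "e > 0" using \<open>?A \<noteq> ?B\<close> by (simp add: e_def)
  define Q where "Q h = f (x + h *\<^sub>R u + h *\<^sub>R v) - f (x + h *\<^sub>R u) - f (x + h *\<^sub>R v) + f x" for h
  obtain d1 where d1: "d1 > 0" "\<And>h. 0 < h \<Longrightarrow> h < d1 \<Longrightarrow> norm (Q h - h\<^sup>2 *\<^sub>R ?A) \<le> e * h\<^sup>2"
    using second_difference[OF assms e, of u v] unfolding Q_def by blast
  obtain d2 where d2: "d2 > 0" "\<And>h. 0 < h \<Longrightarrow> h < d2 \<Longrightarrow> norm (Q h - h\<^sup>2 *\<^sub>R ?B) \<le> e * h\<^sup>2"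
  proof -
    obtain d2 where *: "d2 > 0" "\<And>h. 0 < h \<and> h < d2 \<longrightarrow> norm (f (x + h *\<^sub>R v + h *\<^sub>R u) - f (x + h *\<^sub>R v) - f (x + h *\<^sub>R u) + f x - h\<^sup>2 *\<^sub>R ?B) \<le> e * h\<^sup>2"
      using second_difference[OF assms e, of v u] by blast
    have Q: "f (x + h *\<^sub>R v + h *\<^sub>R u) - f (x + h *\<^sub>R v) - f (x + h *\<^sub>R u) + f x = Q h" for h
      by (simp add: Q_def algebra_simps)
    show ?thesis using that[OF *(1)] *(2) unfolding Q by blast
  qed
  define h where "h = min d1 d2 / 2"
  have h: "0 < h" "h < d1" "h < d2" using d1(1) d2(1) by (auto simp: h_def)
  have "h\<^sup>2 * (3 * e) = norm ((Q h - h\<^sup>2 *\<^sub>R ?B) - (Q h - h\<^sup>2 *\<^sub>R ?A))"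
    by (simp add: e_def flip: scaleR_diff_right)
  also have "\<dots> \<le> e * h\<^sup>2 + e * h\<^sup>2"
    using norm_triangle_ineq4[of "Q h - h\<^sup>2 *\<^sub>R ?B" "Q h - h\<^sup>2 *\<^sub>R ?A"] d1(2)[OF h(1,2)] d2(2)[OF h(1,3)] by linarith
  finally have "h\<^sup>2 * e \<le> 0" by (simp add: algebra_simps)
  then show False using e h(1) by (simp add: mult_le_0_iff)
qed

section \<open>The inverse function theorem for smooth maps\<close>

text \<open>The factor \<open>c\<close> is only continuous: as \<open>h\<close> vanishes at
  \<open>y\<close>, the term of the product rule with the derivative of \<open>c\<close> is absent.
  This differentiates an inverse that is so far known to be continuous only.\<close>

lemma has_derivative_scaleR_at_zero:
  fixes c :: "'a::real_normed_vector \<Rightarrow> real" and h :: "'a \<Rightarrow> 'b::real_normed_vector"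
  assumes c: "isCont c y" and h: "(h has_derivative h') (at y)" and "h y = 0"
  shows "((\<lambda>x. c x *\<^sub>R h x) has_derivative (\<lambda>v. c y *\<^sub>R h' v)) (at y)"
proof -
  interpret h': bounded_linear h' using h by (rule has_derivative_bounded_linear)
  obtain K where K: "K > 0" "\<And>v. norm (h' v) \<le> norm v * K" using h'.pos_bounded by blast
  have "\<exists>d>0. \<forall>x. norm (x - y) < d \<longrightarrow> norm (c x *\<^sub>R h x - c y *\<^sub>R h y - c y *\<^sub>R h' (x - y)) \<le> e * norm (x - y)"
    if e: "e > 0" for e
  proof -
    define e1 where "e1 = e / (2 * (1 + K))"
    define e2 where "e2 = min 1 (e / (2 * (\<bar>c y\<bar> + 1)))"
    have e12: "e1 > 0" "e2 > 0" using e K by (auto simp: e1_def e2_def)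
    obtain d1 where d1: "d1 > 0" "\<And>x. norm (x - y) < d1 \<Longrightarrow> \<bar>c x - c y\<bar> < e1"
      using c e12(1) unfolding continuous_at_eps_delta dist_norm real_norm_def by blast
    obtain d2 where d2: "d2 > 0" "\<And>x. norm (x - y) < d2 \<Longrightarrow> norm (h x - h y - h' (x - y)) \<le> e2 * norm (x - y)"
      using h e12(2) unfolding has_derivative_at_alt by blast
    have "norm (c x *\<^sub>R h x - c y *\<^sub>R h y - c y *\<^sub>R h' (x - y)) \<le> e * norm (x - y)"
      if x: "norm (x - y) < min d1 d2" for x
    proof -
      let ?n = "norm (x - y)"
      have r: "norm (h x - h' (x - y)) \<le> e2 * ?n" using d2(2)[of x] x assms(3) by simp
      have "norm (h x) \<le> norm (h x - h' (x - y)) + norm (h' (x - y))"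
        using norm_triangle_ineq[of "h x - h' (x - y)" "h' (x - y)"] by simp
      also have "\<dots> \<le> e2 * ?n + ?n * K" using r K(2) by (meson add_mono)
      also have "\<dots> \<le> 1 * ?n + ?n * K" by (intro add_mono mult_right_mono order_refl) (auto simp: e2_def)
      finally have hx: "norm (h x) \<le> ?n * (1 + K)" by (simp add: algebra_simps)
      have "c x *\<^sub>R h x - c y *\<^sub>R h y - c y *\<^sub>R h' (x - y) = (c x - c y) *\<^sub>R h x + c y *\<^sub>R (h x - h' (x - y))"
        using assms(3) by (simp add: algebra_simps)
      also have "norm \<dots> \<le> \<bar>c x - c y\<bar> * norm (h x) + \<bar>c y\<bar> * norm (h x - h' (x - y))"
        using norm_triangle_ineq[of "(c x - c y) *\<^sub>R h x" "c y *\<^sub>R (h x - h' (x - y))"] by simp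
      also have "\<dots> \<le> e1 * (?n * (1 + K)) + (\<bar>c y\<bar> + 1) * (e / (2 * (\<bar>c y\<bar> + 1)) * ?n)"
      proof (intro add_mono mult_mono hx)
        show "norm (h x - h' (x - y)) \<le> e / (2 * (\<bar>c y\<bar> + 1)) * ?n"
          using r by (rule order_trans) (intro mult_right_mono, auto simp only: e2_def min.cobounded2 norm_ge_zero)
      qed (use d1(2)[of x] x e12 K in auto)
      also have "\<dots> = e * ?n"
      proof -
        have 1: "e1 * (?n * (1 + K)) = e * ?n / 2" using K(1) by (simp add: e1_def field_simps)
        have 2: "(\<bar>c y\<bar> + 1) * (e / (2 * (\<bar>c y\<bar> + 1)) * ?n) = e * ?n / 2"
        proof -
          have "\<bar>c y\<bar> + 1 \<noteq> 0" by linarith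
          then show ?thesis by (simp add: divide_simps)
        qed
        show ?thesis unfolding 1 2 by simp
      qed
      finally show ?thesis .
    qed
    moreover have "min d1 d2 > 0" using d1 d2 by simp
    ultimately show ?thesis by blast
  qed
  then show ?thesis unfolding has_derivative_at_alt
    by (auto intro: bounded_linear_const_scaleR h'.bounded_linear_axioms)
qed

text \<open>Resolvent identity: \<open>B y w - B y0 w = - B y0 ((A y - A y0) (B y w))\<close>. It
  gives first continuity and then the derivative \<open>- B A' B\<close>, which involves only
  \<open>B\<close> and the derivative of \<open>A\<close>, so that one order of smoothness is gained
  in each step.\<close>

lemma Ck_on_inverse_family:
  fixes A B :: "'p::real_normed_vector \<Rightarrow> 'a::euclidean_space \<Rightarrow> 'a"
  assumes S: "open S" and linA: "\<And>y. y \<in> S \<Longrightarrow> linear (A y)" and linB: "\<And>y. y \<in> S \<Longrightarrow> linear (B y)"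
    and AB: "\<And>y w. y \<in> S \<Longrightarrow> A y (B y w) = w" and BA: "\<And>y w. y \<in> S \<Longrightarrow> B y (A y w) = w"
    and A: "\<And>v. Ck_on k S (\<lambda>y. A y v)"
  shows "Ck_on k S (\<lambda>y. B y w)"
  using A
proof (induction k arbitrary: w)
  case 0
  have "isCont (\<lambda>y. B y w) y0" if y0: "y0 \<in> S" for y0
  proof -
    have "bounded_linear (B y0)" using linB[OF y0] linear_conv_bounded_linear by blast
    then obtain K where K: "K > 0" "\<And>v. norm (B y0 v) \<le> norm v * K"
      using bounded_linear.pos_bounded by blast
    \<comment> \<open>A bound for the operator norm of \<open>A y - A y0\<close> in terms of values
      on the basis, which are continuous in \<open>y\<close> by assumption.\<close>
    define \<epsilon> where "\<epsilon> y = (\<Sum>b\<in>Basis. norm (A y b - A y0 b))" for y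
    have "isCont (\<lambda>y. A y b) y0" for b
      using 0 S y0 continuous_on_eq_continuous_at by fastforce
    then have "isCont \<epsilon> y0" unfolding \<epsilon>_def by (intro continuous_intros)
    moreover have "\<epsilon> y0 = 0" by (simp add: \<epsilon>_def)
    ultimately have \<epsilon>0: "(\<epsilon> \<longlongrightarrow> 0) (at y0)" by (simp add: isCont_def)
    have bd: "norm (A y z - A y0 z) \<le> \<epsilon> y * norm z" if "y \<in> S" for y z
    proof -
      have "A y z - A y0 z = (\<Sum>b\<in>Basis. (z \<bullet> b) *\<^sub>R (A y b - A y0 b))"
        by (subst linear_euclidean_expand[OF linA[OF that]], subst linear_euclidean_expand[OF linA[OF y0]])
          (simp add: scaleR_diff_right sum_subtractf)
      also have "norm \<dots> \<le> (\<Sum>b\<in>Basis. norm z * norm (A y b - A y0 b))"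
        by (intro sum_norm_le) (simp add: Basis_le_norm mult_right_mono)
      finally show ?thesis by (simp add: \<epsilon>_def sum_distrib_left mult.commute)
    qed
    have ev: "\<forall>\<^sub>F y in at y0. norm (B y w - B y0 w) \<le> \<epsilon> y * (K * (2 * norm (B y0 w)))"
    proof -
      have "\<forall>\<^sub>F y in at y0. y \<in> S" using S y0 eventually_at_topological by blast
      moreover have "\<forall>\<^sub>F y in at y0. \<epsilon> y < 1 / (2 * K)"
        using \<epsilon>0 K(1) by (intro order_tendstoD(2)[OF \<epsilon>0]) simp
      ultimately show ?thesis
      proof eventually_elim
        case (elim y)
        define z where "z = B y w"
        have "z - B y0 w = - B y0 (A y z - A y0 z)"
          using AB[OF elim(1)] BA[OF y0] by (simp add: z_def linear_diff[OF linB[OF y0]])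
        then have 1: "norm (z - B y0 w) \<le> norm (A y z - A y0 z) * K" using K(2) by simp
        also have "\<dots> \<le> \<epsilon> y * norm z * K" using bd[OF elim(1)] K(1) by (intro mult_right_mono) auto
        finally have 2: "norm (z - B y0 w) \<le> \<epsilon> y * norm z * K" .
        have "\<epsilon> y * K \<le> 1 / 2" using elim(2) K(1) by (simp add: field_simps)
        then have "\<epsilon> y * norm z * K \<le> norm z / 2"
          using mult_right_mono[OF _ norm_ge_zero, of "\<epsilon> y * K" "1 / 2" z] by (simp add: algebra_simps)
        then have "norm z \<le> 2 * norm (B y0 w)"
          using 2 norm_triangle_sub[of z "B y0 w"] by linarith
        moreover have "0 \<le> \<epsilon> y" by (simp add: \<epsilon>_def sum_nonneg)
        ultimately have "\<epsilon> y * K * norm z \<le> \<epsilon> y * K * (2 * norm (B y0 w))"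
          using K(1) by (intro mult_left_mono) auto
        with 2 show ?case by (simp add: z_def algebra_simps)
      qed
    qed
    have "((\<lambda>y. B y w - B y0 w) \<longlongrightarrow> 0) (at y0)"
      by (rule Lim_null_comparison[OF ev]) (use \<epsilon>0 in \<open>auto intro!: tendsto_mult_left_zero\<close>)
    then show ?thesis by (simp add: isCont_def LIM_zero_iff)
  qed
  then show ?case using continuous_at_imp_continuous_on by auto
next
  case (Suc k)
  note Ak = Ck_on_SucD[OF Suc.prems]
  have IH: "Ck_on k S (\<lambda>y. B y w)" for w
    by (rule Suc.IH) (rule Ck_on_Suc_imp[OF Suc.prems])
  define R where "R y v w = (\<Sum>b\<in>Basis. (B y w \<bullet> b) *\<^sub>R fderiv (\<lambda>y. A y b) y v)" for y v w
  show ?case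
  proof (rule Ck_on_SucI[OF S, where f'="\<lambda>y v. - B y (R y v w)"])
    fix y0 assume y0: "y0 \<in> S"
    have cont: "isCont (\<lambda>y. B y w) y0"
      using Ck_on_le[OF IH] S y0 continuous_on_eq_continuous_at by fastforce
    have lb: "bounded_linear (B y0)" using linB[OF y0] linear_conv_bounded_linear by blast
    \<comment> \<open>The coefficients \<open>B y w \<bullet> b\<close> are only continuous here,
      but each multiplies a map that vanishes at \<open>y0\<close>.\<close>
    have "((\<lambda>y. \<Sum>b\<in>Basis. (B y w \<bullet> b) *\<^sub>R (A y b - A y0 b)) has_derivative (\<lambda>v. R y0 v w)) (at y0)"
      unfolding R_def
      by (intro has_derivative_sum has_derivative_scaleR_at_zero continuous_intros cont)
        (auto intro!: derivative_eq_intros Ak(1)[OF y0])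
    then have "((\<lambda>y. B y0 w - B y0 (\<Sum>b\<in>Basis. (B y w \<bullet> b) *\<^sub>R (A y b - A y0 b)))
        has_derivative (\<lambda>v. 0 - B y0 (R y0 v w))) (at y0)"
      by (intro has_derivative_diff has_derivative_const bounded_linear.has_derivative[OF lb])
    moreover have "B y0 w - B y0 (\<Sum>b\<in>Basis. (B y w \<bullet> b) *\<^sub>R (A y b - A y0 b)) = B y w" if "y \<in> S" for y
    proof -
      have "(\<Sum>b\<in>Basis. (B y w \<bullet> b) *\<^sub>R (A y b - A y0 b)) = A y (B y w) - A y0 (B y w)"
        by (subst linear_euclidean_expand[OF linA[OF that], of "B y w"], subst linear_euclidean_expand[OF linA[OF y0], of "B y w"])
          (simp add: scaleR_diff_right sum_subtractf)
      then show ?thesis using AB[OF that] BA[OF y0] by (simp add: linear_diff[OF linB[OF y0]])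
    qed
    ultimately show "((\<lambda>y. B y w) has_derivative (\<lambda>v. - B y0 (R y0 v w))) (at y0)"
      using has_derivative_transform_within_open[OF _ S y0] by fastforce
  next
    fix v
    have "Ck_on k S (\<lambda>y. B y (R y v w))"
    proof (rule Ck_on_linear_family[OF S linB])
      show "Ck_on k S (\<lambda>y. R y v w)" unfolding R_def
        by (intro Ck_on_sum S Ck_on_bilinear[OF bounded_bilinear_scaleR]
            Ck_on_bounded_linear[OF bounded_linear_inner_left] IH Ak(2))
    qed (auto intro: IH)
    then show "Ck_on k S (\<lambda>y. - B y (R y v w))"
      by (rule Ck_on_bounded_linear[OF bounded_linear_minus[OF bounded_linear_ident] S])
  qed
qed

text \<open>The inverse function theorem yields a differentiable inverse \<open>g\<close> whose
  derivative at \<open>y\<close> is the inverse of that of \<open>f\<close> at \<open>g y\<close>.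
  If \<open>g\<close> is \<open>C^k\<close>, so is this family of inverses, hence \<open>g\<close>
  is \<open>C^(k+1)\<close>.\<close>

lemma smooth_local_diffeo:
  fixes f :: "'a::euclidean_space \<Rightarrow> 'a"
  assumes "open U" "smooth_on U f" "x0 \<in> U" "inj (fderiv f x0)"
  obtains U' V g where "open U'" "U' \<subseteq> U" "x0 \<in> U'" "open V" "f x0 \<in> V"
    "homeomorphism U' V f g" "smooth_on V g"
proof -
  define f' where "f' x = Blinfun (fderiv f x)" for x
  have f': "blinfun_apply (f' x) = fderiv f x" if "x \<in> U" for x
    unfolding f'_def using smooth_on_has_derivative[OF assms(2) that]
    by (simp add: bounded_linear_Blinfun_apply has_derivative_bounded_linear)
  have derf: "(f has_derivative blinfun_apply (f' x)) (at x)" if "x \<in> U" for x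
    using smooth_on_has_derivative[OF assms(2) that] f'[OF that] by simp
  have contf: "continuous_on U f'"
  proof (rule continuous_on_blinfun_componentwise)
    fix i :: 'a
    show "continuous_on U (\<lambda>x. blinfun_apply (f' x) i)"
      using smooth_on_continuous[OF smooth_on_fderiv_dir[OF assms(2), of i]] continuous_on_cong f' by fastforce
  qed
  obtain h where h: "linear h" "h \<circ> fderiv f x0 = id"
    using linear_injective_left_inverse[OF smooth_on_linear_fderiv[OF assms(2,3)] assms(4)] by blast
  have invf: "Blinfun h o\<^sub>L f' x0 = id_blinfun"
    using h by (intro blinfun_eqI) (simp add: bounded_linear_Blinfun_apply linear_conv_bounded_linear[symmetric]
        f'[OF assms(3)] fun_eq_iff)
  obtain U' V g g' where *: "open U'" "U' \<subseteq> U" "x0 \<in> U'" "open V" "f x0 \<in> V"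
    "homeomorphism U' V f g" "\<And>y. y \<in> V \<Longrightarrow> (g has_derivative g' y) (at y)"
    "\<And>y. y \<in> V \<Longrightarrow> g' y = inv (blinfun_apply (f' (g y)))"
    "\<And>y. y \<in> V \<Longrightarrow> bij (blinfun_apply (f' (g y)))"
    using inverse_function_theorem[OF assms(1) derf contf assms(3) invf] by metis
  have gU: "g ` V \<subseteq> U" using *(2,6) by (auto simp: homeomorphism_def)
  have "Ck_on k V g" for k
  proof (induction k)
    case 0 then show ?case using *(6) by (simp add: homeomorphism_def)
  next
    case (Suc k)
    show ?case
    proof (rule Ck_on_SucI[OF *(4) *(7)])
      show "Ck_on k V (\<lambda>y. g' y v)" for v
      proof (rule Ck_on_inverse_family[OF *(4)])
        show "linear (blinfun_apply (f' (g y)))" for y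
          using blinfun.bounded_linear_right bounded_linear.linear by blast
        show "linear (g' y)" if "y \<in> V" for y using *(7)[OF that] has_derivative_linear by blast
        show "blinfun_apply (f' (g y)) (g' y w) = w" if "y \<in> V" for y w
          using *(8,9)[OF that] by (simp add: bij_is_surj surj_f_inv_f)
        show "g' y (blinfun_apply (f' (g y)) w) = w" if "y \<in> V" for y w
          using *(8,9)[OF that] by (simp add: bij_is_inj)
        show "Ck_on k V (\<lambda>y. blinfun_apply (f' (g y)) v)" for v
          by (rule Ck_on_cong[OF *(4) _ Ck_on_compose[OF *(4) assms(1) Suc.IH gU
                smooth_onD[OF smooth_on_fderiv_dir[OF assms(2), of v]]]])
            (use f' gU in auto)
      qed
    qed
  qed
  then show ?thesis using that[OF *(1-6)] by (simp add: smooth_on_def)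
qed

text \<open>
  Near \<open>p0\<close> the solution of \<open>f (\<Lambda> (x, q)) = x\<close> is found on the affine plane through \<open>q\<close> in the
  direction of a complement of the kernel, by inverting \<open>p + A (f p - Df(p0) p)\<close>, whose
  differential at \<open>p0\<close> is the identity.
\<close>

lemma smooth_submersion_lift:
  fixes f :: "'a::euclidean_space \<Rightarrow> 'b::euclidean_space"
  assumes S: "open S" and f: "smooth_on S f" and p0: "p0 \<in> S"
    and A: "linear A" "\<And>y. fderiv f p0 (A y) = y"
  obtains N \<Lambda> where "open N" "(f p0, p0) \<in> N" "smooth_on N \<Lambda>" "\<Lambda> ` N \<subseteq> S"
    "\<And>x q. (x, q) \<in> N \<Longrightarrow> f (\<Lambda> (x, q)) = x"
    "\<And>x q. (x, q) \<in> N \<Longrightarrow> \<Lambda> (x, q) - q \<in> range A"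
    "\<And>x q. (x, q) \<in> N \<Longrightarrow> f q = x \<Longrightarrow> \<Lambda> (x, q) = q"
proof -
  let ?D = "fderiv f p0"
  have linD: "linear ?D" by (rule smooth_on_linear_fderiv[OF f p0])
  have blA: "bounded_linear A" and blD: "bounded_linear ?D"
    using A(1) linD linear_conv_bounded_linear by blast+
  define \<phi> where "\<phi> p = p + A (f p - ?D p)" for p
  have \<phi>: "smooth_on S \<phi>" unfolding \<phi>_def
    by (intro smooth_on_add smooth_on_id S smooth_on_bounded_linear[OF blA] smooth_on_diff f
        smooth_on_linear[OF blD])
  have "(\<phi> has_derivative (\<lambda>v. v + A (?D v - ?D v))) (at p0)"
    unfolding \<phi>_def
    by (intro has_derivative_add has_derivative_ident bounded_linear.has_derivative[OF blA]
        has_derivative_diff smooth_on_has_derivative[OF f p0] bounded_linear_imp_has_derivative[OF blD])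
  then have "fderiv \<phi> p0 = (\<lambda>v. v)"
    using frechet_derivative_at linear_0[OF A(1)] by force
  then have "inj (fderiv \<phi> p0)" by (simp add: inj_on_def)
  then obtain U' V g where g: "open U'" "U' \<subseteq> S" "p0 \<in> U'" "open V" "\<phi> p0 \<in> V"
    "homeomorphism U' V \<phi> g" "smooth_on V g"
    using smooth_local_diffeo[OF S \<phi> p0] by blast
  \<comment> \<open>If \<open>p = q + A y\<close> satisfies \<open>f p = x\<close>, then
    \<open>\<phi> p = A x + (q - A (?D q))\<close>, because \<open>?D (A y) = y\<close>. The right
    side is known from \<open>x\<close> and \<open>q\<close>, so inverting \<open>\<phi>\<close>
    finds \<open>p\<close>.\<close>
  define m where "m = (\<lambda>(x, q). A x + (q - A (?D q)))"
  have m: "smooth_on W m" if "open W" for W :: "('b \<times> 'a) set"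
  proof -
    have "bounded_linear m" unfolding m_def split_def
      by (intro bounded_linear_add bounded_linear_sub bounded_linear_compose[OF blA]
          bounded_linear_compose[OF blD] bounded_linear_fst bounded_linear_snd)
    then show ?thesis by (rule smooth_on_linear)
  qed
  have D\<phi>: "?D (\<phi> p) = f p" for p
    by (simp add: \<phi>_def linear_add[OF linD] A(2))
  define N where "N = (m -` V) \<inter> (UNIV \<times> U')"
  define \<Lambda> where "\<Lambda> z = g (m z)" for z
  have contm: "continuous_on UNIV m" using smooth_on_continuous[OF m] by blast
  have N: "open N" unfolding N_def
    by (intro open_Int open_Times open_UNIV g(1) open_vimage g(4) contm)
  have m\<phi>: "m (f q, q) = \<phi> q" for q by (simp add: m_def \<phi>_def linear_diff[OF A(1)])
  have \<phi>g: "\<phi> (\<Lambda> z) = m z" and gU: "\<Lambda> z \<in> U'" if "z \<in> N" for z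
    using that g(6) by (auto simp: N_def \<Lambda>_def homeomorphism_def)
  have Dm: "?D (m (x, q)) = x" for x q
    by (simp add: m_def linear_add[OF linD] linear_diff[OF linD] A(2))
  show ?thesis
  proof (rule that[of N \<Lambda>])
    show "(f p0, p0) \<in> N" using g m\<phi> by (simp add: N_def)
    show "smooth_on N \<Lambda>" unfolding \<Lambda>_def
      by (rule smooth_on_compose[OF N g(4) m[OF N] _ g(7)]) (auto simp: N_def)
    show "\<Lambda> ` N \<subseteq> S" using gU g(2) by blast
    show 1: "f (\<Lambda> (x, q)) = x" if "(x, q) \<in> N" for x q
      using D\<phi>[of "\<Lambda> (x, q)"] \<phi>g[OF that] Dm by simp
    show "\<Lambda> (x, q) - q \<in> range A" if "(x, q) \<in> N" for x q
    proof -
      have "\<Lambda> (x, q) + A (f (\<Lambda> (x, q)) - ?D (\<Lambda> (x, q))) = A x + (q - A (?D q))"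
        using \<phi>g[OF that] by (simp add: \<phi>_def m_def)
      then have "\<Lambda> (x, q) - q = A (x - ?D q - (f (\<Lambda> (x, q)) - ?D (\<Lambda> (x, q))))"
        by (simp add: linear_diff[OF A(1)] linear_add[OF A(1)] algebra_simps)
      then show ?thesis by blast
    qed
    show "\<Lambda> (x, q) = q" if "(x, q) \<in> N" "f q = x" for x q
    proof -
      have "\<phi> (\<Lambda> (x, q)) = \<phi> q" using \<phi>g[OF that(1)] m\<phi> that(2) by metis
      moreover have "q \<in> U'" using that(1) by (simp add: N_def)
      ultimately show ?thesis using gU[OF that(1)] g(6) by (metis homeomorphism_apply1)
    qed
  qed (rule N)
qed

section \<open>Pullback of 1-forms\<close>

lemma fderiv_blinfun_apply:
  assumes "(F has_derivative F') (at x)" "(w has_derivative w') (at x)"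
  shows "fderiv (\<lambda>z. blinfun_apply (F z) (w z)) x u = blinfun_apply (F x) (w' u) + blinfun_apply (F' u) (w x)"
  using frechet_derivative_at[OF bounded_bilinear.FDERIV[OF bounded_bilinear_blinfun_apply assms]]
  by metis

lemma fderiv_compose:
  assumes "(f has_derivative f') (at x)" "(g has_derivative g') (at (f x))"
  shows "fderiv (\<lambda>z. g (f z)) x u = g' (f' u)"
  using frechet_derivative_at[OF has_derivative_compose[OF assms]] by metis

text \<open>The second derivatives of \<open>f\<close> enter both terms symmetrically and cancel.
  The directions \<open>u\<close> and \<open>v\<close> are constant in the source, so no Lie bracket
  occurs.\<close>

lemma ext_d_pullback:
  fixes \<omega> :: "'a::euclidean_space \<Rightarrow> 'a covector" and f :: "'c::euclidean_space \<Rightarrow> 'a"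
  assumes "open S" "smooth_on S f" "z \<in> S" "(\<omega> has_derivative \<omega>') (at (f z))"
  shows "fderiv (\<lambda>z. blinfun_apply (\<omega> (f z)) (fderiv f z v)) z u
       - fderiv (\<lambda>z. blinfun_apply (\<omega> (f z)) (fderiv f z u)) z v
       = blinfun_apply (blinfun_apply (ext_d \<omega> (f z)) (fderiv f z u)) (fderiv f z v)"
proof -
  note fz = smooth_on_has_derivative[OF assms(2,3)]
  have D: "fderiv (\<lambda>z. blinfun_apply (\<omega> (f z)) (fderiv f z v)) z u
      = blinfun_apply (\<omega> (f z)) (fderiv (\<lambda>z. fderiv f z v) z u) + blinfun_apply (\<omega>' (fderiv f z u)) (fderiv f z v)" for u v
    by (rule fderiv_blinfun_apply[OF has_derivative_compose[OF fz assms(4)]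
          smooth_on_has_derivative[OF smooth_on_fderiv_dir[OF assms(2)] assms(3)]])
  have "\<omega> differentiable (at (f z))" using assms(4) differentiable_def by blast
  moreover have "fderiv \<omega> (f z) = \<omega>'" using frechet_derivative_at[OF assms(4)] by simp
  ultimately show ?thesis
    by (simp add: D ext_d_apply fderiv_symmetric[OF assms(1-3), of v u])
qed

text \<open>This is \<open>d(d\<omega>) = 0\<close> on constant vector fields: the six second
  derivatives cancel in pairs by symmetry.\<close>

lemma ext_d_closed:
  fixes \<omega> :: "'a::euclidean_space \<Rightarrow> 'a covector"
  assumes "open S" "smooth_on S \<omega>" "x \<in> S"
  shows "fderiv (\<lambda>y. blinfun_apply (blinfun_apply (ext_d \<omega> y) v) w) x u
       + fderiv (\<lambda>y. blinfun_apply (blinfun_apply (ext_d \<omega> y) w) u) x v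
       + fderiv (\<lambda>y. blinfun_apply (blinfun_apply (ext_d \<omega> y) u) v) x w = 0"
proof -
  define Z where "Z v u = fderiv (\<lambda>y. fderiv \<omega> y v) x u" for u v
  have sym: "Z v u = Z u v" for u v
    unfolding Z_def by (rule fderiv_symmetric[OF assms])
  have E: "fderiv (\<lambda>y. blinfun_apply (blinfun_apply (ext_d \<omega> y) v) w) x u
      = blinfun_apply (Z v u) w - blinfun_apply (Z w u) v" for u v w
  proof -
    have Zd: "((\<lambda>y. fderiv \<omega> y v) has_derivative Z v) (at x)" for v
      unfolding Z_def using smooth_on_has_derivative[OF smooth_on_fderiv_dir[OF assms(2)] assms(3)] .
    have 1: "fderiv (\<lambda>y. blinfun_apply (blinfun_apply (ext_d \<omega> y) v) w) x
        = fderiv (\<lambda>y. blinfun_apply (fderiv \<omega> y v) w - blinfun_apply (fderiv \<omega> y w) v) x"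
      by (rule frechet_derivative_cong_open[OF assms(1,3)])
        (simp add: ext_d_apply smooth_on_differentiable[OF assms(2)])
    have 2: "((\<lambda>y. blinfun_apply (fderiv \<omega> y v) w - blinfun_apply (fderiv \<omega> y w) v) has_derivative
        (\<lambda>u. blinfun_apply (Z v u) w - blinfun_apply (Z w u) v)) (at x)"
      by (intro has_derivative_diff bounded_linear.has_derivative[OF blinfun.bounded_linear_left] Zd)
    show ?thesis unfolding 1 frechet_derivative_at[OF 2, symmetric] ..
  qed
  show ?thesis unfolding E using sym[of u v] sym[of u w] sym[of v w] by simp
qed

section \<open>Smooth bump functions\<close>

text \<open>The functions \<open>h n\<close> are closed under differentiation up to linear
  combinations, which turns smoothness of \<open>exp (- 1 / x)\<close>, extended by zero, into an
  induction over all \<open>n\<close> at once.\<close>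

lemma has_derivative_smooth_step:
  defines "h \<equiv> \<lambda>n x::real. if x > 0 then exp (- 1 / x) / x ^ n else 0"
  shows "(h n has_real_derivative h (n + 2) x - real n * h (n + 1) x) (at x)"
proof -
  consider "x > 0" | "x < 0" | "x = 0" by linarith
  then show ?thesis
  proof cases
    case 1
    have "((\<lambda>x. exp (- 1 / x) / x ^ n) has_real_derivative h (n + 2) x - real n * h (n + 1) x) (at x)"
    proof (rule DERIV_cong)
      show "((\<lambda>x. exp (- 1 / x) / x ^ n) has_real_derivative
          (exp (- 1 / x) * (1 / x\<^sup>2) * x ^ n - exp (- 1 / x) * (real n * x ^ (n - 1))) / (x ^ n * x ^ n)) (at x)"
        using 1 by (auto intro!: derivative_eq_intros simp: power2_eq_square)
      have "real n * x ^ (n - 1) = real n * (x ^ n / x)" using 1 by (cases n) auto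
      then show "(exp (- 1 / x) * (1 / x\<^sup>2) * x ^ n - exp (- 1 / x) * (real n * x ^ (n - 1))) / (x ^ n * x ^ n)
          = h (n + 2) x - real n * h (n + 1) x"
        using 1 by (simp add: h_def divide_simps power2_eq_square) (auto simp: algebra_simps)
    qed
    then show ?thesis
      by (rule has_field_derivative_transform_within_open[of _ _ _ "{0<..}"]) (use 1 in \<open>auto simp: h_def\<close>)
  next
    case 2
    have "((\<lambda>x. 0) has_real_derivative h (n + 2) x - real n * h (n + 1) x) (at x)"
      using 2 by (simp add: h_def)
    then show ?thesis
      by (rule has_field_derivative_transform_within_open[of _ _ _ "{..<0}"]) (use 2 in \<open>auto simp: h_def\<close>)
  next
    case 3
    have lim: "((\<lambda>y. h n y / y) \<longlongrightarrow> 0) (at 0)"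
    proof (rule filterlim_split_at)
      show "((\<lambda>y. h n y / y) \<longlongrightarrow> 0) (at_left 0)"
        by (rule tendsto_eventually) (auto simp: h_def eventually_at_left_field intro!: exI[of _ "-1"])
      have "((\<lambda>t::real. t ^ (n + 1) / exp t) \<longlongrightarrow> 0) at_top" by (rule tendsto_power_div_exp_0)
      then have "((\<lambda>y::real. inverse y ^ (n + 1) / exp (inverse y)) \<longlongrightarrow> 0) (at_right 0)"
        using filterlim_compose[OF _ filterlim_inverse_at_top_right] by blast
      then show "((\<lambda>y. h n y / y) \<longlongrightarrow> 0) (at_right 0)"
        by (rule Lim_transform_eventually)
          (auto simp: h_def eventually_at_right_field exp_minus field_simps intro!: exI[of _ 1])
    qed
    then show ?thesis unfolding 3 has_field_derivative_iff by (simp add: h_def)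
  qed
qed

lemma smooth_step: "smooth_on S (\<lambda>x::real. if x > 0 then exp (- 1 / x) else 0)"
proof -
  define h where "h = (\<lambda>n (x::real). if x > 0 then exp (- 1 / x) / x ^ n else (0::real))"
  have "Ck_on k UNIV (h n)" for k n
  proof (induction k arbitrary: n)
    case 0
    have "isCont (h n) x" for x
      using has_derivative_smooth_step[of n x] DERIV_isCont unfolding h_def by blast
    then show ?case by (simp add: continuous_at_imp_continuous_on)
  next
    case (Suc k)
    show ?case
    proof (rule Ck_on_SucI[where f'="\<lambda>x v. (h (n + 2) x - real n * h (n + 1) x) * v"])
      show "(h n has_derivative (\<lambda>v. (h (n + 2) x - real n * h (n + 1) x) * v)) (at x)" for x
        using has_derivative_smooth_step[of n x] unfolding h_def has_field_derivative_def .
      have "Ck_on k UNIV (\<lambda>x. v * (h (n + 2) x + (- real n) * h (n + 1) x))" for v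
        by (intro Ck_on_add Ck_on_bounded_linear[OF bounded_linear_mult_right] Suc.IH open_UNIV)
      then show "Ck_on k UNIV (\<lambda>x. (h (n + 2) x - real n * h (n + 1) x) * v)" for v
        by (simp add: mult.commute)
    qed simp
  qed
  then have "smooth_on UNIV (h 0)" by (simp add: smooth_on_def)
  then show ?thesis unfolding h_def power_0 div_by_1 by (rule smooth_on_subset) simp
qed

lemma smooth_bump:
  obtains \<psi> :: "real \<Rightarrow> real" where "smooth_on UNIV \<psi>" "\<And>t. 0 \<le> \<psi> t" "\<And>t. a < t \<Longrightarrow> t < b \<Longrightarrow> 0 < \<psi> t"
    "\<And>t. t \<notin> {a<..<b} \<Longrightarrow> \<psi> t = 0"
proof (rule that)
  define h where "h x = (if x > 0 then exp (- 1 / x) else 0)" for x :: real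
  have h: "smooth_on UNIV h" unfolding h_def by (rule smooth_step)
  let ?b = "\<lambda>t. h (t - a) * h (b - t)"
  show "smooth_on UNIV ?b"
    by (intro smooth_on_mult smooth_on_compose[OF _ open_UNIV _ _ h] smooth_on_diff smooth_on_id
        smooth_on_const open_UNIV) auto
  show "0 \<le> ?b t" "a < t \<Longrightarrow> t < b \<Longrightarrow> 0 < ?b t" "t \<notin> {a<..<b} \<Longrightarrow> ?b t = 0" for t
    by (auto simp: h_def)
qed

section \<open>Ordinary differential equations\<close>

text \<open>On an interval with \<open>\<tau> * K \<le> 1 / 2\<close> the maximum \<open>M\<close>
  of \<open>norm (r t)\<close> satisfies \<open>M \<le> norm (r 0) + \<tau> * e + M / 2\<close>, and
  the last term is absorbed, whence the factor 2. It does the work of an exponential estimate on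
  short intervals.\<close>

lemma ode_bound:
  fixes r :: "real \<Rightarrow> 'a::real_normed_vector"
  assumes "0 \<le> \<tau>" "0 \<le> K" "\<tau> * K \<le> 1 / 2" "0 \<le> e"
    and r: "\<And>t. t \<in> {-\<tau>..\<tau>} \<Longrightarrow> (r has_vector_derivative r' t) (at t)"
    and b: "\<And>t. t \<in> {-\<tau>..\<tau>} \<Longrightarrow> norm (r' t) \<le> K * norm (r t) + e"
    and t: "t \<in> {-\<tau>..\<tau>}"
  shows "norm (r t) \<le> 2 * (norm (r 0) + \<tau> * e)"
proof -
  have "continuous_on {-\<tau>..\<tau>} (\<lambda>t. norm (r t))"
    using r by (intro continuous_on_norm continuous_at_imp_continuous_on ballI) (rule has_vector_derivative_continuous)
  then obtain t1 where t1: "t1 \<in> {-\<tau>..\<tau>}" "\<And>t. t \<in> {-\<tau>..\<tau>} \<Longrightarrow> norm (r t) \<le> norm (r t1)"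
    using continuous_attains_sup[of "{-\<tau>..\<tau>}" "\<lambda>t. norm (r t)"] assms(1) by auto
  define M where "M = norm (r t1)"
  have dM: "norm (r' t) \<le> K * M + e" if "t \<in> {-\<tau>..\<tau>}" for t
    using b[OF that] mult_left_mono[OF t1(2)[OF that] assms(2)] unfolding M_def by linarith
  have KM: "0 \<le> K * M + e" using assms(2,4) by (simp add: M_def)
  have "norm (r t1 - r 0) \<le> (K * M + e) * \<tau>"
  proof (cases "0 \<le> t1")
    case True
    have "norm (r t1 - r 0) \<le> (K * M + e) * (t1 - 0)"
      by (rule vector_derivative_bound[OF True has_vector_derivative_at_within[OF r]])
        (use t1(1) dM in auto)
    also have "\<dots> \<le> (K * M + e) * \<tau>" using t1(1) KM by (intro mult_left_mono) auto
    finally show ?thesis .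
  next
    case False
    have "norm (r 0 - r t1) \<le> (K * M + e) * (0 - t1)"
      by (rule vector_derivative_bound[OF _ has_vector_derivative_at_within[OF r]])
        (use t1(1) dM False in auto)
    also have "\<dots> \<le> (K * M + e) * \<tau>" using t1(1) KM by (intro mult_left_mono) auto
    finally show ?thesis by (simp add: norm_minus_commute)
  qed
  then have "M \<le> norm (r 0) + (K * M + e) * \<tau>"
    using norm_triangle_sub[of "r t1" "r 0"] unfolding M_def by linarith
  moreover have "(\<tau> * K) * M \<le> 1 / 2 * M" using assms(3) by (intro mult_right_mono) (auto simp: M_def)
  ultimately have "M \<le> 2 * (norm (r 0) + \<tau> * e)" by (simp add: algebra_simps)
  then show ?thesis using t1(2)[OF t] by (simp add: M_def)
qed

text \<open>The integral operator contracts by \<open>\<tau> * K \<le> 1 / 2\<close> on the bounded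
  continuous functions with values in \<open>cball y0 R\<close>.\<close>

lemma picard_existence:
  fixes f :: "real \<Rightarrow> 'a::euclidean_space \<Rightarrow> 'a"
  assumes \<tau>: "0 < \<tau>" and R: "0 \<le> R" and K: "0 \<le> K" "\<tau> * K \<le> 1 / 2"
    and cont: "continuous_on ({-\<tau>..\<tau>} \<times> cball y0 R) (\<lambda>(t, x). f t x)"
    and lip: "\<And>t x y. t \<in> {-\<tau>..\<tau>} \<Longrightarrow> x \<in> cball y0 R \<Longrightarrow> y \<in> cball y0 R \<Longrightarrow> norm (f t x - f t y) \<le> K * norm (x - y)"
    and bnd: "\<And>t x. t \<in> {-\<tau>..\<tau>} \<Longrightarrow> x \<in> cball y0 R \<Longrightarrow> norm (f t x) \<le> B" "\<tau> * B \<le> R"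
  obtains u where "u 0 = y0" "\<And>t. t \<in> {-\<tau><..<\<tau>} \<Longrightarrow> u t \<in> cball y0 R"
    "\<And>t. t \<in> {-\<tau><..<\<tau>} \<Longrightarrow> (u has_vector_derivative f t (u t)) (at t)"
proof -
  \<comment> \<open>Functions stay defined on the whole line, where the bounded continuous ones form
    a complete space; time is clamped to the interval instead of being restricted to it.\<close>
  define cl where "cl t = max (-\<tau>) (min \<tau> t)" for t
  have cl: "cl t \<in> {-\<tau>..\<tau>}" "t \<in> {-\<tau>..\<tau>} \<Longrightarrow> cl t = t" for t using \<tau> by (auto simp: cl_def)
  have contcl: "continuous_on UNIV cl" unfolding cl_def by (intro continuous_intros)
  \<comment> \<open>The integral from \<open>0\<close> to \<open>t\<close>, in a form that is also
    right for negative \<open>t\<close>.\<close>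
  define Gi where "Gi h t = integral {-\<tau>..t} h - integral {-\<tau>..0} h" for h :: "real \<Rightarrow> 'a" and t
  have Gi: "(Gi h has_vector_derivative h t) (at t within {-\<tau>..\<tau>})"
    if "continuous_on {-\<tau>..\<tau>} h" "t \<in> {-\<tau>..\<tau>}" for h t
  proof -
    have "((\<lambda>t. integral {-\<tau>..t} h - integral {-\<tau>..0} h) has_vector_derivative h t - 0) (at t within {-\<tau>..\<tau>})"
      by (intro has_vector_derivative_diff integral_has_vector_derivative that has_vector_derivative_const)
    then show ?thesis by (simp add: Gi_def[abs_def])
  qed
  have Gi0: "Gi h 0 = 0" for h by (simp add: Gi_def)
  have Gib: "norm (Gi h t - Gi k t) \<le> c * \<tau>" if hk: "continuous_on {-\<tau>..\<tau>} h" "continuous_on {-\<tau>..\<tau>} k"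
    and c: "\<And>t. t \<in> {-\<tau>..\<tau>} \<Longrightarrow> norm (h t - k t) \<le> c" and t: "t \<in> {-\<tau>..\<tau>}" for h k c t
  proof -
    let ?d = "\<lambda>t. Gi h t - Gi k t"
    have d: "(?d has_vector_derivative h t - k t) (at t within S)" if "t \<in> S" "S \<subseteq> {-\<tau>..\<tau>}" for t S
      using has_vector_derivative_within_subset[OF has_vector_derivative_diff[OF Gi[OF hk(1)] Gi[OF hk(2)]]] that
      by blast
    have c0: "0 \<le> c" using order_trans[OF norm_ge_zero c[of 0]] \<tau> by simp
    have "norm (?d t - ?d 0) \<le> c * \<bar>t\<bar>"
    proof (cases "0 \<le> t")
      case True
      have "norm (?d t - ?d 0) \<le> c * (t - 0)"
        by (rule vector_derivative_bound[OF True d c]) (use t \<tau> in auto)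
      then show ?thesis using True by simp
    next
      case False
      have "norm (?d 0 - ?d t) \<le> c * (0 - t)"
        by (rule vector_derivative_bound[OF _ d c]) (use t \<tau> False in auto)
      then show ?thesis using False by (simp add: norm_minus_commute)
    qed
    also have "\<dots> \<le> c * \<tau>" using t c0 by (intro mult_left_mono) auto
    finally show ?thesis by (simp add: Gi0)
  qed
  define h where "h u t = f t (apply_bcontfun u t)" for u :: "real \<Rightarrow>\<^sub>C 'a" and t
  define T where "T u = Bcontfun (\<lambda>t. y0 + Gi (h u) (cl t))" for u
  define S where "S = PiC UNIV (\<lambda>_::real. cball y0 R)"
  have S: "u \<in> S \<longleftrightarrow> (\<forall>t. apply_bcontfun u t \<in> cball y0 R)" for u
    by (auto simp: S_def mem_PiC_iff)
  have conth: "continuous_on {-\<tau>..\<tau>} (h u)" if "u \<in> S" for u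
  proof -
    have "continuous_on {-\<tau>..\<tau>} (\<lambda>t. (\<lambda>(t, x). f t x) (t, apply_bcontfun u t))"
      by (rule continuous_on_compose2[OF cont]) (use that S in \<open>auto intro!: continuous_intros\<close>)
    then show ?thesis by (simp add: h_def[abs_def])
  qed
  have hb: "norm (h u t - 0) \<le> B" if "u \<in> S" "t \<in> {-\<tau>..\<tau>}" for u t
    using bnd(1)[OF that(2)] that(1) S by (simp add: h_def)
  have Giz: "Gi (\<lambda>_. 0) t = 0" for t by (simp add: Gi_def)
  have GR: "norm (Gi (h u) t) \<le> R" if "u \<in> S" "t \<in> {-\<tau>..\<tau>}" for u t
    using Gib[OF conth[OF that(1)] continuous_on_const hb[OF that(1)] that(2)] bnd(2)
    by (simp add: Giz mult.commute)
  have T: "apply_bcontfun (T u) t = y0 + Gi (h u) (cl t)" if "u \<in> S" for u t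
  proof -
    have "continuous_on {-\<tau>..\<tau>} (Gi (h u))"
      using Gi[OF conth[OF that]] has_vector_derivative_continuous continuous_on_eq_continuous_within by blast
    then have 1: "continuous_on UNIV (\<lambda>t. Gi (h u) (cl t))"
      by (rule continuous_on_compose2[OF _ contcl]) (use cl in auto)
    have "(\<lambda>t. y0 + Gi (h u) (cl t)) \<in> bcontfun"
    proof (rule bcontfun_normI)
      show "norm (y0 + Gi (h u) (cl t)) \<le> norm y0 + R" for t
        using norm_triangle_le[OF add_left_mono[OF GR[OF that cl(1)[of t]]]] .
    qed (intro continuous_intros 1)
    then show ?thesis by (simp add: T_def Bcontfun_inverse)
  qed
  have "\<exists>!u\<in>S. T u = u"
  proof (rule Banach_fix)
    have "closed S" unfolding S_def by (rule closed_PiC) simp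
    then show "complete S" by (simp add: complete_eq_closed)
    show "S \<noteq> {}" using R S[of "const_bcontfun y0"] by auto
    show "T ` S \<subseteq> S"
      using GR cl(1) by (auto simp: S T dist_norm)
    show "dist (T u) (T v) \<le> 1 / 2 * dist u v" if uv: "u \<in> S" "v \<in> S" for u v
    proof (rule dist_bound)
      fix t
      have "norm (h u t - h v t) \<le> K * dist u v" if "t \<in> {-\<tau>..\<tau>}" for t
      proof -
        have "norm (h u t - h v t) \<le> K * norm (apply_bcontfun u t - apply_bcontfun v t)"
          unfolding h_def by (rule lip[OF that]) (use uv S in auto)
        also have "\<dots> \<le> K * dist u v"
          using dist_bounded[of u t v] K(1) by (intro mult_left_mono) (auto simp: dist_norm)
        finally show ?thesis .
      qed
      from Gib[OF conth[OF uv(1)] conth[OF uv(2)] this cl(1)[of t]]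
      have "norm (Gi (h u) (cl t) - Gi (h v) (cl t)) \<le> (\<tau> * K) * dist u v" by (simp add: mult_ac)
      also have "\<dots> \<le> 1 / 2 * dist u v" using K(2) by (intro mult_right_mono) auto
      finally show "dist (apply_bcontfun (T u) t) (apply_bcontfun (T v) t) \<le> 1 / 2 * dist u v"
        by (simp add: T uv dist_norm)
    qed
  qed simp_all
  then obtain u where u: "u \<in> S" "T u = u" by blast
  have ut: "apply_bcontfun u t = y0 + Gi (h u) (cl t)" for t using T[OF u(1)] u(2) by metis
  show ?thesis
  proof (rule that[of "apply_bcontfun u"])
    show "apply_bcontfun u 0 = y0" using ut[of 0] cl(2)[of 0] \<tau> by (simp add: Gi0)
    show "apply_bcontfun u t \<in> cball y0 R" for t using u(1) S by blast
    show "(apply_bcontfun u has_vector_derivative f t (apply_bcontfun u t)) (at t)" if t: "t \<in> {-\<tau><..<\<tau>}" for t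
    proof -
      have "(Gi (h u) has_vector_derivative h u t) (at t)"
        using Gi[OF conth[OF u(1)], of t] t by (simp add: at_within_Icc_at)
      then have "((\<lambda>t. y0 + Gi (h u) t) has_vector_derivative 0 + h u t) (at t)"
        by (intro has_vector_derivative_add has_vector_derivative_const)
      then have "(apply_bcontfun u has_vector_derivative 0 + h u t) (at t)"
        by (rule has_vector_derivative_transform_within_open[of _ _ _ "{-\<tau><..<\<tau>}"]) (use t cl(2) ut in auto)
      then show ?thesis by (simp add: h_def)
    qed
  qed
qed

lemma ode_unique:
  fixes u v :: "real \<Rightarrow> 'a::real_normed_vector"
  assumes "0 \<le> K" "\<tau> * K \<le> 1 / 2" "u 0 = v 0"
    and u: "\<And>t. t \<in> {-\<tau><..<\<tau>} \<Longrightarrow> (u has_vector_derivative g t (u t)) (at t)"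
    and v: "\<And>t. t \<in> {-\<tau><..<\<tau>} \<Longrightarrow> (v has_vector_derivative g t (v t)) (at t)"
    and lip: "\<And>t x y. t \<in> {-\<tau><..<\<tau>} \<Longrightarrow> norm (g t x - g t y) \<le> K * norm (x - y)"
    and t: "t \<in> {-\<tau><..<\<tau>}"
  shows "u t = v t"
proof -
  have "norm (u t - v t) \<le> 2 * (norm (u 0 - v 0) + \<bar>t\<bar> * 0)"
  proof (rule ode_bound[where \<tau>="\<bar>t\<bar>" and K=K and r'="\<lambda>t. g t (u t) - g t (v t)"])
    have "\<bar>t\<bar> * K \<le> \<tau> * K" using t assms(1) by (intro mult_right_mono) auto
    then show "\<bar>t\<bar> * K \<le> 1 / 2" using assms(2) by linarith
    show "norm (g s (u s) - g s (v s)) \<le> K * norm (u s - v s) + 0" if "s \<in> {-\<bar>t\<bar>..\<bar>t\<bar>}" for s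
    proof -
      have "s \<in> {-\<tau><..<\<tau>}" using that t by auto
      then show ?thesis using lip by simp
    qed
  qed (use t assms(1) in \<open>auto intro!: has_vector_derivative_diff u v\<close>)
  then show ?thesis using assms(3) by simp
qed

text \<open>The Lipschitz constant holds on the whole space, so no solution escapes: one exists for
  every radius \<open>\<tau> < \<delta>\<close>, and these agree by uniqueness. The lemma is made
  for the linearised equation along a solution.\<close>

lemma lipschitz_ode_existence:
  fixes g :: "real \<Rightarrow> 'a::euclidean_space \<Rightarrow> 'a"
  assumes \<delta>: "0 < \<delta>" and K: "0 \<le> K" "\<delta> * K \<le> 1 / 2"
    and cont: "continuous_on ({-\<delta><..<\<delta>} \<times> UNIV) (\<lambda>(t, x). g t x)"
    and lip: "\<And>t x y. t \<in> {-\<delta><..<\<delta>} \<Longrightarrow> norm (g t x - g t y) \<le> K * norm (x - y)"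
  obtains w where "w 0 = w0" "\<And>t. t \<in> {-\<delta><..<\<delta>} \<Longrightarrow> (w has_vector_derivative g t (w t)) (at t)"
proof -
  have "\<exists>u. u 0 = w0 \<and> (\<forall>t\<in>{-\<tau><..<\<tau>}. (u has_vector_derivative g t (u t)) (at t))" if \<tau>: "0 < \<tau>" "\<tau> < \<delta>" for \<tau>
  proof -
    have sub: "{-\<tau>..\<tau>} \<subseteq> {-\<delta><..<\<delta>}" using \<tau> by auto
    have "continuous_on {-\<tau>..\<tau>} (\<lambda>t. (\<lambda>(t, x). g t x) (t, w0))"
      by (rule continuous_on_compose2[OF cont]) (use sub in \<open>auto intro!: continuous_intros\<close>)
    then have "compact ((\<lambda>t. g t w0) ` {-\<tau>..\<tau>})" by (intro compact_continuous_image) auto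
    then have "bounded ((\<lambda>t. g t w0) ` {-\<tau>..\<tau>})" by (rule compact_imp_bounded)
    then obtain M where M: "M > 0" "\<And>t. t \<in> {-\<tau>..\<tau>} \<Longrightarrow> norm (g t w0) \<le> M"
      unfolding bounded_pos by blast
    \<comment> \<open>Then \<open>\<tau> * M = R / 2\<close> and
      \<open>\<tau> * K * R \<le> R / 2\<close>, which together give the condition
      \<open>\<tau> * (M + K * R) \<le> R\<close>.\<close>
    define R where "R = 2 * \<tau> * M"
    have R: "R \<ge> 0" using \<tau> M by (simp add: R_def)
    have \<tau>K: "\<tau> * K \<le> 1 / 2" using mult_right_mono[of \<tau> \<delta> K] \<tau> K by linarith
    obtain u where "u 0 = w0" "\<And>t. t \<in> {-\<tau><..<\<tau>} \<Longrightarrow> (u has_vector_derivative g t (u t)) (at t)"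
    proof (rule picard_existence[OF \<tau>(1) R K(1) \<tau>K, where f=g and B="M + K * R"])
      show "continuous_on ({-\<tau>..\<tau>} \<times> cball w0 R) (\<lambda>(t, x). g t x)"
        by (rule continuous_on_subset[OF cont]) (use sub in auto)
      show "norm (g t x - g t y) \<le> K * norm (x - y)" if "t \<in> {-\<tau>..\<tau>}" for t x y
        using lip that sub by blast
      show "norm (g t x) \<le> M + K * R" if "t \<in> {-\<tau>..\<tau>}" "x \<in> cball w0 R" for t x
      proof -
        have "norm (g t x) \<le> norm (g t w0) + norm (g t x - g t w0)"
          using norm_triangle_sub by blast
        also have "\<dots> \<le> M + K * norm (x - w0)" using M(2) lip that sub by (intro add_mono) blast+
        also have "\<dots> \<le> M + K * R" using that K(1)
          by (intro add_left_mono mult_left_mono) (auto simp: dist_norm norm_minus_commute)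
        finally show ?thesis .
      qed
      have "(\<tau> * K) * R \<le> 1 / 2 * R" using \<tau>K R by (intro mult_right_mono)
      then show "\<tau> * (M + K * R) \<le> R" by (simp add: R_def algebra_simps)
    qed blast
    then show ?thesis by blast
  qed
  then obtain U where U: "\<And>\<tau>. 0 < \<tau> \<Longrightarrow> \<tau> < \<delta> \<Longrightarrow> U \<tau> 0 = w0"
    "\<And>\<tau> t. 0 < \<tau> \<Longrightarrow> \<tau> < \<delta> \<Longrightarrow> t \<in> {-\<tau><..<\<tau>} \<Longrightarrow> (U \<tau> has_vector_derivative g t (U \<tau> t)) (at t)"
    by metis
  have eq: "U \<tau> t = U \<tau>' t" if "0 < \<tau>" "\<tau> < \<delta>" "\<tau> \<le> \<tau>'" "\<tau>' < \<delta>" "t \<in> {-\<tau><..<\<tau>}" for \<tau> \<tau>' t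
  proof (rule ode_unique[OF K(1), where g=g and \<tau>=\<tau>])
    show "\<tau> * K \<le> 1 / 2" using mult_right_mono[of \<tau> \<delta> K] that K by linarith
  qed (use that U lip in auto)
  \<comment> \<open>Any radius strictly between \<open>abs t\<close> and \<open>\<delta>\<close>;
    the piece of that radius supplies the value at \<open>t\<close>.\<close>
  define r where "r t = (\<bar>t\<bar> + \<delta>) / 2" for t
  have r: "0 < r t" "r t < \<delta>" "t \<in> {-r t<..<r t}" if "t \<in> {-\<delta><..<\<delta>}" for t
    using that by (auto simp: r_def abs_if field_simps split: if_splits)
  show ?thesis
  proof (rule that[of "\<lambda>t. U (r t) t"])
    show "U (r 0) 0 = w0" using U(1) r[of 0] \<delta> by auto
    fix t assume t: "t \<in> {-\<delta><..<\<delta>}"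
    have "((\<lambda>t. U (r t) t) has_vector_derivative g t (U (r t) t)) (at t)"
    proof (rule has_vector_derivative_transform_within_open[OF U(2)[OF r(1,2)[OF t] r(3)[OF t]]])
      fix s assume s: "s \<in> {-r t<..<r t}"
      then have s': "s \<in> {-\<delta><..<\<delta>}" using r[OF t] by auto
      have "U (min (r t) (r s)) s = U (r t) s" "U (min (r t) (r s)) s = U (r s) s"
        using eq[of "min (r t) (r s)" "r t" s] eq[of "min (r t) (r s)" "r s" s] r[OF t] r[OF s'] s by auto
      then show "U (r t) s = U (r s) s" by simp
    qed (use r[OF t] in auto)
    then show "((\<lambda>t. U (r t) t) has_vector_derivative g t (U (r t) t)) (at t)" .
  qed
qed

section \<open>Estimates that are uniform near a compact set\<close>

lemma compact_local_to_uniform: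
  fixes S :: "'a::metric_space set"
  assumes "compact S"
    and "\<And>z0. z0 \<in> S \<Longrightarrow> \<exists>d>0. \<forall>z\<in>ball z0 d. \<forall>z'\<in>ball z0 d. P z z'"
  obtains d where "d > 0" "\<And>z z'. z \<in> S \<Longrightarrow> dist z z' < d \<Longrightarrow> P z z'"
proof -
  obtain d0 where d0: "\<And>z0. z0 \<in> S \<Longrightarrow> d0 z0 > 0"
    "\<And>z0 z z'. z0 \<in> S \<Longrightarrow> z \<in> ball z0 (d0 z0) \<Longrightarrow> z' \<in> ball z0 (d0 z0) \<Longrightarrow> P z z'"
    using assms(2) by metis
  \<comment> \<open>\<open>e\<close> is a Lebesgue number of the cover of \<open>S\<close> by these
    balls.\<close>
  obtain e where e: "0 < e" "\<And>x. x \<in> S \<Longrightarrow> \<exists>G \<in> (\<lambda>z. ball z (d0 z)) ` S. ball x e \<subseteq> G"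
  proof (rule Heine_Borel_lemma[OF assms(1), of "(\<lambda>z. ball z (d0 z)) ` S"])
    show "S \<subseteq> \<Union> ((\<lambda>z. ball z (d0 z)) ` S)" using d0(1) centre_in_ball by blast
    show "open G" if "G \<in> (\<lambda>z. ball z (d0 z)) ` S" for G using that by auto
  qed blast
  have "P z z'" if z: "z \<in> S" "dist z z' < e" for z z'
  proof -
    obtain z0 where z0: "z0 \<in> S" "ball z e \<subseteq> ball z0 (d0 z0)" using e(2)[OF z(1)] by blast
    have "z \<in> ball z e" "z' \<in> ball z e" using e(1) z(2) by auto
    then show ?thesis using d0(2)[OF z0(1)] z0(2) by blast
  qed
  then show ?thesis using that e(1) by blast
qed

text \<open>Only \<open>z\<close> runs through the compact set. The comparison points
  \<open>z'\<close> will have another parameter and lie off the reference curve, so uniform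
  continuity on the curve itself would be too weak.\<close>

lemma continuous_uniform_near_compact:
  fixes f :: "'a::metric_space \<Rightarrow> 'b::metric_space"
  assumes "open E" "continuous_on E f" "compact S" "S \<subseteq> E" "e > 0"
  obtains d where "d > 0" "\<And>z z'. z \<in> S \<Longrightarrow> dist z z' < d \<Longrightarrow> z' \<in> E \<and> dist (f z') (f z) < e"
proof (rule compact_local_to_uniform[OF assms(3), where P="\<lambda>z z'. z' \<in> E \<and> dist (f z') (f z) < e"])
  fix z0 assume "z0 \<in> S"
  then have z0: "z0 \<in> E" using assms(4) by blast
  obtain d1 where d1: "d1 > 0" "ball z0 d1 \<subseteq> E" using openE[OF assms(1) z0] by blast
  have "isCont f z0" using assms(1,2) z0 continuous_on_eq_continuous_at by blast
  then obtain d2 where d2: "d2 > 0" "\<And>z. dist z z0 < d2 \<Longrightarrow> dist (f z) (f z0) < e / 2"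
    using assms(5) unfolding continuous_at_eps_delta by (meson half_gt_zero)
  show "\<exists>d>0. \<forall>z\<in>ball z0 d. \<forall>z'\<in>ball z0 d. z' \<in> E \<and> dist (f z') (f z) < e"
  proof (intro exI[of _ "min d1 d2"] conjI ballI)
    fix z z' assume z: "z \<in> ball z0 (min d1 d2)" "z' \<in> ball z0 (min d1 d2)"
    then show "z' \<in> E" using d1(2) by auto
    show "dist (f z') (f z) < e"
      using dist_triangle_half_l[of "f z'" "f z0" e "f z"] d2(2)[of z] d2(2)[of z'] z by (auto simp: dist_commute)
  qed (use d1 d2 in auto)
qed (use that in blast)

text \<open>On a small ball the derivative varies by at most \<open>e\<close>, by its continuity,
  and the mean value inequality turns this into the error of the linear approximation. Compactness
  makes the radius uniform.\<close>

lemma C1_uniformly_differentiable: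
  fixes f :: "'a::euclidean_space \<Rightarrow> 'b::euclidean_space"
  assumes E: "open E" and f: "Ck_on 1 E f" and S: "compact S" "S \<subseteq> E" and e: "e > 0"
  obtains d where "d > 0" "\<And>z z'. z \<in> S \<Longrightarrow> dist z z' < d \<Longrightarrow>
    norm (f z' - f z - fderiv f z (z' - z)) \<le> e * norm (z' - z)"
proof (rule compact_local_to_uniform[OF S(1), where P="\<lambda>z z'. norm (f z' - f z - fderiv f z (z' - z)) \<le> e * norm (z' - z)"])
  have f0: "Ck_on (Suc 0) E f" using f by (simp only: One_nat_def)
  note D = Ck_on_SucD[OF f0]
  fix z0 assume "z0 \<in> S"
  then have z0: "z0 \<in> E" using S(2) by blast
  define \<epsilon> where "\<epsilon> x y = (\<Sum>b\<in>Basis. norm (fderiv f x b - fderiv f y b))" for x y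
  have contb: "isCont (\<lambda>y. fderiv f y b) z0" for b
    using D(2)[of b] E z0 continuous_on_eq_continuous_at by fastforce
  have "isCont (\<lambda>x. \<epsilon> x z0) z0" unfolding \<epsilon>_def by (intro continuous_intros contb)
  moreover have "\<epsilon> z0 z0 = 0" "e / 2 > 0" using e by (simp_all add: \<epsilon>_def)
  moreover have "0 \<le> \<epsilon> x z0" for x by (simp add: \<epsilon>_def sum_nonneg)
  ultimately obtain d2 where d2: "d2 > 0" "\<And>z. dist z z0 < d2 \<Longrightarrow> \<epsilon> z z0 < e / 2"
    unfolding continuous_at_eps_delta dist_real_def by (metis abs_of_nonneg diff_zero)
  obtain d1 where d1: "d1 > 0" "ball z0 d1 \<subseteq> E" using openE[OF E z0] by blast
  define d where "d = min d1 d2"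
  have lin: "linear (fderiv f x)" if "x \<in> E" for x using D(1)[OF that] has_derivative_linear by blast
  have ons: "norm (fderiv f x v - fderiv f y v) \<le> \<epsilon> x y * norm v" if "x \<in> E" "y \<in> E" for x y v
  proof -
    have "fderiv f x v - fderiv f y v = (\<Sum>b\<in>Basis. (v \<bullet> b) *\<^sub>R (fderiv f x b - fderiv f y b))"
      by (subst linear_euclidean_expand[OF lin[OF that(1)]], subst linear_euclidean_expand[OF lin[OF that(2)]])
        (simp add: scaleR_diff_right sum_subtractf)
    also have "norm \<dots> \<le> (\<Sum>b\<in>Basis. norm v * norm (fderiv f x b - fderiv f y b))"
      by (intro sum_norm_le) (simp add: Basis_le_norm mult_right_mono)
    finally show ?thesis by (simp add: \<epsilon>_def sum_distrib_left mult.commute)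
  qed
  show "\<exists>d>0. \<forall>z\<in>ball z0 d. \<forall>z'\<in>ball z0 d. norm (f z' - f z - fderiv f z (z' - z)) \<le> e * norm (z' - z)"
  proof (intro exI[of _ d] conjI ballI)
    show "d > 0" using d1 d2 by (simp add: d_def)
    fix z z' assume z: "z \<in> ball z0 d" "z' \<in> ball z0 d"
    have dE: "ball z0 d \<subseteq> E" using d1(2) by (auto simp: d_def)
    have \<epsilon>d: "\<epsilon> x z0 \<le> e / 2" if "x \<in> ball z0 d" for x
      using d2(2)[of x] that by (auto simp: d_def dist_commute)
    have "norm (f z' - f z - fderiv f z (z' - z)) \<le> norm (z' - z) * e"
    proof (rule differentiable_bound_linearization[where S="ball z0 d"])
      show "z + t *\<^sub>R (z' - z) \<in> ball z0 d" if "t \<in> {0..1}" for t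
      proof -
        have "(1 - t) *\<^sub>R z + t *\<^sub>R z' \<in> ball z0 d"
          using convexD_alt[OF convex_ball z, of t] that by auto
        then show ?thesis by (simp add: algebra_simps)
      qed
      show "(f has_derivative fderiv f x) (at x within ball z0 d)" if "x \<in> ball z0 d" for x
        using D(1) dE that has_derivative_at_withinI by blast
      show "onorm (fderiv f x - fderiv f z) \<le> e" if "x \<in> ball z0 d" for x
      proof (rule onorm_le)
        fix v
        have "(fderiv f x - fderiv f z) v = (fderiv f x v - fderiv f z0 v) - (fderiv f z v - fderiv f z0 v)" by simp
        also have "norm \<dots> \<le> norm (fderiv f x v - fderiv f z0 v) + norm (fderiv f z v - fderiv f z0 v)"
          by (rule norm_triangle_ineq4)
        also have "\<dots> \<le> e / 2 * norm v + e / 2 * norm v"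
        proof (rule add_mono)
          have "x \<in> E" "z \<in> E" using that z dE by auto
          then show "norm (fderiv f x v - fderiv f z0 v) \<le> e / 2 * norm v"
            "norm (fderiv f z v - fderiv f z0 v) \<le> e / 2 * norm v"
            using ons[OF _ z0] mult_right_mono[OF \<epsilon>d norm_ge_zero] that z(1) order_trans by blast+
        qed
        finally show "norm ((fderiv f x - fderiv f z) v) \<le> e * norm v" by (simp add: algebra_simps)
      qed
    qed (use z in auto)
    then show "norm (f z' - f z - fderiv f z (z' - z)) \<le> e * norm (z' - z)" by (simp add: mult.commute)
  qed
qed (use that in blast)

lemma lipschitz_derivative_bound:
  assumes D: "(f has_derivative D) (at z)" and "d > 0"
    and lip: "\<And>h. 0 < h \<Longrightarrow> h < d \<Longrightarrow> norm (f (z + h *\<^sub>R v) - f z) \<le> c * h"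
  shows "norm (D v) \<le> c"
proof -
  have lin: "linear D" using D has_derivative_linear by blast
  have "norm (D v) \<le> c + e" if e: "e > 0" for e
  proof -
    define e' where "e' = e / (norm v + 1)"
    have nv: "norm v + 1 > 0" using norm_ge_zero[of v] by linarith
    have e': "e' > 0" "e' * norm v \<le> e" using e nv by (auto simp: e'_def field_simps)
    obtain d' where d': "d' > 0" "\<And>y. norm (y - z) < d' \<Longrightarrow> norm (f y - f z - D (y - z)) \<le> e' * norm (y - z)"
      using D e'(1) unfolding has_derivative_at_alt by blast
    define m where "m = d' / (norm v + 1)"
    have "m > 0" using d'(1) nv by (simp add: m_def)
    define h where "h = min d m / 2"
    have h: "0 < h" "h < d" "h < m"
      using assms(2) \<open>m > 0\<close> by (auto simp: h_def)
    have "h * norm v < d'"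
    proof -
      have "h * norm v \<le> h * (norm v + 1)" using h(1) by simp
      also have "\<dots> < d'" using h(3) nv by (simp add: m_def field_simps)
      finally show ?thesis .
    qed
    then have "norm (f (z + h *\<^sub>R v) - f z - h *\<^sub>R D v) \<le> h * (e' * norm v)"
      using d'(2)[of "z + h *\<^sub>R v"] h(1) by (simp add: linear_scale[OF lin] mult_ac)
    also have "\<dots> \<le> h * e" using e'(2) h(1) by simp
    finally have "norm (h *\<^sub>R D v) \<le> h * (c + e)"
      using lip[OF h(1,2)] norm_triangle_sub[of "h *\<^sub>R D v" "f (z + h *\<^sub>R v) - f z"]
      by (simp add: norm_minus_commute algebra_simps)
    then show ?thesis using h(1) by simp
  qed
  then show ?thesis by (rule field_le_epsilon)
qed

section \<open>Smooth dependence of solutions on parameters\<close>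

text \<open>Right sides depend on time and on a parameter because the linearised equation along a
  solution does, and it has to be of the same kind for the induction on smoothness. The Lipschitz
  condition concerns the state alone; \<open>\<delta> * K \<le> 1 / 2\<close> makes
  \<open>ode_bound\<close> available on the time interval shared by all parameters.\<close>

definition ode_family ::
    "real \<Rightarrow> 'p::euclidean_space set \<Rightarrow> 'a::euclidean_space set \<Rightarrow> real \<Rightarrow> (real \<times> 'p \<times> 'a \<Rightarrow> 'a)
      \<Rightarrow> (real \<times> 'p \<Rightarrow> 'a) \<Rightarrow> bool" where
  "ode_family \<delta> \<Lambda> C K f u \<longleftrightarrow> open \<Lambda> \<and> open C \<and> 0 < \<delta> \<and> 0 \<le> K \<and> \<delta> * K \<le> 1 / 2 \<and>
     (\<forall>t\<in>{-\<delta><..<\<delta>}. \<forall>l\<in>\<Lambda>. (\<forall>x\<in>C. \<forall>y\<in>C. norm (f (t, l, x) - f (t, l, y)) \<le> K * norm (x - y)) \<and>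
        u (t, l) \<in> C \<and> ((\<lambda>t. u (t, l)) has_vector_derivative f (t, l, u (t, l))) (at t))"

lemma ode_familyD:
  assumes "ode_family \<delta> \<Lambda> C K f u"
  shows "open \<Lambda>" "open C" "0 < \<delta>" "0 \<le> K" "\<delta> * K \<le> 1 / 2"
    "\<And>t l x y. t \<in> {-\<delta><..<\<delta>} \<Longrightarrow> l \<in> \<Lambda> \<Longrightarrow> x \<in> C \<Longrightarrow> y \<in> C \<Longrightarrow> norm (f (t, l, x) - f (t, l, y)) \<le> K * norm (x - y)"
    "\<And>t l. t \<in> {-\<delta><..<\<delta>} \<Longrightarrow> l \<in> \<Lambda> \<Longrightarrow> u (t, l) \<in> C"
    "\<And>t l. t \<in> {-\<delta><..<\<delta>} \<Longrightarrow> l \<in> \<Lambda> \<Longrightarrow> ((\<lambda>t. u (t, l)) has_vector_derivative f (t, l, u (t, l))) (at t)"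
  using assms unfolding ode_family_def by blast+

lemma ode_family_open:
  assumes "ode_family \<delta> \<Lambda> C K f u"
  shows "open ({-\<delta><..<\<delta>} \<times> \<Lambda>)" "open ({-\<delta><..<\<delta>} \<times> \<Lambda> \<times> C)"
  using ode_familyD(1,2)[OF assms] by (simp_all add: open_Times)

lemma ode_family_curve_continuous:
  assumes "ode_family \<delta> \<Lambda> C K f u" "l \<in> \<Lambda>" "T \<subseteq> {-\<delta><..<\<delta>}"
  shows "continuous_on T (\<lambda>t. u (t, l))"
  using ode_familyD(8)[OF assms(1) _ assms(2)] assms(3)
  by (intro continuous_at_imp_continuous_on ballI has_vector_derivative_continuous) blast

lemma ode_family_curve_compact:
  assumes "ode_family \<delta> \<Lambda> C K f u" "l \<in> \<Lambda>" "\<tau> < \<delta>"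
  shows "compact ((\<lambda>t. (t, l, u (t, l))) ` {-\<tau>..\<tau>})"
    "(\<lambda>t. (t, l, u (t, l))) ` {-\<tau>..\<tau>} \<subseteq> {-\<delta><..<\<delta>} \<times> \<Lambda> \<times> C"
proof -
  have sub: "{-\<tau>..\<tau>} \<subseteq> {-\<delta><..<\<delta>}" using assms(3) by auto
  show "compact ((\<lambda>t. (t, l, u (t, l))) ` {-\<tau>..\<tau>})"
    by (intro compact_continuous_image continuous_intros ode_family_curve_continuous[OF assms(1,2) sub]) simp
  show "(\<lambda>t. (t, l, u (t, l))) ` {-\<tau>..\<tau>} \<subseteq> {-\<delta><..<\<delta>} \<times> \<Lambda> \<times> C"
    using ode_familyD(7)[OF assms(1) _ assms(2)] sub assms(2) by auto
qed

text \<open>The curves for \<open>l\<close> and \<open>l0\<close> are compared by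
  \<open>ode_bound\<close>: their difference has a Lipschitz part with constant \<open>K\<close> and
  a small defect caused by changing \<open>l\<close> inside \<open>f\<close>.\<close>

lemma ode_family_continuous:
  assumes fam: "ode_family \<delta> \<Lambda> C K f u"
    and f: "continuous_on ({-\<delta><..<\<delta>} \<times> \<Lambda> \<times> C) f" and u0: "continuous_on \<Lambda> (\<lambda>l. u (0, l))"
  shows "continuous_on ({-\<delta><..<\<delta>} \<times> \<Lambda>) u"
proof (rule continuous_at_imp_continuous_on, rule ballI)
  note fD = ode_familyD[OF fam]
  fix z assume "z \<in> {-\<delta><..<\<delta>} \<times> \<Lambda>"
  then obtain t0 l0 where z: "z = (t0, l0)" "t0 \<in> {-\<delta><..<\<delta>}" "l0 \<in> \<Lambda>" by auto
  define \<tau> where "\<tau> = (\<bar>t0\<bar> + \<delta>) / 2"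
  have \<tau>: "0 < \<tau>" "\<tau> < \<delta>" "\<bar>t0\<bar> < \<tau>" using z(2) by (auto simp: \<tau>_def)
  have sub: "{-\<tau>..\<tau>} \<subseteq> {-\<delta><..<\<delta>}" using \<tau> by auto
  have \<tau>K: "\<tau> * K \<le> 1 / 2" using mult_right_mono[of \<tau> \<delta> K] \<tau> fD(4,5) by linarith
  note cpt = ode_family_curve_compact[OF fam z(3) \<tau>(2)]
  show "isCont u z"
    unfolding continuous_at_eps_delta
  proof (intro allI impI)
    fix e :: real assume e: "e > 0"
    define c where "c = 1 + \<delta>"
    \<comment> \<open>The bound reached below is
      \<open>2 * (e1 + \<delta> * e1) = 2 * c * e1 = e / 4\<close>; the other half of
      \<open>e\<close> is spent on moving \<open>t\<close>.\<close>
    define e1 where "e1 = e / (8 * c)"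
    have c: "c > 0" using fD(3) by (simp add: c_def)
    have e1: "e1 > 0" using e c by (simp add: e1_def)
    obtain d1 where d1: "d1 > 0" "\<And>z z'. z \<in> (\<lambda>t. (t, l0, u (t, l0))) ` {-\<tau>..\<tau>} \<Longrightarrow> dist z z' < d1 \<Longrightarrow>
        z' \<in> {-\<delta><..<\<delta>} \<times> \<Lambda> \<times> C \<and> dist (f z') (f z) < e1"
      using continuous_uniform_near_compact[OF ode_family_open(2)[OF fam] f cpt e1] by blast
    have "isCont (\<lambda>l. u (0, l)) l0" using u0 fD(1) z(3) continuous_on_eq_continuous_at by blast
    then obtain d2 where d2: "d2 > 0" "\<And>l. dist l l0 < d2 \<Longrightarrow> dist (u (0, l)) (u (0, l0)) < e1"
      using e1 unfolding continuous_at_eps_delta by meson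
    obtain d3 where d3: "d3 > 0" "ball l0 d3 \<subseteq> \<Lambda>" using openE[OF fD(1) z(3)] by blast
    have "isCont (\<lambda>t. u (t, l0)) t0" using has_vector_derivative_continuous[OF fD(8)[OF z(2,3)]] .
    then obtain d4 where d4: "d4 > 0" "\<And>t. dist t t0 < d4 \<Longrightarrow> dist (u (t, l0)) (u (t0, l0)) < e / 2"
      using e unfolding continuous_at_eps_delta by (meson half_gt_zero)
    define d where "d = min (min d1 d2) (min d3 (min d4 (\<tau> - \<bar>t0\<bar>)))"
    have unif: "norm (u (t, l) - u (t, l0)) \<le> e / 2" if l: "dist l l0 < d" and t: "t \<in> {-\<tau>..\<tau>}" for t l
    proof -
      have l\<Lambda>: "l \<in> \<Lambda>" using l d3(2) by (auto simp: d_def dist_commute)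
      have "norm (u (t, l) - u (t, l0)) \<le> 2 * (norm (u (0, l) - u (0, l0)) + \<tau> * e1)"
      proof (rule ode_bound[OF _ fD(4) \<tau>K _ has_vector_derivative_diff[OF fD(8) fD(8)] _ t])
        fix s assume s: "s \<in> {-\<tau>..\<tau>}"
        have in_fam: "s \<in> {-\<delta><..<\<delta>}" using s sub by blast
        have "dist (s, l0, u (s, l0)) (s, l, u (s, l0)) < d1"
          using l by (simp add: d_def dist_Pair_Pair dist_commute)
        then have "norm (f (s, l, u (s, l0)) - f (s, l0, u (s, l0))) \<le> e1"
          using d1(2)[of "(s, l0, u (s, l0))" "(s, l, u (s, l0))"] s by (auto simp: dist_norm)
        moreover have "norm (f (s, l, u (s, l)) - f (s, l, u (s, l0))) \<le> K * norm (u (s, l) - u (s, l0))"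
          by (intro fD(6,7) in_fam l\<Lambda> z(3))
        ultimately show "norm (f (s, l, u (s, l)) - f (s, l0, u (s, l0))) \<le> K * norm (u (s, l) - u (s, l0)) + e1"
          using norm_triangle_ineq[of "f (s, l, u (s, l)) - f (s, l, u (s, l0))" "f (s, l, u (s, l0)) - f (s, l0, u (s, l0))"]
          by simp
      qed (use \<tau> e1 sub l\<Lambda> z(3) in auto)
      also have "\<dots> \<le> 2 * (e1 + \<delta> * e1)"
        using d2(2)[of l] l \<tau> e1 by (intro mult_left_mono add_mono mult_right_mono) (auto simp: d_def dist_norm)
      also have "\<dots> = 2 * (c * e1)" by (simp add: c_def algebra_simps)
      also have "c * e1 = e / 8" using c by (simp add: e1_def)
      also have "2 * (e / 8) \<le> e / 2" using e by simp
      finally show ?thesis .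
    qed
    show "\<exists>d>0. \<forall>x'. dist x' z < d \<longrightarrow> dist (u x') (u z) < e"
    proof (intro exI[of _ d] conjI allI impI)
      show "d > 0" using d1 d2 d3 d4 \<tau> by (simp add: d_def)
      fix z' assume z': "dist z' z < d"
      obtain t l where tl: "z' = (t, l)" by (cases z')
      have dt: "dist t t0 < d" "dist l l0 < d"
        using z' dist_fst_le[of z' z] dist_snd_le[of z' z] unfolding tl z(1) by auto
      then have "t \<in> {-\<tau>..\<tau>}" by (auto simp: d_def dist_real_def)
      then have "dist (u (t, l)) (u (t, l0)) \<le> e / 2" using unif dt(2) by (simp add: dist_norm)
      moreover have "dist (u (t, l0)) (u (t0, l0)) < e / 2" using d4(2) dt(1) by (simp add: d_def)
      ultimately show "dist (u z') (u z) < e"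
        unfolding tl z(1) using dist_triangle[of "u (t, l)" "u (t0, l0)" "u (t, l0)"] by linarith
    qed
  qed
qed

text \<open>The candidate \<open>w v\<close> for the derivative in the parameter direction
  \<open>v\<close> solves the equation linearised along the curve. It is linear in \<open>v\<close>
  by uniqueness, and the remainder of the first order expansion of \<open>u\<close> obeys
  \<open>ode_bound\<close> with a defect that is small compared with \<open>norm v\<close>.\<close>

lemma ode_family_C1:
  fixes f :: "real \<times> 'p::euclidean_space \<times> 'a::euclidean_space \<Rightarrow> 'a"
  assumes fam: "ode_family \<delta> \<Lambda> C K f u"
    and f: "Ck_on 1 ({-\<delta><..<\<delta>} \<times> \<Lambda> \<times> C) f"
    and u0: "\<And>l. l \<in> \<Lambda> \<Longrightarrow> ((\<lambda>l. u (0, l)) has_derivative u0' l) (at l)"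
  obtains w where
    "\<And>t l v. t \<in> {-\<delta><..<\<delta>} \<Longrightarrow> l \<in> \<Lambda> \<Longrightarrow>
       ((\<lambda>t. w v (t, l)) has_vector_derivative fderiv f (t, l, u (t, l)) (0, v, w v (t, l))) (at t)"
    "\<And>l v. l \<in> \<Lambda> \<Longrightarrow> w v (0, l) = u0' l v"
    "\<And>t l. t \<in> {-\<delta><..<\<delta>} \<Longrightarrow> l \<in> \<Lambda> \<Longrightarrow>
       (u has_derivative (\<lambda>(s, v). s *\<^sub>R f (t, l, u (t, l)) + w v (t, l))) (at (t, l))"
    "\<And>z x y v. z \<in> {-\<delta><..<\<delta>} \<times> \<Lambda> \<times> C \<Longrightarrow> norm (fderiv f z (0, v, x) - fderiv f z (0, v, y)) \<le> K * norm (x - y)"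
proof -
  note fD = ode_familyD[OF fam]
  define E where "E = {-\<delta><..<\<delta>} \<times> \<Lambda> \<times> C"
  have oE: "open E" unfolding E_def by (rule ode_family_open(2)[OF fam])
  have f1: "Ck_on (Suc 0) E f" using f unfolding E_def by (simp only: One_nat_def)
  note Df = Ck_on_SucD[OF f1]
  have contu: "continuous_on ({-\<delta><..<\<delta>} \<times> \<Lambda>) u"
  proof (rule ode_family_continuous[OF fam])
    show "continuous_on ({-\<delta><..<\<delta>} \<times> \<Lambda> \<times> C) f" using Ck_on_Suc_imp[OF f1] by (simp add: E_def)
    show "continuous_on \<Lambda> (\<lambda>l. u (0, l))"
      using u0 has_derivative_continuous by (intro continuous_at_imp_continuous_on) blast
  qed
  have linD: "linear (fderiv f z)" if "z \<in> E" for z using Df(1)[OF that] has_derivative_linear by blast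
  \<comment> \<open>The Lipschitz constant of \<open>f\<close> bounds its state derivative, so the
    linearised equation has the same \<open>K\<close> and is solvable on the same time
    interval.\<close>
  have DK: "norm (fderiv f z (0, 0, x)) \<le> K * norm x" if z: "z \<in> E" for z x
  proof -
    obtain t l y where zz: "z = (t, l, y)" "t \<in> {-\<delta><..<\<delta>}" "l \<in> \<Lambda>" "y \<in> C"
      using z by (auto simp: E_def)
    obtain d where d: "d > 0" "ball y d \<subseteq> C" using openE[OF fD(2) zz(4)] by blast
    show ?thesis
    proof (rule lipschitz_derivative_bound[OF Df(1)[OF z]])
      show "d / (norm x + 1) > 0" using d(1) norm_ge_zero[of x] by (intro divide_pos_pos) linarith+
      fix h assume h: "0 < h" "h < d / (norm x + 1)"
      have "norm x + 1 > 0" using norm_ge_zero[of x] by linarith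
      then have "h * (norm x + 1) < d" using h(2) by (simp add: field_simps)
      then have "h * norm x < d" using h(1) by (simp add: algebra_simps)
      then have "y + h *\<^sub>R x \<in> C" using d(2) h(1) by (auto simp: dist_norm subset_iff)
      then have "norm (f (t, l, y + h *\<^sub>R x) - f (t, l, y)) \<le> K * norm (y + h *\<^sub>R x - y)"
        by (intro fD(6) zz)
      then show "norm (f (z + h *\<^sub>R (0, 0, x)) - f z) \<le> K * norm x * h"
        using h(1) by (simp add: zz(1) mult_ac)
    qed
  qed
  have DK2: "norm (fderiv f z (0, v, x) - fderiv f z (0, v, y)) \<le> K * norm (x - y)" if z: "z \<in> E" for z v x y
    using DK[OF z, of "x - y"] linear_diff[OF linD[OF z], of "(0, v, x)" "(0, v, y)"] by simp
  have uE: "(t, l, u (t, l)) \<in> E" if "t \<in> {-\<delta><..<\<delta>}" "l \<in> \<Lambda>" for t l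
    using fD(7)[OF that] that by (simp add: E_def)
  have "\<exists>W. W 0 = u0' l v \<and> (\<forall>t\<in>{-\<delta><..<\<delta>}. (W has_vector_derivative fderiv f (t, l, u (t, l)) (0, v, W t)) (at t))"
    if l: "l \<in> \<Lambda>" for l v
  proof -
    have "continuous_on ({-\<delta><..<\<delta>} \<times> UNIV) (\<lambda>z. fderiv f (fst z, l, u (fst z, l)) (0, v, snd z))"
    proof -
      have cb: "continuous_on ({-\<delta><..<\<delta>} \<times> UNIV) (\<lambda>z::real\<times>'a. fderiv f (fst z, l, u (fst z, l)) b)" for b
      proof (rule continuous_on_compose2[of E "\<lambda>y. fderiv f y b"])
        show "continuous_on E (\<lambda>y. fderiv f y b)" using Df(2) by simp
        show "continuous_on ({-\<delta><..<\<delta>} \<times> UNIV) (\<lambda>z::real\<times>'a. (fst z, l, u (fst z, l)))"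
          by (intro continuous_intros continuous_on_compose2[OF ode_family_curve_continuous[OF fam l subset_refl]]) auto
        show "(\<lambda>z::real\<times>'a. (fst z, l, u (fst z, l))) ` ({-\<delta><..<\<delta>} \<times> UNIV) \<subseteq> E" using uE l by auto
      qed
      have "continuous_on ({-\<delta><..<\<delta>} \<times> UNIV) (\<lambda>z::real\<times>'a. \<Sum>b\<in>Basis. ((0, v, snd z) \<bullet> b) *\<^sub>R fderiv f (fst z, l, u (fst z, l)) b)"
        by (intro continuous_intros cb)
      then show ?thesis
        by (rule continuous_on_eq) (use uE l linear_euclidean_expand[OF linD] in \<open>auto simp del: sum_Basis_prod_eq\<close>)
    qed
    then have c: "continuous_on ({-\<delta><..<\<delta>} \<times> UNIV) (\<lambda>(t, x). fderiv f (t, l, u (t, l)) (0, v, x))"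
      by (simp add: case_prod_beta)
    show ?thesis
      by (rule lipschitz_ode_existence[OF fD(3-5) c, of "u0' l v"]) (use DK2 uE l in blast)+
  qed
  then obtain W where W: "\<And>l v. l \<in> \<Lambda> \<Longrightarrow> W l v 0 = u0' l v"
    "\<And>l v t. l \<in> \<Lambda> \<Longrightarrow> t \<in> {-\<delta><..<\<delta>} \<Longrightarrow> (W l v has_vector_derivative fderiv f (t, l, u (t, l)) (0, v, W l v t)) (at t)"
    by metis
  have linW: "linear (\<lambda>v. W l v t)" if l: "l \<in> \<Lambda>" and t: "t \<in> {-\<delta><..<\<delta>}" for l t
  proof (rule linearI)
    have lu0: "linear (u0' l)" using u0[OF l] has_derivative_linear by blast
    have lf: "linear (fderiv f (s, l, u (s, l)))" if "s \<in> {-\<delta><..<\<delta>}" for s using linD uE l that by blast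
    show "W l (v + v') t = W l v t + W l v' t" for v v'
    proof (rule ode_unique[OF fD(4,5), where u="W l (v + v')" and v="\<lambda>t. W l v t + W l v' t"
          and g="\<lambda>s x. fderiv f (s, l, u (s, l)) (0, v + v', x)"])
      show "W l (v + v') 0 = W l v 0 + W l v' 0" using W(1)[OF l] linear_add[OF lu0] by simp
      fix s assume s: "s \<in> {-\<delta><..<\<delta>}"
      have 1: "fderiv f (s, l, u (s, l)) (0, v, W l v s) + fderiv f (s, l, u (s, l)) (0, v', W l v' s)
          = fderiv f (s, l, u (s, l)) (0, v + v', W l v s + W l v' s)"
        using linear_add[OF lf[OF s], of "(0, v, W l v s)" "(0, v', W l v' s)"] by simp
      show "((\<lambda>t. W l v t + W l v' t) has_vector_derivative
          fderiv f (s, l, u (s, l)) (0, v + v', W l v s + W l v' s)) (at s)"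
        unfolding 1[symmetric] by (rule has_vector_derivative_add[OF W(2)[OF l s] W(2)[OF l s]])
    qed (use DK2 uE l t W(2) in blast)+
    show "W l (c *\<^sub>R v) t = c *\<^sub>R W l v t" for c v
    proof (rule ode_unique[OF fD(4,5), where u="W l (c *\<^sub>R v)" and v="\<lambda>t. c *\<^sub>R W l v t"
          and g="\<lambda>s x. fderiv f (s, l, u (s, l)) (0, c *\<^sub>R v, x)"])
      show "W l (c *\<^sub>R v) 0 = c *\<^sub>R W l v 0" using W(1)[OF l] linear_scale[OF lu0] by simp
      fix s assume s: "s \<in> {-\<delta><..<\<delta>}"
      have 1: "c *\<^sub>R fderiv f (s, l, u (s, l)) (0, v, W l v s)
          = fderiv f (s, l, u (s, l)) (0, c *\<^sub>R v, c *\<^sub>R W l v s)"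
        using linear_scale[OF lf[OF s], of c "(0, v, W l v s)"] by simp
      show "((\<lambda>t. c *\<^sub>R W l v t) has_vector_derivative
          fderiv f (s, l, u (s, l)) (0, c *\<^sub>R v, c *\<^sub>R W l v s)) (at s)"
        unfolding 1[symmetric]
        by (rule bounded_linear.has_vector_derivative[OF bounded_linear_scaleR_right W(2)[OF l s]])
    qed (use DK2 uE l t W(2) in blast)+
  qed
  have part: "((\<lambda>l. u (t, l)) has_derivative (\<lambda>v. W l0 v t)) (at l0)"
    if l0: "l0 \<in> \<Lambda>" and t: "t \<in> {-\<delta><..<\<delta>}" for l0 t
  proof -
    define \<tau> where "\<tau> = \<bar>t\<bar>"
    have \<tau>: "0 \<le> \<tau>" "\<tau> < \<delta>" "t \<in> {-\<tau>..\<tau>}" using t by (auto simp: \<tau>_def)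
    have sub: "{-\<tau>..\<tau>} \<subseteq> {-\<delta><..<\<delta>}" using \<tau> by auto
    have \<tau>K: "\<tau> * K \<le> 1 / 2" using mult_right_mono[of \<tau> \<delta> K] \<tau> fD(4,5) by linarith
    define S where "S = (\<lambda>t. (t, l0, u (t, l0))) ` {-\<tau>..\<tau>}"
    have S: "compact S" "S \<subseteq> E"
      using ode_family_curve_compact[OF fam l0 \<tau>(2)] unfolding S_def E_def by blast+
    have f1': "Ck_on 1 E f" using f unfolding E_def .
    obtain d0 where d0: "d0 > 0" "ball l0 d0 \<subseteq> \<Lambda>" using openE[OF fD(1) l0] by blast
    have derW: "((\<lambda>t. u (t, l0 + v) - u (t, l0)) has_vector_derivative
        f (s, l0 + v, u (s, l0 + v)) - f (s, l0, u (s, l0))) (at s)"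
      if "norm v < d0" "s \<in> {-\<tau>..\<tau>}" for s v
    proof -
      have "l0 + v \<in> \<Lambda>" using d0(2) that(1) by (auto simp: dist_norm subset_iff)
      then show ?thesis using sub that(2) l0 by (intro has_vector_derivative_diff fD(8)) auto
    qed
    have lip: "norm (f (s, l0 + v, u (s, l0 + v)) - f (s, l0 + v, u (s, l0))) \<le> K * norm (u (s, l0 + v) - u (s, l0))"
      if "norm v < d0" "s \<in> {-\<tau>..\<tau>}" for s v
    proof -
      have "l0 + v \<in> \<Lambda>" using d0(2) that(1) by (auto simp: dist_norm subset_iff)
      then show ?thesis using sub that(2) l0 by (intro fD(6,7)) auto
    qed
    obtain B where B: "B > 0" "\<And>s v. s \<in> {-\<tau>..\<tau>} \<Longrightarrow> norm (fderiv f (s, l0, u (s, l0)) (0, v, 0)) \<le> B * norm v"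
    proof -
      have "\<exists>b>0. \<forall>y\<in>(\<lambda>z. fderiv f z i) ` S. norm y \<le> b" for i
      proof -
        have "continuous_on S (\<lambda>z. fderiv f z i)" using Df(2)[of i] S(2) continuous_on_subset by auto
        then have "bounded ((\<lambda>z. fderiv f z i) ` S)"
          using S(1) compact_continuous_image compact_imp_bounded by blast
        then show ?thesis unfolding bounded_pos .
      qed
      then obtain b where b: "\<And>i. b i > 0" "\<And>i z. z \<in> S \<Longrightarrow> norm (fderiv f z i) \<le> b i" by (metis imageI)
      define B where "B = (\<Sum>i\<in>Basis. b (0, i, 0)) + 1"
      have "norm (fderiv f (s, l0, u (s, l0)) (0, v, 0)) \<le> B * norm v" if s: "s \<in> {-\<tau>..\<tau>}" for s v
      proof -
        have sS: "(s, l0, u (s, l0)) \<in> S" using s by (auto simp: S_def)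
        have "linear (\<lambda>v. fderiv f (s, l0, u (s, l0)) (0, v, 0))"
        proof (rule linearI)
          note ll = linD[OF subsetD[OF S(2) sS]]
          show "fderiv f (s, l0, u (s, l0)) (0, a + b, 0) = fderiv f (s, l0, u (s, l0)) (0, a, 0) + fderiv f (s, l0, u (s, l0)) (0, b, 0)" for a b
            using linear_add[OF ll, of "(0, a, 0)" "(0, b, 0)"] by simp
          show "fderiv f (s, l0, u (s, l0)) (0, r *\<^sub>R a, 0) = r *\<^sub>R fderiv f (s, l0, u (s, l0)) (0, a, 0)" for a r
            using linear_scale[OF ll, of r "(0, a, 0)"] by simp
        qed
        then have "fderiv f (s, l0, u (s, l0)) (0, v, 0) = (\<Sum>i\<in>Basis. (v \<bullet> i) *\<^sub>R fderiv f (s, l0, u (s, l0)) (0, i, 0))"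
          by (rule linear_euclidean_expand)
        also have "norm \<dots> \<le> (\<Sum>i\<in>Basis. norm v * b (0, i, 0))"
          by (intro sum_norm_le) (simp add: Basis_le_norm mult_mono b(2)[OF sS])
        also have "\<dots> \<le> B * norm v"
          by (simp add: B_def sum_distrib_left[symmetric] algebra_simps)
        finally show ?thesis .
      qed
      moreover have "B > 0" unfolding B_def using b(1) by (intro add_nonneg_pos sum_nonneg) (auto intro: less_imp_le)
      ultimately show ?thesis using that by blast
    qed
    have bl0: "bounded_linear (u0' l0)" using u0[OF l0] has_derivative_bounded_linear by blast
    then obtain B0 where B0: "B0 > 0" "\<And>v. norm (u0' l0 v) \<le> norm v * B0"
      using bounded_linear.pos_bounded by blast
    have u0d: "\<exists>d>0. \<forall>v. norm v < d \<longrightarrow> norm (u (0, l0 + v) - u (0, l0) - u0' l0 v) \<le> e * norm v" if "e > 0" for e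
      using u0[OF l0] that unfolding has_derivative_at_alt by (metis add_diff_cancel_left')
    \<comment> \<open>A crude Lipschitz constant of \<open>u\<close> in the parameter, from a first
      use of \<open>ode_bound\<close>: the initial values contribute \<open>1 + B0\<close>, the
      defect \<open>1 + B\<close>. It controls how far the arguments of \<open>f\<close> move in the
      sharp estimate.\<close>
    define C1 where "C1 = 2 * ((1 + B0) + \<delta> * (1 + B))"
    have C1: "C1 > 0" using B0(1) B(1) fD(3) by (simp add: C1_def add_pos_pos)
    obtain d1 where d1: "d1 > 0" "\<And>v s. norm v < d1 \<Longrightarrow> s \<in> {-\<tau>..\<tau>} \<Longrightarrow> norm (u (s, l0 + v) - u (s, l0)) \<le> C1 * norm v"
    proof -
      obtain da where da: "da > 0" "\<And>z z'. z \<in> S \<Longrightarrow> dist z z' < da \<Longrightarrow>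
          norm (f z' - f z - fderiv f z (z' - z)) \<le> 1 * norm (z' - z)"
        using C1_uniformly_differentiable[OF oE f1' S zero_less_one] by metis
      obtain db where db: "db > 0" "\<And>v. norm v < db \<Longrightarrow> norm (u (0, l0 + v) - u (0, l0) - u0' l0 v) \<le> 1 * norm v"
        using u0d[OF zero_less_one] by blast
      have "norm (u (s, l0 + v) - u (s, l0)) \<le> C1 * norm v"
        if v: "norm v < min d0 (min da db)" and s: "s \<in> {-\<tau>..\<tau>}" for v s
      proof -
        have "norm (u (s, l0 + v) - u (s, l0)) \<le> 2 * (norm (u (0, l0 + v) - u (0, l0)) + \<tau> * ((1 + B) * norm v))"
        proof (rule ode_bound[OF \<tau>(1) fD(4) \<tau>K _ derW _ s])
          fix r assume r: "r \<in> {-\<tau>..\<tau>}"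
          have "norm (f (r, l0 + v, u (r, l0)) - f (r, l0, u (r, l0)) - fderiv f (r, l0, u (r, l0)) (0, v, 0)) \<le> 1 * norm v"
            using da(2)[of "(r, l0, u (r, l0))" "(r, l0 + v, u (r, l0))"] r v
            by (auto simp: S_def dist_Pair_Pair norm_Pair dist_norm)
          then have "norm (f (r, l0 + v, u (r, l0)) - f (r, l0, u (r, l0))) \<le> (1 + B) * norm v"
            using B(2)[OF r, of v] norm_triangle_sub[of "f (r, l0 + v, u (r, l0)) - f (r, l0, u (r, l0))" "fderiv f (r, l0, u (r, l0)) (0, v, 0)"]
            by (simp add: algebra_simps)
          moreover have "norm (f (r, l0 + v, u (r, l0 + v)) - f (r, l0 + v, u (r, l0))) \<le> K * norm (u (r, l0 + v) - u (r, l0))"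
            using lip r v by simp
          ultimately show "norm (f (r, l0 + v, u (r, l0 + v)) - f (r, l0, u (r, l0))) \<le> K * norm (u (r, l0 + v) - u (r, l0)) + (1 + B) * norm v"
            using norm_triangle_ineq[of "f (r, l0 + v, u (r, l0 + v)) - f (r, l0 + v, u (r, l0))" "f (r, l0 + v, u (r, l0)) - f (r, l0, u (r, l0))"]
            by simp
        qed (use v B in auto)
        also have "\<dots> \<le> 2 * ((1 + B0) * norm v + \<delta> * ((1 + B) * norm v))"
        proof (intro mult_left_mono add_mono mult_right_mono)
          show "norm (u (0, l0 + v) - u (0, l0)) \<le> (1 + B0) * norm v"
            using db(2)[of v] v B0(2)[of v] norm_triangle_sub[of "u (0, l0 + v) - u (0, l0)" "u0' l0 v"]
            by (simp add: algebra_simps)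
        qed (use \<tau> B in auto)
        also have "\<dots> = C1 * norm v" by (simp add: C1_def algebra_simps)
        finally show ?thesis .
      qed
      then show ?thesis using that[of "min d0 (min da db)"] d0 da db by simp
    qed
    show ?thesis unfolding has_derivative_at_alt
    proof (intro conjI allI impI)
      show "bounded_linear (\<lambda>v. W l0 v t)" using linW[OF l0 t] linear_conv_bounded_linear by blast
      fix e :: real assume e: "e > 0"
      \<comment> \<open>Makes the final factor \<open>2 * (e1 + \<delta> * e1 * (1 + C1))\<close>
        equal to \<open>e\<close>.\<close>
      define e1 where "e1 = e / (2 * (1 + \<delta> * (1 + C1)))"
      have den: "1 + \<delta> * (1 + C1) > 0" using fD(3) C1 by (simp add: add_pos_pos)
      have e1: "e1 > 0" "2 * (1 + \<delta> * (1 + C1)) * e1 = e" using e den by (simp_all add: e1_def)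
      obtain da where da: "da > 0" "\<And>z z'. z \<in> S \<Longrightarrow> dist z z' < da \<Longrightarrow>
          norm (f z' - f z - fderiv f z (z' - z)) \<le> e1 * norm (z' - z)"
        using C1_uniformly_differentiable[OF oE f1' S e1(1)] by metis
      obtain db where db: "db > 0" "\<And>v. norm v < db \<Longrightarrow> norm (u (0, l0 + v) - u (0, l0) - u0' l0 v) \<le> e1 * norm v"
        using u0d[OF e1(1)] by blast
      define d where "d = min (min d0 d1) (min (da / (1 + C1)) db)"
      have d: "d > 0" using d0 d1 da db C1 by (simp add: d_def)
      have "norm (u (t, l0 + v) - u (t, l0) - W l0 v t) \<le> e * norm v" if v: "norm v < d" for v
      proof -
        have v': "norm v < d0" "norm v < d1" "norm v < db" "(1 + C1) * norm v < da"
          using v C1 by (auto simp: d_def field_simps)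
        have "norm (u (t, l0 + v) - u (t, l0) - W l0 v t) \<le> 2 * (norm (u (0, l0 + v) - u (0, l0) - W l0 v 0) + \<tau> * (e1 * ((1 + C1) * norm v)))"
        proof (rule ode_bound[OF \<tau>(1) fD(4) \<tau>K _ has_vector_derivative_diff[OF derW[OF v'(1)] W(2)[OF l0]] _ \<tau>(3)])
          fix s assume s: "s \<in> {-\<tau>..\<tau>}"
          let ?z = "(s, l0, u (s, l0))" and ?z' = "(s, l0 + v, u (s, l0 + v))"
          have zS: "?z \<in> S" using s by (auto simp: S_def)
          have "norm (?z' - ?z) \<le> norm v + norm (u (s, l0 + v) - u (s, l0))"
            by (simp add: norm_Pair) (rule sqrt_sum_squares_le_sum; simp)
          also have "\<dots> \<le> (1 + C1) * norm v" using d1(2)[OF v'(2) s] by (simp add: algebra_simps)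
          finally have n: "norm (?z' - ?z) \<le> (1 + C1) * norm v" .
          have "dist ?z ?z' < da"
            unfolding dist_norm norm_minus_commute[of ?z ?z'] by (rule le_less_trans[OF n v'(4)])
          then have "norm (f ?z' - f ?z - fderiv f ?z (?z' - ?z)) \<le> e1 * norm (?z' - ?z)"
            by (rule da(2)[OF zS])
          also have "\<dots> \<le> e1 * ((1 + C1) * norm v)" using n e1(1) by (intro mult_left_mono) auto
          finally have 1: "norm (f ?z' - f ?z - fderiv f ?z (?z' - ?z)) \<le> e1 * ((1 + C1) * norm v)" .
          have "f ?z' - f ?z - fderiv f ?z (0, v, W l0 v s)
              = (f ?z' - f ?z - fderiv f ?z (?z' - ?z)) + (fderiv f ?z (0, v, u (s, l0 + v) - u (s, l0)) - fderiv f ?z (0, v, W l0 v s))"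
            by simp
          also have "norm \<dots> \<le> e1 * ((1 + C1) * norm v) + K * norm (u (s, l0 + v) - u (s, l0) - W l0 v s)"
            using S(2) zS by (intro norm_triangle_mono 1 DK2) auto
          finally show "norm (f ?z' - f ?z - fderiv f ?z (0, v, W l0 v s)) \<le> K * norm (u (s, l0 + v) - u (s, l0) - W l0 v s) + e1 * ((1 + C1) * norm v)"
            by simp
        qed (use sub e1 C1 in auto)
        also have "\<dots> \<le> 2 * (e1 * norm v + \<delta> * (e1 * ((1 + C1) * norm v)))"
          using db(2)[OF v'(3)] W(1)[OF l0] \<tau> e1 C1 by (intro mult_left_mono add_mono mult_right_mono) auto
        also have "\<dots> = (2 * (1 + \<delta> * (1 + C1)) * e1) * norm v" by (simp add: algebra_simps)
        finally show ?thesis unfolding e1(2) .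
      qed
      then show "\<exists>d>0. \<forall>y. norm (y - l0) < d \<longrightarrow> norm (u (t, y) - u (t, l0) - W l0 (y - l0) t) \<le> e * norm (y - l0)"
        using d by (metis add.commute diff_add_cancel)
    qed
  qed
  \<comment> \<open>The derivative in \<open>t\<close> is \<open>f\<close> along \<open>u\<close>,
    hence jointly continuous, so the two partial derivatives combine into a total one.\<close>
  have total: "(u has_derivative (\<lambda>(s, v). s *\<^sub>R f (t, l, u (t, l)) + W l v t)) (at (t, l))"
    if t: "t \<in> {-\<delta><..<\<delta>}" and l: "l \<in> \<Lambda>" for t l
  proof -
    define fy where "fy l t = blinfun_scaleR_left (f (t, l, u (t, l)))" for l t
    have contfy: "continuous (at (l, t) within \<Lambda> \<times> {-\<delta><..<\<delta>}) (\<lambda>(l, t). fy l t)"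
    proof -
      have "continuous_on (\<Lambda> \<times> {-\<delta><..<\<delta>}) (\<lambda>z. u (snd z, fst z))"
        by (rule continuous_on_compose2[OF contu]) (auto intro!: continuous_intros)
      then have c: "continuous_on (\<Lambda> \<times> {-\<delta><..<\<delta>}) (\<lambda>z. (snd z, fst z, u (snd z, fst z)))"
        by (intro continuous_on_Pair continuous_on_fst continuous_on_snd continuous_on_id)
      have "continuous_on E f" using Ck_on_Suc_imp[OF f1] by simp
      then have "continuous_on (\<Lambda> \<times> {-\<delta><..<\<delta>}) (\<lambda>z. f (snd z, fst z, u (snd z, fst z)))"
        by (rule continuous_on_compose2[OF _ c]) (use uE in auto)
      then have "continuous_on (\<Lambda> \<times> {-\<delta><..<\<delta>}) (\<lambda>(l, t). fy l t)"
        unfolding fy_def case_prod_beta by (intro continuous_intros)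
      then show ?thesis using t l by (simp add: continuous_on_eq_continuous_within)
    qed
    have "((\<lambda>(l, t). u (t, l)) has_derivative (\<lambda>(tx, ty). W l tx t + blinfun_apply (fy l t) ty)) (at (l, t) within \<Lambda> \<times> {-\<delta><..<\<delta>})"
    proof (rule has_derivative_partialsI[OF _ _ contfy t])
      show "((\<lambda>x. u (t, x)) has_derivative (\<lambda>tx. W l tx t)) (at l within \<Lambda>)"
        using part[OF l t] has_derivative_at_withinI by blast
      show "((\<lambda>y. u (y, x)) has_derivative blinfun_apply (fy x y)) (at y within {-\<delta><..<\<delta>})"
        if "x \<in> \<Lambda>" "y \<in> {-\<delta><..<\<delta>}" for x y
        using fD(8)[OF that(2,1)] has_derivative_at_withinI
        by (simp add: fy_def has_vector_derivative_def)
    qed simp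
    then have h: "((\<lambda>(l, t). u (t, l)) has_derivative (\<lambda>(tx, ty). W l tx t + ty *\<^sub>R f (t, l, u (t, l)))) (at (l, t))"
      using t l fD(1) by (simp add: fy_def at_within_open[OF _ open_Times])
    have sw: "((\<lambda>z. (snd z, fst z)) has_derivative (\<lambda>z. (snd z, fst z))) (at (t, l))"
      by (intro has_derivative_Pair has_derivative_snd has_derivative_fst has_derivative_ident)
    have "((\<lambda>z. (\<lambda>(l, t). u (t, l)) (snd z, fst z)) has_derivative
        (\<lambda>z. (\<lambda>(tx, ty). W l tx t + ty *\<^sub>R f (t, l, u (t, l))) (snd z, fst z))) (at (t, l))"
      by (rule has_derivative_compose[OF sw]) (use h in simp)
    then show ?thesis by (simp add: split_beta' add.commute)
  qed
  show ?thesis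
    by (rule that[of "\<lambda>v z. W (snd z) v (fst z)"]) (use W total DK2 in \<open>auto simp: E_def\<close>)
qed

text \<open>The derivatives of \<open>u\<close> are built from \<open>f\<close> along
  \<open>u\<close> and the solutions \<open>w v\<close> of the linearised equation. The latter form
  an \<open>ode_family\<close> again, with state space \<open>UNIV\<close> and a right side that is
  \<open>C^k\<close> as soon as \<open>u\<close> is, so the induction hypothesis applies to them as
  well.\<close>

lemma ode_family_Ck:
  fixes f :: "real \<times> 'p::euclidean_space \<times> 'a::euclidean_space \<Rightarrow> 'a"
  assumes "ode_family \<delta> \<Lambda> C K f u" "Ck_on k ({-\<delta><..<\<delta>} \<times> \<Lambda> \<times> C) f" "Ck_on k \<Lambda> (\<lambda>l. u (0, l))"
  shows "Ck_on k ({-\<delta><..<\<delta>} \<times> \<Lambda>) u"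
  using assms
proof (induction k arbitrary: f u C)
  case 0 then show ?case using ode_family_continuous by simp
next
  case (Suc k)
  note fam = Suc.prems(1) and f = Suc.prems(2) and u0 = Suc.prems(3)
  note fD = ode_familyD[OF fam]
  let ?O = "{-\<delta><..<\<delta>} \<times> \<Lambda>" and ?E = "{-\<delta><..<\<delta>} \<times> \<Lambda> \<times> C"
  note op = ode_family_open[OF fam]
  have uk: "Ck_on k ?O u" by (rule Suc.IH[OF fam Ck_on_Suc_imp[OF f] Ck_on_Suc_imp[OF u0]])
  have "Ck_on 1 ?E f" using Ck_on_le[OF f, of 1] by simp
  then obtain w where w:
    "\<And>t l v. t \<in> {-\<delta><..<\<delta>} \<Longrightarrow> l \<in> \<Lambda> \<Longrightarrow>
       ((\<lambda>t. w v (t, l)) has_vector_derivative fderiv f (t, l, u (t, l)) (0, v, w v (t, l))) (at t)"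
    "\<And>l v. l \<in> \<Lambda> \<Longrightarrow> w v (0, l) = fderiv (\<lambda>l. u (0, l)) l v"
    "\<And>t l. t \<in> {-\<delta><..<\<delta>} \<Longrightarrow> l \<in> \<Lambda> \<Longrightarrow>
       (u has_derivative (\<lambda>(s, v). s *\<^sub>R f (t, l, u (t, l)) + w v (t, l))) (at (t, l))"
    "\<And>z x y v. z \<in> ?E \<Longrightarrow> norm (fderiv f z (0, v, x) - fderiv f z (0, v, y)) \<le> K * norm (x - y)"
    using ode_family_C1[OF fam _ Ck_on_SucD(1)[OF u0]] by blast
  have wk: "Ck_on k ?O (w v)" for v
  proof (rule Suc.IH[where C=UNIV and f="\<lambda>(t, l, x). fderiv f (t, l, u (t, l)) (0, v, x)"])
    show "ode_family \<delta> \<Lambda> UNIV K (\<lambda>(t, l, x). fderiv f (t, l, u (t, l)) (0, v, x)) (w v)"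
      unfolding ode_family_def using fD w(1,4) by auto
    have "Ck_on k ({-\<delta><..<\<delta>} \<times> \<Lambda> \<times> UNIV) (\<lambda>z. fderiv f (fst z, fst (snd z), u (fst z, fst (snd z))) (0, v, snd (snd z)))"
      (is "Ck_on k ?F _")
    proof (rule Ck_on_linear_family[where A="\<lambda>z. fderiv f (fst z, fst (snd z), u (fst z, fst (snd z)))"])
      show opF: "open ?F" using fD(1) by (simp add: open_Times)
      have fst': "Ck_on k ?F (\<lambda>z. fst z)" and fsnd: "Ck_on k ?F (\<lambda>z. fst (snd z))" and ssnd: "Ck_on k ?F (\<lambda>z. snd (snd z))"
        by (intro Ck_on_linear bounded_linear_intros)+
      have pr: "Ck_on k S (\<lambda>z. (a z, b z))" if "open S" "Ck_on k S a" "Ck_on k S b"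
        for S :: "(real \<times> 'p \<times> 'a) set" and a :: "_ \<Rightarrow> 'x::real_normed_vector" and b :: "_ \<Rightarrow> 'y::real_normed_vector"
      proof -
        have "Ck_on k S (\<lambda>z. (a z, 0) + (0, b z))"
          by (intro Ck_on_add that Ck_on_bounded_linear[OF bounded_linear_Pair[OF bounded_linear_ident bounded_linear_zero]]
              Ck_on_bounded_linear[OF bounded_linear_Pair[OF bounded_linear_zero bounded_linear_ident]])
        then show ?thesis by simp
      qed
      show "Ck_on k ?F (\<lambda>z. (0, v, snd (snd z)))"
        by (intro pr opF Ck_on_const ssnd)
      show "linear (fderiv f (fst y, fst (snd y), u (fst y, fst (snd y))))" if "y \<in> ?F" for y
        using Ck_on_SucD(1)[OF f, of "(fst y, fst (snd y), u (fst y, fst (snd y)))"] fD(7) that has_derivative_linear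
        by auto
      have "Ck_on k ?F (\<lambda>z. u (fst z, fst (snd z)))"
        by (rule Ck_on_compose[OF opF op(1) _ _ uk]) (use pr[OF opF fst' fsnd] in auto)
      then have "Ck_on k ?F (\<lambda>z. (fst z, fst (snd z), u (fst z, fst (snd z))))"
        by (intro pr opF fst' fsnd)
      then show "Ck_on k ?F (\<lambda>y. fderiv f (fst y, fst (snd y), u (fst y, fst (snd y))) b)" for b
        by (rule Ck_on_compose[OF opF op(2) _ _ Ck_on_SucD(2)[OF f]]) (use fD(7) in auto)
    qed
    then show "Ck_on k ?F (\<lambda>(t, l, x). fderiv f (t, l, u (t, l)) (0, v, x))"
      by (simp add: split_beta')
    show "Ck_on k \<Lambda> (\<lambda>l. w v (0, l))"
      by (rule Ck_on_cong[OF fD(1) _ Ck_on_SucD(2)[OF u0]]) (use w(2) in auto)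
  qed
  show ?case
  proof (rule Ck_on_SucI[OF op(1), where f'="\<lambda>z v. fst v *\<^sub>R f (fst z, snd z, u z) + w (snd v) z"])
    show "(u has_derivative (\<lambda>v. fst v *\<^sub>R f (fst z, snd z, u z) + w (snd v) z)) (at z)" if "z \<in> ?O" for z
      using w(3)[of "fst z" "snd z"] that by (auto simp: split_beta')
    have "Ck_on k ?O (\<lambda>z. (fst z, snd z, u z))"
    proof -
      have "Ck_on k ?O (\<lambda>z. (fst z, snd z, 0) + (0, 0, u z))"
        by (intro Ck_on_add op Ck_on_linear bounded_linear_intros
            Ck_on_bounded_linear[OF bounded_linear_Pair[OF bounded_linear_zero bounded_linear_Pair[OF bounded_linear_zero bounded_linear_ident]] op(1) uk])
      then show ?thesis by simp
    qed
    then have "Ck_on k ?O (\<lambda>z. f (fst z, snd z, u z))"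
      by (rule Ck_on_compose[OF op(1) op(2) _ _ Ck_on_Suc_imp[OF f]]) (use fD(7) in auto)
    then show "Ck_on k ?O (\<lambda>z. fst v *\<^sub>R f (fst z, snd z, u z) + w (snd v) z)" for v
      by (intro Ck_on_add op wk Ck_on_bounded_linear[OF bounded_linear_scaleR_right])
  qed
qed

theorem smooth_local_flow:
  fixes X :: "'a::euclidean_space \<Rightarrow> 'a"
  assumes "open U" "smooth_on U X" "x0 \<in> U"
  obtains \<delta> R \<Phi> where "\<delta> > 0" "R > 0" "smooth_on ({-\<delta><..<\<delta>} \<times> ball x0 R) \<Phi>"
    "\<And>t x. t \<in> {-\<delta><..<\<delta>} \<Longrightarrow> x \<in> ball x0 R \<Longrightarrow> \<Phi> (t, x) \<in> U"
    "\<And>x. x \<in> ball x0 R \<Longrightarrow> \<Phi> (0, x) = x"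
    "\<And>t x. t \<in> {-\<delta><..<\<delta>} \<Longrightarrow> x \<in> ball x0 R \<Longrightarrow> ((\<lambda>t. \<Phi> (t, x)) has_vector_derivative X (\<Phi> (t, x))) (at t)"
proof -
  obtain R0 where R0: "R0 > 0" "cball x0 R0 \<subseteq> U" using assms(1,3) open_contains_cball by blast
  \<comment> \<open>Orbits start within \<open>R\<close> of \<open>x0\<close> and travel at most
    \<open>R\<close>, so they remain where the bounds on \<open>X\<close> hold.\<close>
  define R where "R = R0 / 2"
  have R: "R > 0" using R0 by (simp add: R_def)
  have Xc: "continuous_on (cball x0 R0) X" using smooth_on_continuous[OF assms(2)] R0(2) continuous_on_subset by blast
  have "bounded (X ` cball x0 R0)"
    by (intro compact_imp_bounded compact_continuous_image Xc compact_cball)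
  then obtain B where B: "B > 0" "\<And>x. x \<in> cball x0 R0 \<Longrightarrow> norm (X x) \<le> B"
    unfolding bounded_pos by blast
  obtain K where K: "K > 0" "\<And>x y. x \<in> cball x0 R0 \<Longrightarrow> y \<in> cball x0 R0 \<Longrightarrow> norm (X x - X y) \<le> K * norm (x - y)"
  proof -
    have "\<exists>c>0. \<forall>x\<in>(\<lambda>x. fderiv X x b) ` cball x0 R0. norm x \<le> c" for b
    proof -
      have "continuous_on (cball x0 R0) (\<lambda>x. fderiv X x b)"
        using smooth_on_continuous[OF smooth_on_fderiv_dir[OF assms(2)]] R0(2) continuous_on_subset by blast
      then have "bounded ((\<lambda>x. fderiv X x b) ` cball x0 R0)"
        by (intro compact_imp_bounded compact_continuous_image compact_cball)
      then show ?thesis unfolding bounded_pos .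
    qed
    then obtain c where c: "\<And>b. c b > 0" "\<And>b x. x \<in> cball x0 R0 \<Longrightarrow> norm (fderiv X x b) \<le> c b" by (metis imageI)
    define K where "K = (\<Sum>b\<in>Basis. c b) + 1"
    have "K > 0" unfolding K_def using c(1) by (intro add_nonneg_pos sum_nonneg) (auto intro: less_imp_le)
    moreover have "norm (X x - X y) \<le> K * norm (x - y)" if xy: "x \<in> cball x0 R0" "y \<in> cball x0 R0" for x y
    proof (rule differentiable_bound[OF convex_cball _ _ xy(1,2), where f'="\<lambda>x. fderiv X x"])
      show "(X has_derivative fderiv X z) (at z within cball x0 R0)" if "z \<in> cball x0 R0" for z
        using smooth_on_has_derivative[OF assms(2)] R0(2) that has_derivative_at_withinI by blast
      show "onorm (fderiv X z) \<le> K" if z: "z \<in> cball x0 R0" for z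
      proof (rule onorm_le)
        fix v
        have "fderiv X z v = (\<Sum>b\<in>Basis. (v \<bullet> b) *\<^sub>R fderiv X z b)"
          using linear_euclidean_expand[OF smooth_on_linear_fderiv[OF assms(2)]] R0(2) z by blast
        also have "norm \<dots> \<le> (\<Sum>b\<in>Basis. norm v * c b)"
          by (intro sum_norm_le) (simp add: Basis_le_norm mult_mono c(2)[OF z])
        also have "\<dots> \<le> K * norm v"
          by (simp add: K_def sum_distrib_left[symmetric] algebra_simps)
        finally show "norm (fderiv X z v) \<le> K * norm v" .
      qed
    qed
    ultimately show ?thesis using that by blast
  qed
  \<comment> \<open>The first bound keeps each orbit within \<open>R\<close> of its starting point,
    the second is the contraction condition.\<close>
  define \<delta> where "\<delta> = min (R / B) (1 / (2 * K))"
  have \<delta>: "\<delta> > 0" using R B K by (simp add: \<delta>_def)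
  have "\<delta> \<le> R / B" "\<delta> \<le> 1 / (2 * K)" by (auto simp: \<delta>_def)
  then have \<delta>B: "\<delta> * B \<le> R" and \<delta>K: "\<delta> * K \<le> 1 / 2" using B(1) K(1) by (auto simp: field_simps)
  have "\<exists>u. u 0 = x \<and> (\<forall>t\<in>{-\<delta><..<\<delta>}. u t \<in> cball x R \<and> (u has_vector_derivative X (u t)) (at t))"
    if x: "x \<in> ball x0 R" for x
  proof -
    have sub: "cball x R \<subseteq> cball x0 R0"
    proof
      fix y assume "y \<in> cball x R"
      then show "y \<in> cball x0 R0" using x dist_triangle[of x0 y x] by (auto simp: R_def)
    qed
    show ?thesis
    proof (rule picard_existence[OF \<delta> less_imp_le[OF R] less_imp_le[OF K(1)] \<delta>K, where f="\<lambda>_. X" and B=B and ?y0.0=x])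
      have "continuous_on ({-\<delta>..\<delta>} \<times> cball x R) (\<lambda>z. X (snd z))"
        by (rule continuous_on_compose2[OF Xc]) (use sub in \<open>auto intro!: continuous_intros\<close>)
      then show "continuous_on ({-\<delta>..\<delta>} \<times> cball x R) (\<lambda>(t, x). X x)" by (simp add: case_prod_beta)
    qed (use K(2) B(2) sub \<delta>B in blast)+
  qed
  then obtain u where u: "\<And>x. x \<in> ball x0 R \<Longrightarrow> u x 0 = x"
    "\<And>x t. x \<in> ball x0 R \<Longrightarrow> t \<in> {-\<delta><..<\<delta>} \<Longrightarrow> u x t \<in> cball x R"
    "\<And>x t. x \<in> ball x0 R \<Longrightarrow> t \<in> {-\<delta><..<\<delta>} \<Longrightarrow> (u x has_vector_derivative X (u x t)) (at t)"
    by metis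
  define \<Phi> where "\<Phi> z = u (snd z) (fst z)" for z
  have in_ball: "\<Phi> (t, x) \<in> ball x0 R0" if "t \<in> {-\<delta><..<\<delta>}" "x \<in> ball x0 R" for t x
    using u(2)[OF that(2,1)] that(2) dist_triangle[of x0 "u x t" x] by (auto simp: \<Phi>_def R_def)
  have sub: "ball x0 R0 \<subseteq> cball x0 R0" by auto
  have fam: "ode_family \<delta> (ball x0 R) (ball x0 R0) K (\<lambda>z. X (snd (snd z))) \<Phi>"
    unfolding ode_family_def
  proof (intro conjI ballI)
    show "norm (X (snd (snd (t, l, x))) - X (snd (snd (t, l, y)))) \<le> K * norm (x - y)"
      if "x \<in> ball x0 R0" "y \<in> ball x0 R0" for t l x y using K(2) that by auto
    show "((\<lambda>t. \<Phi> (t, l)) has_vector_derivative X (snd (snd (t, l, \<Phi> (t, l))))) (at t)"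
      if "t \<in> {-\<delta><..<\<delta>}" "l \<in> ball x0 R" for t l using u(3)[OF that(2,1)] by (simp add: \<Phi>_def)
  qed (use \<delta> K \<delta>K in_ball in auto)
  have "Ck_on k ({-\<delta><..<\<delta>} \<times> ball x0 R) \<Phi>" for k
  proof (rule ode_family_Ck[OF fam])
    show "Ck_on k ({-\<delta><..<\<delta>} \<times> ball x0 R \<times> ball x0 R0) (\<lambda>z. X (snd (snd z)))"
    proof (rule Ck_on_compose[OF _ assms(1) _ _ smooth_onD[OF assms(2)]])
      show "open ({-\<delta><..<\<delta>} \<times> ball x0 R \<times> ball x0 R0)" by (intro open_Times) auto
      show "Ck_on k ({-\<delta><..<\<delta>} \<times> ball x0 R \<times> ball x0 R0) (\<lambda>z. snd (snd z))"
        by (intro Ck_on_linear bounded_linear_intros)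
      show "(\<lambda>z. snd (snd z)) ` ({-\<delta><..<\<delta>} \<times> ball x0 R \<times> ball x0 R0) \<subseteq> U"
        using R0(2) sub by auto
    qed
    show "Ck_on k (ball x0 R) (\<lambda>l. \<Phi> (0, l))"
      by (rule Ck_on_cong[OF open_ball _ Ck_on_linear[OF bounded_linear_ident]]) (use u(1) in \<open>auto simp: \<Phi>_def\<close>)
  qed
  then have "smooth_on ({-\<delta><..<\<delta>} \<times> ball x0 R) \<Phi>" by (simp add: smooth_on_def)
  then show ?thesis
  proof (rule that[OF \<delta> R])
    show "\<Phi> (t, x) \<in> U" if "t \<in> {-\<delta><..<\<delta>}" "x \<in> ball x0 R" for t x
      using in_ball[OF that] sub R0(2) by blast
  qed (use u(1,3) in \<open>auto simp: \<Phi>_def\<close>)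
qed

section \<open>The reduced structure equations\<close>

lemma smooth_pair_nbhd:
  fixes z :: "'a::metric_space \<times> 'b::metric_space"
  assumes "open N" "(x, y) \<in> N"
  obtains r where "r > 0" "\<And>x' y'. dist x x' < r \<Longrightarrow> dist y y' < r \<Longrightarrow> (x', y') \<in> N"
proof -
  obtain A B where AB: "open A" "open B" "x \<in> A" "y \<in> B" "A \<times> B \<subseteq> N"
    using open_prod_elim[OF assms] by (metis mem_Sigma_iff)
  obtain r1 where r1: "r1 > 0" "ball x r1 \<subseteq> A" using openE[OF AB(1,3)] by blast
  obtain r2 where r2: "r2 > 0" "ball y r2 \<subseteq> B" using openE[OF AB(2,4)] by blast
  show ?thesis
  proof (rule that[of "min r1 r2"])
    fix x' y' assume "dist x x' < min r1 r2" "dist y y' < min r1 r2"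
    then have "x' \<in> A" "y' \<in> B" using r1(2) r2(2) by auto
    then show "(x', y') \<in> N" using AB(5) by blast
  qed (use r1 r2 in auto)
qed

text \<open>Otherwise the simplifier turns the index of \<open>\<theta>\<^sub>1\<close> into \<open>Suc 0\<close>.\<close>

declare One_nat_def [simp del]

lemma index5: "(i::5) = 1 \<or> i = 2 \<or> i = 3 \<or> i = 4 \<or> i = 5"
proof (induct i)
  case (of_int z)
  \<comment> \<open>The residue \<open>0\<close> is the index \<open>5\<close> of the last
    alternative, as \<open>5 = 0\<close> in this type.\<close>
  then have "z = 0 \<or> z = 1 \<or> z = 2 \<or> z = 3 \<or> z = 4" by auto
  then show ?case by auto
qed

text \<open>The canonical coframe as seen from \<open>P\<close>: into the equations for
  \<open>d\<sigma>\<close>, \<open>d\<theta>\<^sub>0\<close>, \<open>d\<theta>\<^sub>1\<close> the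
  values \<open>\<alpha> = - 2 (w0 \<theta>\<^sub>0 + w1 \<theta>\<^sub>1)\<close>,
  \<open>\<beta> = - 3 (w0 \<theta>\<^sub>0 + w1 \<theta>\<^sub>1)\<close>,
  \<open>T\<^sub>2 = T\<^sub>5 = 0\<close> and \<open>T\<^sub>4 = -1\<close> are already
  substituted. The form \<open>\<gamma>\<close> is recorded through its
  \<open>\<theta>\<^sub>1\<close>-coefficient \<open>- 3 g1\<close>.\<close>

locale path_coframe =
  fixes P :: "(real^5) set" and M :: "(real^3) set" and D :: "real^3 \<Rightarrow> (real^3) set"
    and \<rho> :: "real^5 \<Rightarrow> real^3" and L :: "real^5 \<Rightarrow> (real^5) set"
    and e :: "real^5 \<Rightarrow> ((real^5) covector)^5"
    and w0 w1 g1 t1 t3 :: "real^5 \<Rightarrow> real" and \<gamma> :: "real^5 \<Rightarrow> (real^5) covector"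
  assumes contact: "contact_structure M D" and fibration: "fibration P M \<rho>" and line_field: "line_field P L"
    and transverse: "\<And>p. p \<in> P \<Longrightarrow> L p \<inter> vertical \<rho> p = {0}"
    and smooth_sigma: "smooth_on P (sigma e)" and smooth_theta0: "smooth_on P (theta e 0)"
    and smooth_theta1: "smooth_on P (theta e 1)"
    and smooth_w0: "smooth_on P w0" and smooth_w1: "smooth_on P w1" and smooth_g1: "smooth_on P g1"
    and contact_iff: "\<And>p v. p \<in> P \<Longrightarrow> fderiv \<rho> p v \<in> D (\<rho> p) \<longleftrightarrow> blinfun_apply (theta e 0 p) v = 0"
    and vertical0: "\<And>p v. p \<in> P \<Longrightarrow> v \<in> vertical \<rho> p \<Longrightarrow> blinfun_apply (theta e 0 p) v = 0"
    and vertical1: "\<And>p v. p \<in> P \<Longrightarrow> v \<in> vertical \<rho> p \<Longrightarrow> blinfun_apply (theta e 1 p) v = 0"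
    and theta_L: "\<And>p v i. p \<in> P \<Longrightarrow> v \<in> L p \<Longrightarrow> i \<le> 3 \<Longrightarrow> blinfun_apply (theta e i p) v = 0"
    and coframe: "\<And>p v. p \<in> P \<Longrightarrow> (\<And>i. blinfun_apply (e p $ i) v = 0) \<Longrightarrow> v = 0"
    and d_sigma: "\<And>p. p \<in> P \<Longrightarrow> ext_d (sigma e) p =
      (- 2 *\<^sub>R (w0 p *\<^sub>R theta e 0 p + w1 p *\<^sub>R theta e 1 p)) \<and>\<^sub>w sigma e p
      + theta e 0 p \<and>\<^sub>w (t1 p *\<^sub>R theta e 1 p + t3 p *\<^sub>R theta e 3 p) - theta e 1 p \<and>\<^sub>w theta e 2 p"
    and d_theta0: "\<And>p. p \<in> P \<Longrightarrow> ext_d (theta e 0) p =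
      (- 3 *\<^sub>R (w0 p *\<^sub>R theta e 0 p + w1 p *\<^sub>R theta e 1 p)) \<and>\<^sub>w theta e 0 p + sigma e p \<and>\<^sub>w theta e 1 p"
    and d_theta1: "\<And>p. p \<in> P \<Longrightarrow> ext_d (theta e 1) p =
      (- (w0 p *\<^sub>R theta e 0 p + w1 p *\<^sub>R theta e 1 p)) \<and>\<^sub>w theta e 1 p
      + \<gamma> p \<and>\<^sub>w theta e 0 p + sigma e p \<and>\<^sub>w theta e 2 p"
    and gamma_g1: "\<And>p v. p \<in> P \<Longrightarrow> blinfun_apply (sigma e p) v = 0 \<Longrightarrow> blinfun_apply (theta e 0 p) v = 0 \<Longrightarrow>
      blinfun_apply (theta e 2 p) v = 0 \<Longrightarrow> blinfun_apply (theta e 3 p) v = 0 \<Longrightarrow>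
      blinfun_apply (\<gamma> p) v = - 3 * g1 p * blinfun_apply (theta e 1 p) v"
begin

abbreviation sg :: "real^5 \<Rightarrow> real^5 \<Rightarrow> real" where "sg p \<equiv> blinfun_apply (sigma e p)"
abbreviation th :: "nat \<Rightarrow> real^5 \<Rightarrow> real^5 \<Rightarrow> real" where "th i p \<equiv> blinfun_apply (theta e i p)"

lemma open_P: "open P" and smooth_rho: "smooth_on P \<rho>" and image_rho: "\<rho> ` P = M"
  and surj_rho: "\<And>p. p \<in> P \<Longrightarrow> surj (fderiv \<rho> p)"
  and connected_fibre: "\<And>x. x \<in> M \<Longrightarrow> connected {p\<in>P. \<rho> p = x}"
  using fibration by (auto simp: fibration_def)

lemma rho_in_M: "p \<in> P \<Longrightarrow> \<rho> p \<in> M"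
  using image_rho by blast

lemma d_sigma_apply:
  "p \<in> P \<Longrightarrow> blinfun_apply (blinfun_apply (ext_d (sigma e) p) u) v =
    - 2 * ((w0 p * th 0 p u + w1 p * th 1 p u) * sg p v - (w0 p * th 0 p v + w1 p * th 1 p v) * sg p u)
    + (th 0 p u * (t1 p * th 1 p v + t3 p * th 3 p v) - th 0 p v * (t1 p * th 1 p u + t3 p * th 3 p u))
    - (th 1 p u * th 2 p v - th 2 p u * th 1 p v)"
  by (simp add: d_sigma wedge_apply blinfun.add_left blinfun.diff_left blinfun.scaleR_left blinfun.minus_left algebra_simps)

text \<open>In product form \<open>d\<theta>\<^sub>0 = (\<sigma> + 3 w1 \<theta>\<^sub>0) \<and>
  \<theta>\<^sub>1\<close>: the \<open>w0\<close> term disappears with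
  \<open>\<theta>\<^sub>0 \<and> \<theta>\<^sub>0\<close>. This shape keeps the second
  differentiation short.\<close>

lemma d_theta0_apply:
  "p \<in> P \<Longrightarrow> blinfun_apply (blinfun_apply (ext_d (theta e 0) p) u) v =
    (sg p u + 3 * w1 p * th 0 p u) * th 1 p v - (sg p v + 3 * w1 p * th 0 p v) * th 1 p u"
  by (simp add: d_theta0 wedge_apply blinfun.add_left blinfun.diff_left blinfun.scaleR_left blinfun.minus_left algebra_simps)

lemma d_theta1_apply:
  "p \<in> P \<Longrightarrow> blinfun_apply (blinfun_apply (ext_d (theta e 1) p) u) v =
    - w0 p * (th 0 p u * th 1 p v - th 0 p v * th 1 p u)
    + (blinfun_apply (\<gamma> p) u * th 0 p v - th 0 p u * blinfun_apply (\<gamma> p) v)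
    + (sg p u * th 2 p v - th 2 p u * sg p v)"
  by (simp add: d_theta1 wedge_apply blinfun.add_left blinfun.diff_left blinfun.scaleR_left blinfun.minus_left algebra_simps)

lemma coframe_zero:
  assumes "p \<in> P" "sg p v = 0" "th 0 p v = 0" "th 1 p v = 0" "th 2 p v = 0" "th 3 p v = 0"
  shows "v = 0"
proof (rule coframe[OF assms(1)])
  show "blinfun_apply (e p $ i) v = 0" for i
    using index5[of i] assms(2-6) by (auto simp: sigma_def theta_def)
qed

lemma dual_vector:
  assumes "p \<in> P"
  obtains v where "sg p v = a" "th 0 p v = b0" "th 1 p v = b1" "th 2 p v = b2" "th 3 p v = b3"
proof -
  define F where "F v = (\<chi> i. blinfun_apply (e p $ i) v)" for v
  have lin: "linear F" unfolding F_def
    by (intro linearI) (simp_all add: vec_eq_iff blinfun.add_right blinfun.scaleR_right)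
  have "F v = 0 \<Longrightarrow> v = 0" for v
    by (rule coframe[OF assms]) (simp add: F_def vec_eq_iff)
  then have "inj F" using linear_injective_0[OF lin] by blast
  then have "surj F" using linear_injective_imp_surjective[OF lin] by simp
  then obtain v where v: "(\<chi> i. if i = 1 then a else if i = 2 then b0 else if i = 3 then b1 else if i = 4 then b2 else b3) = F v"
    by (blast dest: surjD)
  have "blinfun_apply (e p $ i) v = (if i = 1 then a else if i = 2 then b0 else if i = 3 then b1 else if i = 4 then b2 else b3)" for i
    using arg_cong[OF v, of "\<lambda>u. u $ i"] by (simp add: F_def)
  then show ?thesis by (intro that[of v]) (simp_all add: sigma_def theta_def)
qed

text \<open>The coefficient of \<open>\<sigma> \<and> \<theta>\<^sub>0 \<and> \<theta>\<^sub>1\<close> in \<open>d(d\<theta>\<^sub>0) = 0\<close>.\<close>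

lemma w1_along_L:
  assumes p: "p \<in> P" and v: "v \<in> L p"
  shows "fderiv w1 p v = sg p v * (g1 p - w0 p)"
proof -
  \<comment> \<open>Constant vectors, dual to \<open>\<sigma>\<close>,
    \<open>\<theta>\<^sub>0\<close>, \<open>\<theta>\<^sub>1\<close> at \<open>p\<close> only. In
    the cyclic sum the derivatives of the forms then appear in antisymmetric pairs, that is, as
    exterior derivatives.\<close>
  obtain x where x: "sg p x = 1" "th 0 p x = 0" "th 1 p x = 0" "th 2 p x = 0" "th 3 p x = 0"
    using dual_vector[OF p] by blast
  obtain y where y: "sg p y = 0" "th 0 p y = 1" "th 1 p y = 0" "th 2 p y = 0" "th 3 p y = 0"
    using dual_vector[OF p] by blast
  obtain z where z: "sg p z = 0" "th 0 p z = 0" "th 1 p z = 1" "th 2 p z = 0" "th 3 p z = 0"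
    using dual_vector[OF p] by blast
  define Ds where "Ds u v = blinfun_apply (fderiv (sigma e) p u) v" for u v
  define D0 where "D0 u v = blinfun_apply (fderiv (theta e 0) p u) v" for u v
  define D1 where "D1 u v = blinfun_apply (fderiv (theta e 1) p u) v" for u v
  have hs: "((\<lambda>q. sg q b) has_derivative (\<lambda>u. Ds u b)) (at p)"
    and h0: "((\<lambda>q. th 0 q b) has_derivative (\<lambda>u. D0 u b)) (at p)"
    and h1: "((\<lambda>q. th 1 q b) has_derivative (\<lambda>u. D1 u b)) (at p)" for b
    unfolding Ds_def D0_def D1_def
    by (intro bounded_linear.has_derivative[OF blinfun.bounded_linear_left] smooth_on_has_derivative[OF _ p]
        smooth_sigma smooth_theta0 smooth_theta1)+
  note hw = smooth_on_has_derivative[OF smooth_w1 p]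
  have dd: "fderiv (\<lambda>q. blinfun_apply (blinfun_apply (ext_d (theta e 0) q) b) c) p a
     = (Ds a b + 3 * (w1 p * D0 a b + fderiv w1 p a * th 0 p b)) * th 1 p c + (sg p b + 3 * w1 p * th 0 p b) * D1 a c
     - ((Ds a c + 3 * (w1 p * D0 a c + fderiv w1 p a * th 0 p c)) * th 1 p b + (sg p c + 3 * w1 p * th 0 p c) * D1 a b)"
    for a b c
  proof -
    have 1: "fderiv (\<lambda>q. blinfun_apply (blinfun_apply (ext_d (theta e 0) q) b) c) p
      = fderiv (\<lambda>q. (sg q b + 3 * (w1 q * th 0 q b)) * th 1 q c - (sg q c + 3 * (w1 q * th 0 q c)) * th 1 q b) p"
      by (rule frechet_derivative_cong_open[OF open_P p]) (simp add: d_theta0_apply mult.assoc)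
    have 2: "((\<lambda>q. (sg q b + 3 * (w1 q * th 0 q b)) * th 1 q c - (sg q c + 3 * (w1 q * th 0 q c)) * th 1 q b) has_derivative
      (\<lambda>a. (Ds a b + 3 * (w1 p * D0 a b + fderiv w1 p a * th 0 p b)) * th 1 p c + (sg p b + 3 * w1 p * th 0 p b) * D1 a c
     - ((Ds a c + 3 * (w1 p * D0 a c + fderiv w1 p a * th 0 p c)) * th 1 p b + (sg p c + 3 * w1 p * th 0 p c) * D1 a b))) (at p)"
      by (rule has_derivative_eq_rhs, (rule derivative_eq_intros hs h0 h1 hw refl)+) (simp add: fun_eq_iff algebra_simps)
    show ?thesis unfolding 1 frechet_derivative_at[OF 2, symmetric] ..
  qed
  have ds: "Ds u v - Ds v u = blinfun_apply (blinfun_apply (ext_d (sigma e) p) u) v"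
    and d0: "D0 u v - D0 v u = blinfun_apply (blinfun_apply (ext_d (theta e 0) p) u) v"
    and d1: "D1 u v - D1 v u = blinfun_apply (blinfun_apply (ext_d (theta e 1) p) u) v" for u v
    unfolding Ds_def D0_def D1_def
    by (simp_all add: ext_d_apply smooth_on_differentiable[OF smooth_sigma p]
        smooth_on_differentiable[OF smooth_theta0 p] smooth_on_differentiable[OF smooth_theta1 p])
  have "fderiv w1 p x = g1 p - w0 p"
  proof -
    have 0: "(Ds x y - Ds y x) + 3 * w1 p * (D0 x y - D0 y x) + 3 * fderiv w1 p x
        - (D1 y z - D1 z y) - 3 * w1 p * (D1 z x - D1 x z) = 0"
      using ext_d_closed[OF open_P smooth_theta0 p, of y z x] unfolding dd
      by (simp add: x y z algebra_simps)
    \<comment> \<open>The pair for \<open>d\<theta>\<^sub>1(y, z)\<close> gives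
      \<open>- w0 + 3 g1\<close> and two pairs vanish, so the relation reads
      \<open>2 w0 + 3 X w1 + w0 - 3 g1 = 0\<close>, with \<open>X w1\<close> the derivative of
      \<open>w1\<close> along \<open>x\<close>.\<close>
    have "Ds x y - Ds y x = 2 * w0 p" unfolding ds d_sigma_apply[OF p] by (simp add: x y z)
    moreover have "D0 x y - D0 y x = 0" unfolding d0 d_theta0_apply[OF p] by (simp add: x y z)
    moreover have "D1 y z - D1 z y = - w0 p + 3 * g1 p"
      unfolding d1 d_theta1_apply[OF p] using gamma_g1[OF p, of z] by (simp add: x y z)
    moreover have "D1 z x - D1 x z = 0" unfolding d1 d_theta1_apply[OF p] by (simp add: x y z)
    ultimately show ?thesis using 0 by (simp add: algebra_simps)
  qed
  moreover have "v = sg p v *\<^sub>R x"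
  proof -
    have "v - sg p v *\<^sub>R x = 0"
      by (rule coframe_zero[OF p]) (use theta_L[OF p v] x in \<open>simp_all add: blinfun.diff_right blinfun.scaleR_right\<close>)
    then show ?thesis by simp
  qed
  then have "fderiv w1 p v = sg p v * fderiv w1 p x"
    using linear_scale[OF smooth_on_linear_fderiv[OF smooth_w1 p]] by (metis real_scaleR_def)
  ultimately show ?thesis by simp
qed

section \<open>The contact form of \<open>M\<close> on \<open>P\<close>, and vertical
  vectors\<close>

lemma theta0_zero_iff:
  fixes \<phi> :: "(real^3) covector"
  assumes "p \<in> P" "D (\<rho> p) = {w. blinfun_apply \<phi> w = 0}"
  shows "blinfun_apply \<phi> (fderiv \<rho> p v) = 0 \<longleftrightarrow> th 0 p v = 0"
  using contact_iff[OF assms(1), of v] assms(2) by simp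

text \<open>The two covectors have the same kernel, and it contains
  \<open>th 0 p a *\<^sub>R b - th 0 p b *\<^sub>R a\<close>. The relation can be differentiated as
  it stands, without introducing the factor of proportionality and proving it smooth.\<close>

lemma theta0_proportional:
  assumes "p \<in> P" "D (\<rho> p) = {w. blinfun_apply \<phi> w = 0}"
  shows "th 0 p a * blinfun_apply \<phi> (fderiv \<rho> p b) = th 0 p b * blinfun_apply \<phi> (fderiv \<rho> p a)"
proof -
  note lin = smooth_on_linear_fderiv[OF smooth_rho assms(1)]
  have "th 0 p (th 0 p a *\<^sub>R b - th 0 p b *\<^sub>R a) = 0"
    by (simp add: blinfun.diff_right blinfun.scaleR_right)
  then have "blinfun_apply \<phi> (fderiv \<rho> p (th 0 p a *\<^sub>R b - th 0 p b *\<^sub>R a)) = 0"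
    using theta0_zero_iff[OF assms] by blast
  then show ?thesis
    by (simp add: linear_diff[OF lin] linear_scale[OF lin] blinfun.diff_right blinfun.scaleR_right)
qed

text \<open>Obtained by differentiating \<open>\<theta>\<^sub>0 \<and> \<rho>\<^sup>*\<eta> = 0\<close>.\<close>

lemma d_theta0_d_eta:
  assumes p: "p \<in> P" and U: "open U" "\<rho> p \<in> U" "smooth_on U \<eta>"
    and DU: "\<And>y. y \<in> U \<Longrightarrow> D y = {w. blinfun_apply (\<eta> y) w = 0}"
    and v: "th 0 p v = 0" and w: "th 0 p w = 0"
  shows "blinfun_apply (blinfun_apply (ext_d (theta e 0) p) v) w * blinfun_apply (\<eta> (\<rho> p)) (fderiv \<rho> p y)
    = th 0 p y * blinfun_apply (blinfun_apply (ext_d \<eta> (\<rho> p)) (fderiv \<rho> p v)) (fderiv \<rho> p w)"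
proof -
  define S where "S = P \<inter> \<rho> -` U"
  have S: "open S" unfolding S_def
    using continuous_open_preimage[OF smooth_on_continuous[OF smooth_rho] open_P U(1)] .
  have pS: "p \<in> S" using p U by (simp add: S_def)
  have rS: "smooth_on S \<rho>" by (rule smooth_on_subset[OF smooth_rho]) (simp add: S_def)
  define \<zeta> where "\<zeta> b q = blinfun_apply (\<eta> (\<rho> q)) (fderiv \<rho> q b)" for b q
  note h\<eta> = smooth_on_has_derivative[OF U(3,2)]
  have h\<zeta>: "(\<zeta> b has_derivative fderiv (\<zeta> b) p) (at p)" for b
  proof -
    have "smooth_on S (\<zeta> b)" unfolding \<zeta>_def
      by (intro smooth_on_blinfun_apply S smooth_on_compose[OF S U(1) rS _ U(3)] smooth_on_fderiv_dir rS)
        (auto simp: S_def)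
    then show ?thesis using smooth_on_has_derivative pS by blast
  qed
  define D0 where "D0 u v = blinfun_apply (fderiv (theta e 0) p u) v" for u v
  have h0: "((\<lambda>q. th 0 q b) has_derivative (\<lambda>u. D0 u b)) (at p)" for b
    unfolding D0_def
    by (intro bounded_linear.has_derivative[OF blinfun.bounded_linear_left] smooth_on_has_derivative[OF smooth_theta0 p])
  have main: "th 0 p a * fderiv (\<zeta> b) p c + D0 c a * \<zeta> b p = th 0 p b * fderiv (\<zeta> a) p c + D0 c b * \<zeta> a p" for a b c
  proof -
    have 1: "fderiv (\<lambda>q. th 0 q a * \<zeta> b q) p = fderiv (\<lambda>q. th 0 q b * \<zeta> a q) p"
    proof (rule frechet_derivative_cong_open[OF S pS])
      fix q assume "q \<in> S"
      then show "th 0 q a * \<zeta> b q = th 0 q b * \<zeta> a q"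
        unfolding \<zeta>_def by (intro theta0_proportional DU) (auto simp: S_def)
    qed
    have 2: "fderiv (\<lambda>q. th 0 q a * \<zeta> b q) p = (\<lambda>c. th 0 p a * fderiv (\<zeta> b) p c + D0 c a * \<zeta> b p)" for a b
      by (rule frechet_derivative_at[symmetric]) (rule has_derivative_mult[OF h0 h\<zeta>])
    show ?thesis using 1 unfolding 2 by (rule fun_cong)
  qed
  \<comment> \<open>On \<open>v\<close> and \<open>w\<close> both \<open>\<theta>\<^sub>0\<close>
    and the pulled back \<open>\<eta>\<close> vanish at \<open>p\<close>, which leaves one term on
    each side of \<open>main\<close>.\<close>
  have \<zeta>0: "\<zeta> v p = 0" "\<zeta> w p = 0"
    unfolding \<zeta>_def using theta0_zero_iff[OF p DU[OF U(2)]] v w by auto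
  have "D0 v w * \<zeta> y p = th 0 p y * fderiv (\<zeta> w) p v" using main[of w y v] \<zeta>0 w by simp
  moreover have "D0 w v * \<zeta> y p = th 0 p y * fderiv (\<zeta> v) p w" using main[of v y w] \<zeta>0 v by simp
  ultimately have "(D0 v w - D0 w v) * \<zeta> y p = th 0 p y * (fderiv (\<zeta> w) p v - fderiv (\<zeta> v) p w)"
    by (simp add: algebra_simps)
  moreover have "fderiv (\<zeta> w) p v - fderiv (\<zeta> v) p w
      = blinfun_apply (blinfun_apply (ext_d \<eta> (\<rho> p)) (fderiv \<rho> p v)) (fderiv \<rho> p w)"
    unfolding \<zeta>_def by (rule ext_d_pullback[OF S rS pS h\<eta>])
  moreover have "D0 v w - D0 w v = blinfun_apply (blinfun_apply (ext_d (theta e 0) p) v) w"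
    by (simp add: D0_def ext_d_apply smooth_on_differentiable[OF smooth_theta0 p])
  ultimately show ?thesis by (simp add: \<zeta>_def)
qed

lemma contact_form_near:
  assumes "p \<in> P"
 obtains U and \<eta> :: "real^3 \<Rightarrow> (real^3) covector" where "open U" "\<rho> p \<in> U" "U \<subseteq> M" "smooth_on U \<eta>"
    "\<And>y. y \<in> U \<Longrightarrow> D y = {w. blinfun_apply (\<eta> y) w = 0}"
proof -
  have "\<forall>x\<in>M. \<exists>U \<eta>. open U \<and> x \<in> U \<and> U \<subseteq> M \<and> smooth_on U \<eta> \<and>
      (\<forall>y\<in>U. contact_form_at \<eta> y \<and> D y = {w. blinfun_apply (\<eta> y) w = 0})"
    using contact by (simp add: contact_structure_def)
  from bspec[OF this rho_in_M[OF assms]] obtain U \<eta> where *: "open U \<and> \<rho> p \<in> U \<and> U \<subseteq> M \<and> smooth_on U \<eta> \<and>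
      (\<forall>y\<in>U. contact_form_at \<eta> y \<and> D y = {w. blinfun_apply (\<eta> y) w = 0})"
    by (elim exE)
  show ?thesis by (rule that[of U \<eta>]) (use * in auto)
qed

text \<open>On the kernel of \<open>\<theta>\<^sub>0\<close> the form
  \<open>d\<theta>\<^sub>0\<close> is a multiple of the pullback of \<open>d\<eta>\<close>, which
  annihilates vertical vectors. Pairing a vertical \<open>v\<close> with a vector dual to
  \<open>\<theta>\<^sub>1\<close> leaves exactly \<open>\<sigma>(v)\<close>.\<close>

lemma sigma_vertical:
  assumes p: "p \<in> P" and v: "v \<in> vertical \<rho> p"
  shows "sg p v = 0"
proof -
  obtain U and \<eta> :: "real^3 \<Rightarrow> (real^3) covector"
    where U: "open U" "\<rho> p \<in> U" "smooth_on U \<eta>" "\<And>y. y \<in> U \<Longrightarrow> D y = {w. blinfun_apply (\<eta> y) w = 0}"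
    by (rule contact_form_near[OF p]) blast
  obtain y where y: "th 0 p y = 1" using dual_vector[OF p] by blast
  obtain z where z: "sg p z = 0" "th 0 p z = 0" "th 1 p z = 1" using dual_vector[OF p] by blast
  have "fderiv \<rho> p v = 0" using v by (simp add: vertical_def)
  then have "blinfun_apply (blinfun_apply (ext_d (theta e 0) p) v) z * blinfun_apply (\<eta> (\<rho> p)) (fderiv \<rho> p y) = 0"
    using d_theta0_d_eta[OF p U vertical0[OF p v] z(2), of y] by (simp add: blinfun.zero_right)
  moreover have "blinfun_apply (\<eta> (\<rho> p)) (fderiv \<rho> p y) \<noteq> 0"
    using theta0_zero_iff[OF p U(4)[OF U(2)]] y by simp
  ultimately show ?thesis
    using vertical0[OF p v] vertical1[OF p v] z by (simp add: d_theta0_apply[OF p])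
qed

text \<open>Two lifts differ by a vertical vector, on which all three forms vanish. This makes
  lengths and variation fields independent of the lift through which they are computed.\<close>

lemma lift_unique:
  assumes "p \<in> P" "fderiv \<rho> p v = fderiv \<rho> p v'"
  shows "sg p v = sg p v'" "th 0 p v = th 0 p v'" "th 1 p v = th 1 p v'"
proof -
  have "v - v' \<in> vertical \<rho> p"
    using assms linear_diff[OF smooth_on_linear_fderiv[OF smooth_rho assms(1)]] by (simp add: vertical_def)
  from sigma_vertical[OF assms(1) this] vertical0[OF assms(1) this] vertical1[OF assms(1) this]
  show "sg p v = sg p v'" "th 0 p v = th 0 p v'" "th 1 p v = th 1 p v'"
    by (simp_all add: blinfun.diff_right)
qed

text \<open>A pointwise choice with no regularity in \<open>p\<close>. Its value matters only
  through \<open>\<sigma>\<close>, \<open>\<theta>\<^sub>0\<close> and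
  \<open>\<theta>\<^sub>1\<close>, which do not depend on the choice by
  \<open>lift_unique\<close>.\<close>

definition lift :: "real^5 \<Rightarrow> real^3 \<Rightarrow> real^5" where
  "lift p w = (SOME v. fderiv \<rho> p v = w)"

lemma fderiv_lift: "p \<in> P \<Longrightarrow> fderiv \<rho> p (lift p w) = w"
  unfolding lift_def using surj_rho by (metis (mono_tags) someI_ex surjD)

lemma local_lift:
  assumes p0: "p0 \<in> P"
  obtains N \<Lambda> where "open N" "(\<rho> p0, p0) \<in> N" "smooth_on N \<Lambda>" "\<Lambda> ` N \<subseteq> P"
    "\<And>x q. (x, q) \<in> N \<Longrightarrow> \<rho> (\<Lambda> (x, q)) = x"
    "\<And>x q. (x, q) \<in> N \<Longrightarrow> \<rho> q = x \<Longrightarrow> \<Lambda> (x, q) = q"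
proof -
  obtain A where A: "linear A" "fderiv \<rho> p0 \<circ> A = id"
    using linear_surjective_right_inverse[OF smooth_on_linear_fderiv[OF smooth_rho p0] surj_rho[OF p0]] by blast
  have A': "fderiv \<rho> p0 (A y) = y" for y using A(2) by (simp add: fun_eq_iff)
  show ?thesis
    by (rule smooth_submersion_lift[OF open_P smooth_rho p0 A(1) A']) (rule that, assumption+)
qed

section \<open>Descent of the quadratic form to the contact planes\<close>

definition quad :: "real^5 \<Rightarrow> real^5 \<Rightarrow> real" where
  "quad p v = (sg p v)\<^sup>2 + (th 1 p v)\<^sup>2"

lemma quad_lift: "p \<in> P \<Longrightarrow> quad p (lift p (fderiv \<rho> p v)) = quad p v"
  using lift_unique[of p "lift p (fderiv \<rho> p v)" v] fderiv_lift by (simp add: quad_def)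

text \<open>
  Along a curve in a fibre \<open>\<sigma>\<close> and \<open>\<theta>\<^sub>1\<close> are rotated into each other at the rate \<open>\<theta>\<^sub>2\<close>.
\<close>

lemma quad_locally_constant:
  assumes p0: "p0 \<in> P" and w: "w \<in> D (\<rho> p0)"
  obtains r where "r > 0" "\<And>q. q \<in> P \<Longrightarrow> \<rho> q = \<rho> p0 \<Longrightarrow> dist p0 q < r \<Longrightarrow> quad q (lift q w) = quad p0 (lift p0 w)"
proof -
  define x where "x = \<rho> p0"
  obtain N \<Lambda> where \<Lambda>: "open N" "(x, p0) \<in> N" "smooth_on N \<Lambda>" "\<Lambda> ` N \<subseteq> P"
    "\<And>x q. (x, q) \<in> N \<Longrightarrow> \<rho> (\<Lambda> (x, q)) = x"
    "\<And>x q. (x, q) \<in> N \<Longrightarrow> \<rho> q = x \<Longrightarrow> \<Lambda> (x, q) = q"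
    unfolding x_def by (rule local_lift[OF p0]) blast
  obtain r where r: "r > 0" "\<And>x' y'. dist x x' < r \<Longrightarrow> dist p0 y' < r \<Longrightarrow> (x', y') \<in> N"
    using smooth_pair_nbhd[OF \<Lambda>(1,2)] by blast
  have "quad q (lift q w) = quad p0 (lift p0 w)" if q: "q \<in> P" "\<rho> q = x" "dist p0 q < r" for q
  proof -
    \<comment> \<open>The first parameter leads from \<open>p0\<close> to \<open>q\<close>, the
      second moves the base point in direction \<open>w\<close>. After lifting, the first partial
      derivative is vertical and the second is a lift of \<open>w\<close>. The straight segment may
      leave the fibre in between; \<open>\<Lambda>\<close> pushes it back and fixes its
      endpoints.\<close>
    define k where "k z = (x + snd z *\<^sub>R w, p0 + fst z *\<^sub>R (q - p0))" for z :: "real \<times> real"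
    have k: "smooth_on A k" if "open A" for A
      unfolding k_def by (intro smooth_on_Pair smooth_on_add smooth_on_const smooth_on_scaleR that
          smooth_on_linear bounded_linear_fst bounded_linear_snd)
    define W where "W = k -` N"
    have W: "open W" unfolding W_def
      by (rule open_vimage[OF \<Lambda>(1) smooth_on_continuous[OF k[OF open_UNIV]]])
    define m where "m z = \<Lambda> (k z)" for z
    have m: "smooth_on W m" unfolding m_def
      by (rule smooth_on_compose[OF W \<Lambda>(1) k[OF W] _ \<Lambda>(3)]) (auto simp: W_def)
    have mP: "m z \<in> P" if "z \<in> W" for z using that \<Lambda>(4) by (auto simp: m_def W_def)
    have \<rho>m: "\<rho> (m z) = x + snd z *\<^sub>R w" if "z \<in> W" for z
      using that \<Lambda>(5)[of "x + snd z *\<^sub>R w" "p0 + fst z *\<^sub>R (q - p0)"] by (simp add: m_def k_def W_def)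
    have D\<rho>m: "fderiv \<rho> (m z) (fderiv m z v) = snd v *\<^sub>R w" if z: "z \<in> W" for z v
    proof -
      have "fderiv (\<lambda>z. \<rho> (m z)) z v = fderiv \<rho> (m z) (fderiv m z v)"
        by (rule fderiv_compose[OF smooth_on_has_derivative[OF m z] smooth_on_has_derivative[OF smooth_rho mP[OF z]]])
      moreover have "fderiv (\<lambda>z. \<rho> (m z)) z = fderiv (\<lambda>z. x + snd z *\<^sub>R w) z"
        by (rule frechet_derivative_cong_open[OF W z \<rho>m])
      moreover have "((\<lambda>z. x + snd z *\<^sub>R w) has_derivative (\<lambda>v. snd v *\<^sub>R w)) (at z)"
        by (auto intro!: derivative_eq_intros)
      then have "fderiv (\<lambda>z. x + snd z *\<^sub>R w) z = (\<lambda>v. snd v *\<^sub>R w)" by (rule frechet_derivative_at[symmetric])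
      ultimately show ?thesis by simp
    qed
    have inW: "(a, 0) \<in> W" if "a \<in> {0..1}" for a
    proof -
      have "a * dist p0 q \<le> dist p0 q" using that by (simp add: mult_left_le_one_le)
      then have "dist p0 (p0 + a *\<^sub>R (q - p0)) < r"
        using that q(3) by (simp add: dist_norm norm_minus_commute[of p0 q])
      then show ?thesis using r by (simp add: W_def k_def)
    qed
    define s where "s z = sg (m z) (fderiv m z (0, 1))" for z
    define \<tau> where "\<tau> z = th 1 (m z) (fderiv m z (0, 1))" for z
    have vert: "fderiv m z (1, 0) \<in> vertical \<rho> (m z)" if "z \<in> W" for z
      using D\<rho>m[OF that] by (simp add: vertical_def)
    \<comment> \<open>As \<open>\<omega>\<close> vanishes on the vertical first partial derivative
      for all parameters, one of the two terms in the pullback formula for \<open>d\<omega>\<close>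
      drops out.\<close>
    have rot: "fderiv (\<lambda>z. blinfun_apply (\<omega> (m z)) (fderiv m z (0, 1))) z (1, 0)
        = blinfun_apply (blinfun_apply (ext_d \<omega> (m z)) (fderiv m z (1, 0))) (fderiv m z (0, 1))"
      if z: "z \<in> W" and \<omega>: "smooth_on P \<omega>" "\<And>p v. p \<in> P \<Longrightarrow> v \<in> vertical \<rho> p \<Longrightarrow> blinfun_apply (\<omega> p) v = 0"
      for z and \<omega> :: "real^5 \<Rightarrow> (real^5) covector"
    proof -
      have "fderiv (\<lambda>z. blinfun_apply (\<omega> (m z)) (fderiv m z (1, 0))) z = fderiv (\<lambda>z. 0) z"
        by (rule frechet_derivative_cong_open[OF W z]) (use \<omega>(2) mP vert in blast)
      then have "fderiv (\<lambda>z. blinfun_apply (\<omega> (m z)) (fderiv m z (1, 0))) z (0, 1) = 0" by simp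
      with ext_d_pullback[OF W m z smooth_on_has_derivative[OF \<omega>(1) mP[OF z]], of "(0, 1)" "(1, 0)"]
      show ?thesis by simp
    qed
    have der: "((\<lambda>a. (s (a, 0))\<^sup>2 + (\<tau> (a, 0))\<^sup>2) has_vector_derivative 0) (at a)" if a: "a \<in> {0..1}" for a
    proof -
      let ?z = "(a, 0) :: real \<times> real"
      note z = inW[OF a]
      let ?v = "fderiv m ?z (1, 0)" and ?u = "fderiv m ?z (0, 1)"
      have v: "th 0 (m ?z) ?v = 0" "th 1 (m ?z) ?v = 0" "sg (m ?z) ?v = 0"
        using vertical0[OF mP[OF z] vert[OF z]] vertical1[OF mP[OF z] vert[OF z]] sigma_vertical[OF mP[OF z] vert[OF z]] by auto
      have u: "th 0 (m ?z) ?u = 0"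
        using contact_iff[OF mP[OF z], of ?u] D\<rho>m[OF z, of "(0, 1)"] \<rho>m[OF z] w by (simp add: x_def)
      \<comment> \<open>For vertical \<open>?v\<close> and \<open>?u\<close> in the kernel of
        \<open>\<theta>\<^sub>0\<close>, only
        \<open>- \<theta>\<^sub>1 \<and> \<theta>\<^sub>2\<close> survives in
        \<open>d\<sigma>\<close> and only \<open>\<sigma> \<and> \<theta>\<^sub>2\<close> in
        \<open>d\<theta>\<^sub>1\<close>. The opposite signs, due to \<open>T\<^sub>4 = -1\<close>,
        keep the sum of squares constant.\<close>
      have fs: "fderiv s ?z (1, 0) = \<tau> ?z * th 2 (m ?z) ?v"
        unfolding s_def using rot[OF z smooth_sigma sigma_vertical] u v by (simp add: d_sigma_apply[OF mP[OF z]] \<tau>_def)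
      have ft: "fderiv \<tau> ?z (1, 0) = - s ?z * th 2 (m ?z) ?v"
        unfolding \<tau>_def using rot[OF z smooth_theta1 vertical1] u v by (simp add: d_theta1_apply[OF mP[OF z]] s_def)
      have sm: "smooth_on W s" "smooth_on W \<tau>" unfolding s_def \<tau>_def
        by (intro smooth_on_blinfun_apply W smooth_on_compose[OF W open_P m _ smooth_sigma]
            smooth_on_compose[OF W open_P m _ smooth_theta1] smooth_on_fderiv_dir m; use mP in auto)+
      have line: "((\<lambda>a. (a, 0::real)) has_derivative (\<lambda>h. (h, 0))) (at a)"
        by (intro has_derivative_Pair has_derivative_ident has_derivative_const)
      have hs: "((\<lambda>a. h (a, 0)) has_real_derivative fderiv h ?z (1, 0)) (at a)" if "smooth_on W h" for h :: "real \<times> real \<Rightarrow> real"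
      proof -
        note hd = smooth_on_has_derivative[OF that z]
        have 1: "((\<lambda>a. h (a, 0)) has_derivative (\<lambda>t. fderiv h ?z (t, 0))) (at a)"
          by (rule has_derivative_compose[OF line hd])
        have 2: "(\<lambda>t. fderiv h ?z (t, 0)) = (*) (fderiv h ?z (1, 0))"
        proof
          fix t show "fderiv h ?z (t, 0) = fderiv h ?z (1, 0) * t"
            using linear_scale[OF has_derivative_linear[OF hd], of t "(1, 0)"] by simp
        qed
        show ?thesis using 1 unfolding has_field_derivative_def 2 .
      qed
      have "((\<lambda>a. (s (a, 0))\<^sup>2 + (\<tau> (a, 0))\<^sup>2) has_real_derivative
          2 * s ?z * fderiv s ?z (1, 0) + 2 * \<tau> ?z * fderiv \<tau> ?z (1, 0)) (at a)"
        by (auto intro!: derivative_eq_intros hs sm)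
      then show ?thesis unfolding fs ft by (simp add: has_real_derivative_iff_has_vector_derivative algebra_simps)
    qed
    have "norm (((s (1, 0))\<^sup>2 + (\<tau> (1, 0))\<^sup>2) - ((s (0, 0))\<^sup>2 + (\<tau> (0, 0))\<^sup>2)) \<le> 0 * (1 - 0)"
      by (rule vector_derivative_bound[where \<phi>="\<lambda>a. (s (a, 0))\<^sup>2 + (\<tau> (a, 0))\<^sup>2", OF _ has_vector_derivative_at_within[OF der]]) auto
    then have "quad (m (1, 0)) (fderiv m (1, 0) (0, 1)) = quad (m (0, 0)) (fderiv m (0, 0) (0, 1))"
      by (simp add: quad_def s_def \<tau>_def)
    moreover have "quad (m (a, 0)) (fderiv m (a, 0) (0, 1)) = quad (m (a, 0)) (lift (m (a, 0)) w)" if "a \<in> {0..1}" for a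
      using quad_lift[OF mP[OF inW[OF that]], of "fderiv m (a, 0) (0, 1)"] D\<rho>m[OF inW[OF that]] by simp
    moreover have "m (0, 0) = p0"
      using \<Lambda>(6)[OF \<Lambda>(2) x_def[symmetric]] by (simp add: m_def k_def)
    moreover have "m (1, 0) = q"
    proof -
      have "(1, 0) \<in> W" by (rule inW) simp
      then have "(x, q) \<in> N" by (simp add: W_def k_def)
      from \<Lambda>(6)[OF this q(2)] show ?thesis by (simp add: m_def k_def)
    qed
    ultimately show ?thesis by (metis atLeastAtMost_iff order_refl zero_le_one)
  qed
  then show ?thesis using that r(1) by (auto simp: x_def)
qed

text \<open>A locally constant function on a connected fibre is constant.\<close>

lemma quad_fibre_constant:
  assumes "p \<in> P" "q \<in> P" "\<rho> p = \<rho> q" "w \<in> D (\<rho> p)"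
  shows "quad p (lift p w) = quad q (lift q w)"
proof (rule connected_local_const[where f="\<lambda>p. quad p (lift p w)" and A="{r\<in>P. \<rho> r = \<rho> p}"])
  show "connected {r\<in>P. \<rho> r = \<rho> p}" using connected_fibre rho_in_M[OF assms(1)] by blast
  show "\<forall>a\<in>{r\<in>P. \<rho> r = \<rho> p}. \<forall>\<^sub>F b in at a within {r\<in>P. \<rho> r = \<rho> p}. quad a (lift a w) = quad b (lift b w)"
  proof
    fix a assume a: "a \<in> {r\<in>P. \<rho> r = \<rho> p}"
    then have aP: "a \<in> P" and wa: "w \<in> D (\<rho> a)" using assms(4) by auto
    obtain r where r: "r > 0" "\<And>q. q \<in> P \<Longrightarrow> \<rho> q = \<rho> a \<Longrightarrow> dist a q < r \<Longrightarrow> quad q (lift q w) = quad a (lift a w)"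
      by (rule quad_locally_constant[OF aP wa]) blast
    show "\<forall>\<^sub>F b in at a within {r\<in>P. \<rho> r = \<rho> p}. quad a (lift a w) = quad b (lift b w)"
      unfolding eventually_at
    proof (intro exI[of _ r] conjI ballI impI)
      fix b assume "b \<in> {r \<in> P. \<rho> r = \<rho> p}" "b \<noteq> a \<and> dist b a < r"
      then show "quad a (lift a w) = quad b (lift b w)"
        using r(2)[of b] a by (simp add: dist_commute)
    qed (rule r(1))
  qed
qed (use assms in auto)

text \<open>Constancy along fibres and independence of the lift supply the uniqueness behind the
  definite description in \<open>descended_metric\<close>.\<close>

lemma descended_metric_eq:
  assumes "p \<in> P" "th 0 p v = 0"
  shows "descended_metric P \<rho> e (\<rho> p) (fderiv \<rho> p v) = quad p v"
  unfolding descended_metric_def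
proof (rule the_equality)
  show "\<exists>pa\<in>P. \<exists>va. \<rho> pa = \<rho> p \<and> th 0 pa va = 0 \<and> fderiv \<rho> pa va = fderiv \<rho> p v \<and>
      quad p v = (sg pa va)\<^sup>2 + (th 1 pa va)\<^sup>2"
    using assms by (auto simp: quad_def)
  fix r assume "\<exists>pa\<in>P. \<exists>va. \<rho> pa = \<rho> p \<and> th 0 pa va = 0 \<and> fderiv \<rho> pa va = fderiv \<rho> p v \<and>
      r = (sg pa va)\<^sup>2 + (th 1 pa va)\<^sup>2"
  then obtain p' v' where p': "p' \<in> P" "\<rho> p' = \<rho> p" "fderiv \<rho> p' v' = fderiv \<rho> p v" "r = quad p' v'"
    by (auto simp: quad_def)
  have "fderiv \<rho> p v \<in> D (\<rho> p)" using contact_iff assms by blast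
  then show "r = quad p v"
    using quad_fibre_constant[OF assms(1) p'(1) p'(2)[symmetric]] quad_lift[OF assms(1), of v] quad_lift[OF p'(1), of v'] p'(3,4)
    by simp
qed

end

section \<open>First variation of arclength\<close>

lemma smooth_on_slice:
  assumes "smooth_on N h" "(t, s) \<in> N"
  shows "((\<lambda>t. h (t, s)) has_vector_derivative fderiv h (t, s) (1, 0)) (at t)"
    "((\<lambda>s. h (t, s)) has_vector_derivative fderiv h (t, s) (0, 1)) (at s)"
proof -
  note hd = smooth_on_has_derivative[OF assms]
  note lin = linear_scale[OF has_derivative_linear[OF hd]]
  have 1: "((\<lambda>t. (t, s)) has_derivative (\<lambda>r. (r, 0))) (at t)"
    by (intro has_derivative_Pair has_derivative_ident has_derivative_const)
  have 2: "((\<lambda>s. (t, s)) has_derivative (\<lambda>r. (0, r))) (at s)"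
    by (intro has_derivative_Pair has_derivative_ident has_derivative_const)
  have e1: "(\<lambda>r. fderiv h (t, s) (r, 0)) = (\<lambda>r. r *\<^sub>R fderiv h (t, s) (1, 0))"
  proof
    fix r show "fderiv h (t, s) (r, 0) = r *\<^sub>R fderiv h (t, s) (1, 0)"
      using lin[of r "(1, 0)"] by simp
  qed
  have e2: "(\<lambda>r. fderiv h (t, s) (0, r)) = (\<lambda>r. r *\<^sub>R fderiv h (t, s) (0, 1))"
  proof
    fix r show "fderiv h (t, s) (0, r) = r *\<^sub>R fderiv h (t, s) (0, 1)"
      using lin[of r "(0, 1)"] by simp
  qed
  show "((\<lambda>t. h (t, s)) has_vector_derivative fderiv h (t, s) (1, 0)) (at t)"
    using has_derivative_compose[OF 1 hd] unfolding has_vector_derivative_def e1 .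
  show "((\<lambda>s. h (t, s)) has_vector_derivative fderiv h (t, s) (0, 1)) (at s)"
    using has_derivative_compose[OF 2 hd] unfolding has_vector_derivative_def e2 .
qed

locale path_variation = path_coframe P M D \<rho> L e w0 w1 g1 t1 t3 \<gamma>
  for P :: "(real^5) set" and M :: "(real^3) set" and D :: "real^3 \<Rightarrow> (real^3) set"
    and \<rho> :: "real^5 \<Rightarrow> real^3" and L :: "real^5 \<Rightarrow> (real^5) set"
    and e :: "real^5 \<Rightarrow> ((real^5) covector)^5"
    and w0 w1 g1 t1 t3 :: "real^5 \<Rightarrow> real" and \<gamma> :: "real^5 \<Rightarrow> (real^5) covector" +
  fixes J :: "real set" and c :: "real \<Rightarrow> real^5" and a b \<epsilon> :: real and F :: "real \<times> real \<Rightarrow> real^3"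
  assumes path: "path_in P L J c"
    and variation: "contact_variation M D J (\<rho> \<circ> c) a b \<epsilon> F"
begin

lemma open_J: "open J" and smooth_c: "smooth_on J c" and c_in_P: "\<And>t. t \<in> J \<Longrightarrow> c t \<in> P"
  and c'_nz: "\<And>t. t \<in> J \<Longrightarrow> fderiv c t 1 \<noteq> 0" and c'_L: "\<And>t. t \<in> J \<Longrightarrow> fderiv c t 1 \<in> L (c t)"
  using path smooth_on_vector_derivative(2)[of J c] by (auto simp: path_in_def)

lemma ab: "a < b" "{a..b} \<subseteq> J" and \<epsilon>: "0 < \<epsilon>" and smooth_F: "smooth_on (J \<times> {-\<epsilon><..<\<epsilon>}) F"
  and F_0: "\<And>t. t \<in> J \<Longrightarrow> F (t, 0) = \<rho> (c t)"
  and F_outside: "\<And>t s. t \<in> J \<Longrightarrow> t \<notin> {a..b} \<Longrightarrow> s \<in> {-\<epsilon><..<\<epsilon>} \<Longrightarrow> F (t, s) = \<rho> (c t)"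
  using variation by (auto simp: contact_variation_def)

lemma F_contact: "t \<in> J \<Longrightarrow> s \<in> {-\<epsilon><..<\<epsilon>} \<Longrightarrow> fderiv F (t, s) (1, 0) \<in> D (F (t, s))"
proof -
  assume t: "t \<in> J" and s: "s \<in> {-\<epsilon><..<\<epsilon>}"
  have "contact_curve M D J (\<lambda>t. F (t, s))" using variation s by (simp add: contact_variation_def)
  then have "vector_derivative (\<lambda>t. F (t, s)) (at t) \<in> D (F (t, s))" using t by (simp add: contact_curve_def)
  moreover have "vector_derivative (\<lambda>t. F (t, s)) (at t) = fderiv F (t, s) (1, 0)"
    by (rule vector_derivative_at[OF smooth_on_slice(1)[OF smooth_F]]) (use t s in auto)
  ultimately show ?thesis by simp
qed

text \<open>Signed: negative where the path runs against \<open>\<sigma>\<close>.\<close>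

definition speed :: "real \<Rightarrow> real" where "speed t = sg (c t) (fderiv c t 1)"
definition vF :: "real \<Rightarrow> real^5" where "vF t = lift (c t) (fderiv F (t, 0) (0, 1))"
definition y0 :: "real \<Rightarrow> real" where "y0 t = th 0 (c t) (vF t)"
text \<open>The boundary term of the first variation. \<open>d\<sigma>\<close> contributes
  \<open>- 2 w1 \<theta>\<^sub>1(V) \<sigma>(c')\<close>, which is \<open>- 2 w1 y0'\<close> because
  \<open>y0' = \<theta>\<^sub>1(V) \<sigma>(c')\<close>; integrating this by parts produces the
  subtracted term.\<close>

definition Z :: "real \<Rightarrow> real" where "Z t = sg (c t) (vF t) - 2 * w1 (c t) * y0 t"
definition sqlen :: "real \<times> real \<Rightarrow> real" where
  "sqlen z = descended_metric P \<rho> e (F z) (fderiv F z (1, 0))"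

lemma theta_c': "t \<in> J \<Longrightarrow> i \<le> 3 \<Longrightarrow> th i (c t) (fderiv c t 1) = 0"
  using theta_L[OF c_in_P c'_L] .

lemma speed_nz: "t \<in> J \<Longrightarrow> speed t \<noteq> 0"
  using coframe_zero[OF c_in_P, of t "fderiv c t 1"] theta_c'[of t] c'_nz by (auto simp: speed_def)

lemma continuous_speed: "continuous_on J speed"
  unfolding speed_def[abs_def]
  by (rule smooth_on_continuous) (intro smooth_on_blinfun_apply open_J smooth_on_fderiv_dir smooth_c
      smooth_on_compose[OF open_J open_P smooth_c _ smooth_sigma], use c_in_P in auto)

text \<open>The base point of the lift moves along \<open>c\<close>, and \<open>\<Lambda>\<close>
  keeps points that already lie over the target; hence the lift of the undisturbed curve is
  \<open>c\<close> itself.\<close>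

lemma chart:
  assumes t0: "t0 \<in> J"
  obtains N p where "open N" "(t0, 0) \<in> N" "N \<subseteq> J \<times> {-\<epsilon><..<\<epsilon>}" "smooth_on N p"
    "\<And>z. z \<in> N \<Longrightarrow> p z \<in> P" "\<And>z. z \<in> N \<Longrightarrow> \<rho> (p z) = F z" "\<And>t. (t, 0) \<in> N \<Longrightarrow> p (t, 0) = c t"
proof -
  let ?O = "J \<times> {-\<epsilon><..<\<epsilon>}"
  have opO: "open ?O" by (intro open_Times open_J) simp
  obtain N \<Lambda> where \<Lambda>: "open N" "(\<rho> (c t0), c t0) \<in> N" "smooth_on N \<Lambda>" "\<Lambda> ` N \<subseteq> P"
    "\<And>x q. (x, q) \<in> N \<Longrightarrow> \<rho> (\<Lambda> (x, q)) = x"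
    "\<And>x q. (x, q) \<in> N \<Longrightarrow> \<rho> q = x \<Longrightarrow> \<Lambda> (x, q) = q"
    by (rule local_lift[OF c_in_P[OF t0]]) blast
  define k where "k z = (F z, c (fst z))" for z
  have k: "smooth_on ?O k" unfolding k_def
    by (intro smooth_on_Pair opO smooth_F smooth_on_compose[OF opO open_J smooth_on_linear[OF bounded_linear_fst] _ smooth_c]) auto
  define N' where "N' = ?O \<inter> k -` N"
  have N': "open N'" unfolding N'_def
    using continuous_open_preimage[OF smooth_on_continuous[OF k] opO \<Lambda>(1)] .
  show ?thesis
  proof (rule that[of N' "\<lambda>z. \<Lambda> (k z)"])
    show "(t0, 0) \<in> N'" using t0 \<epsilon> \<Lambda>(2) F_0[OF t0] by (simp add: N'_def k_def)
    show "smooth_on N' (\<lambda>z. \<Lambda> (k z))"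
      by (rule smooth_on_compose[OF N' \<Lambda>(1) smooth_on_subset[OF k] _ \<Lambda>(3)]) (auto simp: N'_def)
    show "\<Lambda> (k z) \<in> P" if "z \<in> N'" for z using that \<Lambda>(4) by (auto simp: N'_def)
    show "\<rho> (\<Lambda> (k z)) = F z" if "z \<in> N'" for z
      using that \<Lambda>(5)[of "F z" "c (fst z)"] by (simp add: N'_def k_def)
    show "\<Lambda> (k (t, 0)) = c t" if "(t, 0) \<in> N'" for t
    proof -
      have "t \<in> J" and k0: "k (t, 0) \<in> N" using that by (auto simp: N'_def)
      then have k1: "k (t, 0) = (\<rho> (c t), c t)" by (simp add: k_def F_0)
      show ?thesis using \<Lambda>(6)[OF k0[unfolded k1] refl] by (simp add: k1)
    qed
    show "N' \<subseteq> J \<times> {-\<epsilon><..<\<epsilon>}" by (simp add: N'_def)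
  qed (rule N')
qed

section \<open>Computations in one local lift of the variation\<close>

context
  fixes N p
  assumes N: "open N" "N \<subseteq> J \<times> {-\<epsilon><..<\<epsilon>}" and p: "smooth_on N p"
    and pP: "\<And>z. z \<in> N \<Longrightarrow> p z \<in> P" and \<rho>p: "\<And>z. z \<in> N \<Longrightarrow> \<rho> (p z) = F z"
    and pc: "\<And>t. (t, 0) \<in> N \<Longrightarrow> p (t, 0) = c t"
begin

lemma chart_fderiv: 
  assumes "z \<in> N"
  shows "fderiv \<rho> (p z) (fderiv p z v) = fderiv F z v"
proof -
  have "fderiv (\<lambda>z. \<rho> (p z)) z v = fderiv \<rho> (p z) (fderiv p z v)"
    by (rule fderiv_compose[OF smooth_on_has_derivative[OF p assms] smooth_on_has_derivative[OF smooth_rho pP[OF assms]]])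
  moreover have "fderiv (\<lambda>z. \<rho> (p z)) z = fderiv F z"
    by (rule frechet_derivative_cong_open[OF N(1) assms \<rho>p])
  ultimately show ?thesis by simp
qed

lemma chart_theta0: "z \<in> N \<Longrightarrow> th 0 (p z) (fderiv p z (1, 0)) = 0"
  using contact_iff[OF pP, of z "fderiv p z (1, 0)"] F_contact[of "fst z" "snd z"] N(2)
  by (auto simp: chart_fderiv \<rho>p)

lemma chart_base:
  assumes t: "(t, 0) \<in> N"
  shows "fderiv p (t, 0) (1, 0) = fderiv c t 1" 
proof -
  have tJ: "t \<in> J" using t N(2) by auto
  have op: "open {t. (t, 0::real) \<in> N}"
    using open_vimage[OF N(1), of "\<lambda>t. (t, 0::real)"] by (simp add: vimage_def continuous_on_Pair continuous_on_id)
  have "((\<lambda>t. p (t, 0)) has_vector_derivative fderiv p (t, 0) (1, 0)) (at t)"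
    by (rule smooth_on_slice(1)[OF p t])
  then have "(c has_vector_derivative fderiv p (t, 0) (1, 0)) (at t)"
    by (rule has_vector_derivative_transform_within_open[OF _ op]) (use t pc in auto)
  then show ?thesis
    using vector_derivative_unique_at smooth_on_vector_derivative(1)[OF smooth_c tJ] by blast
qed

lemma chart_sqlen: "z \<in> N \<Longrightarrow> sqlen z = quad (p z) (fderiv p z (1, 0))"
  unfolding sqlen_def using descended_metric_eq[OF pP chart_theta0] by (simp add: chart_fderiv \<rho>p)

lemma chart_smooth_form:
  assumes "smooth_on P \<omega>"
  shows "smooth_on N (\<lambda>z. blinfun_apply (\<omega> (p z)) (fderiv p z v))"
  by (intro smooth_on_blinfun_apply N smooth_on_compose[OF N(1) open_P p _ assms] smooth_on_fderiv_dir p)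
    (use pP in auto)

lemma chart_smooth_sqlen: "smooth_on N sqlen"
proof (rule smooth_on_cong[OF N(1)])
  let ?s = "\<lambda>z. sg (p z) (fderiv p z (1, 0))" and ?t = "\<lambda>z. th 1 (p z) (fderiv p z (1, 0))"
  show "smooth_on N (\<lambda>z. ?s z * ?s z + ?t z * ?t z)"
    by (intro smooth_on_add smooth_on_mult N chart_smooth_form smooth_sigma smooth_theta1)
  show "?s z * ?s z + ?t z * ?t z = sqlen z" if "z \<in> N" for z
    using chart_sqlen[OF that] by (simp add: quad_def power2_eq_square)
qed

text \<open>Both vectors project to the variation field of \<open>F\<close>. So the quantities
  defined by the unregulated choice \<open>lift\<close> coincide along the path with smooth
  ones.\<close>

lemma chart_vF:
  assumes t: "(t, 0) \<in> N"
  shows "sg (c t) (vF t) = sg (p (t, 0)) (fderiv p (t, 0) (0, 1))"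
    "th 0 (c t) (vF t) = th 0 (p (t, 0)) (fderiv p (t, 0) (0, 1))"
    "th 1 (c t) (vF t) = th 1 (p (t, 0)) (fderiv p (t, 0) (0, 1))"
proof -
  have cP: "c t \<in> P" using pP[OF t] pc[OF t] by simp
  have "fderiv \<rho> (c t) (vF t) = fderiv \<rho> (c t) (fderiv p (t, 0) (0, 1))"
    unfolding vF_def fderiv_lift[OF cP] using chart_fderiv[OF t] pc[OF t] by simp
  from lift_unique[OF cP this] pc[OF t]
  show "sg (c t) (vF t) = sg (p (t, 0)) (fderiv p (t, 0) (0, 1))"
    "th 0 (c t) (vF t) = th 0 (p (t, 0)) (fderiv p (t, 0) (0, 1))"
    "th 1 (c t) (vF t) = th 1 (p (t, 0)) (fderiv p (t, 0) (0, 1))" by simp_all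
qed

lemma chart_slice_derivative:
  fixes h :: "real \<times> real \<Rightarrow> real" and g :: "real \<Rightarrow> real"
  assumes h: "smooth_on N h" and t: "(t, 0) \<in> N" and eq: "\<And>t. (t, 0) \<in> N \<Longrightarrow> g t = h (t, 0)"
  shows "(g has_real_derivative fderiv h (t, 0) (1, 0)) (at t)"
proof -
  have op: "open {t. (t, 0::real) \<in> N}"
    using open_vimage[OF N(1), of "\<lambda>t. (t, 0::real)"] by (simp add: vimage_def continuous_on_Pair continuous_on_id)
  have "(g has_vector_derivative fderiv h (t, 0) (1, 0)) (at t)"
    by (rule has_vector_derivative_transform_within_open[OF smooth_on_slice(1)[OF h t] op]) (use t eq in auto)
  then show ?thesis by (simp add: has_real_derivative_iff_has_vector_derivative)
qed

lemma chart_pullback: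
  assumes t: "(t, 0) \<in> N" and \<omega>: "smooth_on P \<omega>"
  shows "fderiv (\<lambda>z. blinfun_apply (\<omega> (p z)) (fderiv p z (1, 0))) (t, 0) (0, 1)
       - fderiv (\<lambda>z. blinfun_apply (\<omega> (p z)) (fderiv p z (0, 1))) (t, 0) (1, 0)
       = blinfun_apply (blinfun_apply (ext_d \<omega> (c t)) (fderiv p (t, 0) (0, 1))) (fderiv c t 1)"
  using ext_d_pullback[OF N(1) p t smooth_on_has_derivative[OF \<omega> pP[OF t]], of "(1, 0)" "(0, 1)"]
  unfolding chart_base[OF t] pc[OF t] .

text \<open>All curves of the variation are contact, so \<open>\<theta>\<^sub>0\<close> of the
  \<open>t\<close>-derivative vanishes for every \<open>s\<close>. What remains of the pullback
  formula is that the \<open>t\<close>-derivative of \<open>\<theta>\<^sub>0(V)\<close> equals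
  \<open>- d\<theta>\<^sub>0(V, c')\<close>.\<close>

lemma chart_y0:
  assumes t: "(t, 0) \<in> N"
  shows "(y0 has_real_derivative speed t * th 1 (c t) (vF t)) (at t)"
proof -
  have tJ: "t \<in> J" using t N(2) by auto
  have "fderiv (\<lambda>z. th 0 (p z) (fderiv p z (1, 0))) (t, 0) = fderiv (\<lambda>z. 0) (t, 0)"
    by (rule frechet_derivative_cong_open[OF N(1) t chart_theta0])
  then have "fderiv (\<lambda>z. th 0 (p z) (fderiv p z (1, 0))) (t, 0) (0, 1) = 0" by simp
  then have "fderiv (\<lambda>z. th 0 (p z) (fderiv p z (0, 1))) (t, 0) (1, 0) = speed t * th 1 (c t) (vF t)"
    using chart_pullback[OF t smooth_theta0] theta_c'[OF tJ, of 0] theta_c'[OF tJ, of 1] chart_vF[OF t] pc[OF t]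
    by (simp add: d_theta0_apply[OF c_in_P[OF tJ]] speed_def)
  moreover have "(y0 has_real_derivative fderiv (\<lambda>z. th 0 (p z) (fderiv p z (0, 1))) (t, 0) (1, 0)) (at t)"
    by (rule chart_slice_derivative[OF chart_smooth_form[OF smooth_theta0] t]) (simp add: y0_def chart_vF)
  ultimately show ?thesis by simp
qed

text \<open>The square of \<open>\<theta>\<^sub>1\<close> contributes nothing to first order, since
  \<open>\<theta>\<^sub>1(c') = 0\<close>.\<close>

lemma chart_sqlen_derivative:
  assumes t: "(t, 0) \<in> N"
  shows "fderiv sqlen (t, 0) (0, 1) = 2 * speed t * fderiv (\<lambda>z. sg (p z) (fderiv p z (1, 0))) (t, 0) (0, 1)"
proof -
  have tJ: "t \<in> J" using t N(2) by auto
  let ?s = "\<lambda>z. sg (p z) (fderiv p z (1, 0))" and ?t = "\<lambda>z. th 1 (p z) (fderiv p z (1, 0))"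
  note hs = smooth_on_has_derivative[OF chart_smooth_form[OF smooth_sigma] t]
    and ht = smooth_on_has_derivative[OF chart_smooth_form[OF smooth_theta1] t]
  have "fderiv sqlen (t, 0) = fderiv (\<lambda>z. ?s z * ?s z + ?t z * ?t z) (t, 0)"
    by (rule frechet_derivative_cong_open[OF N(1) t]) (simp add: chart_sqlen quad_def power2_eq_square)
  also have "\<dots> = (\<lambda>v. (?s (t, 0) * fderiv ?s (t, 0) v + fderiv ?s (t, 0) v * ?s (t, 0))
      + (?t (t, 0) * fderiv ?t (t, 0) v + fderiv ?t (t, 0) v * ?t (t, 0)))"
    by (rule frechet_derivative_at[symmetric]) (intro has_derivative_add has_derivative_mult hs ht)
  finally show ?thesis
    using theta_c'[OF tJ, of 1] unfolding chart_base[OF t] pc[OF t] by (simp add: speed_def)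
qed

text \<open>In \<open>?A - ?S = d\<sigma>(V, c')\<close> the \<open>\<theta>\<^sub>1(V)\<close> part
  is cancelled by differentiating \<open>y0\<close> inside \<open>Z\<close>. Differentiating
  \<open>w1\<close> instead gives \<open>speed t * (g1 - w0)\<close> by \<open>w1_along_L\<close>;
  with the \<open>w0\<close> already in \<open>d\<sigma>\<close> this makes the combination
  \<open>g1 - 2 * w0\<close>.\<close>

lemma chart_Z:
  assumes t: "(t, 0) \<in> N"
  shows "(Z has_real_derivative fderiv sqlen (t, 0) (0, 1) / (2 * speed t)
    - 2 * speed t * (g1 (c t) - 2 * w0 (c t)) * y0 t) (at t)"
proof -
  have tJ: "t \<in> J" using t N(2) by auto
  let ?A = "fderiv (\<lambda>z. sg (p z) (fderiv p z (1, 0))) (t, 0) (0, 1)"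
  let ?S = "fderiv (\<lambda>z. sg (p z) (fderiv p z (0, 1))) (t, 0) (1, 0)"
  have A: "?A - ?S = - 2 * (w0 (c t) * y0 t + w1 (c t) * th 1 (c t) (vF t)) * speed t"
    using chart_pullback[OF t smooth_sigma] theta_c'[OF tJ, of 0] theta_c'[OF tJ, of 1] theta_c'[OF tJ, of 2] theta_c'[OF tJ, of 3]
      chart_vF[OF t] pc[OF t]
    by (simp add: d_sigma_apply[OF c_in_P[OF tJ]] speed_def y0_def left_diff_distrib distrib_right)
  have "((\<lambda>t. sg (c t) (vF t)) has_real_derivative ?S) (at t)"
    by (rule chart_slice_derivative[OF chart_smooth_form[OF smooth_sigma] t]) (simp add: chart_vF)
  moreover have "((\<lambda>t. w1 (c t)) has_real_derivative speed t * (g1 (c t) - w0 (c t))) (at t)"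
  proof -
    have cd: "(c has_derivative (\<lambda>r. r *\<^sub>R fderiv c t 1)) (at t)"
      using smooth_on_vector_derivative(1)[OF smooth_c tJ] by (simp add: has_vector_derivative_def)
    note wd = smooth_on_has_derivative[OF smooth_w1 c_in_P[OF tJ]]
    have "((\<lambda>t. w1 (c t)) has_derivative (\<lambda>r. fderiv w1 (c t) (r *\<^sub>R fderiv c t 1))) (at t)"
      by (rule has_derivative_compose[OF cd wd])
    then show ?thesis
      unfolding linear_scale[OF has_derivative_linear[OF wd]] w1_along_L[OF c_in_P[OF tJ] c'_L[OF tJ]]
      by (simp add: has_field_derivative_def speed_def mult_commute_abs)
  qed
  ultimately have "(Z has_real_derivative ?S - (2 * w1 (c t) * (speed t * th 1 (c t) (vF t))
      + 2 * (speed t * (g1 (c t) - w0 (c t))) * y0 t)) (at t)"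
    unfolding Z_def[abs_def]
    by (auto intro!: derivative_eq_intros chart_y0[OF t] simp: algebra_simps)
  moreover have "?S - (2 * w1 (c t) * (speed t * th 1 (c t) (vF t)) + 2 * (speed t * (g1 (c t) - w0 (c t))) * y0 t)
      = ?A - 2 * speed t * (g1 (c t) - 2 * w0 (c t)) * y0 t"
    using A by (simp add: algebra_simps)
  moreover have "?A = fderiv sqlen (t, 0) (0, 1) / (2 * speed t)"
    using speed_nz[OF tJ] by (simp add: chart_sqlen_derivative[OF t])
  ultimately show ?thesis by simp
qed

end

section \<open>From local lifts to the whole path\<close>

lemma Z_derivative:
  assumes "t \<in> J"
  shows "(Z has_real_derivative fderiv sqlen (t, 0) (0, 1) / (2 * speed t)
    - 2 * speed t * (g1 (c t) - 2 * w0 (c t)) * y0 t) (at t)"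
  by (rule chart[OF assms], rule chart_Z) assumption+

lemma continuous_y0: "continuous_on J y0"
proof (intro continuous_at_imp_continuous_on ballI)
  fix t assume "t \<in> J"
  then have "(y0 has_real_derivative speed t * th 1 (c t) (vF t)) (at t)"
    by (rule chart, rule_tac chart_y0) assumption+
  then show "isCont y0 t" by (rule DERIV_isCont)
qed

text \<open>The support condition speaks of times outside \<open>{a..b}\<close>, where the variation
  field vanishes; at the two endpoints it vanishes as a one-sided limit from outside.\<close>

lemma F_s_zero:
  assumes t: "t \<in> {a, b}"
  shows "fderiv F (t, 0) (0, 1) = 0"
proof -
  have opO: "open (J \<times> {-\<epsilon><..<\<epsilon>})" by (intro open_Times open_J) simp
  have out: "fderiv F (t, 0) (0, 1) = 0" if "t \<in> J" "t \<notin> {a..b}" for t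
  proof -
    have "((\<lambda>s. F (t, s)) has_vector_derivative fderiv F (t, 0) (0, 1)) (at 0)"
      by (rule smooth_on_slice(2)[OF smooth_F]) (use that \<epsilon> in auto)
    moreover have "((\<lambda>s. F (t, s)) has_vector_derivative 0) (at 0)"
      by (rule has_vector_derivative_transform_within_open[OF has_vector_derivative_const, of "{-\<epsilon><..<\<epsilon>}"])
        (use that \<epsilon> F_outside in auto)
    ultimately show ?thesis using vector_derivative_unique_at by blast
  qed
  have tJ: "t \<in> J" using t ab by auto
  have "continuous_on J (\<lambda>t. fderiv F (t, 0) (0, 1))"
    by (rule continuous_on_compose2[OF smooth_on_continuous[OF smooth_on_fderiv_dir[OF smooth_F]]])
      (use \<epsilon> in \<open>auto intro!: continuous_intros\<close>)
  then have "isCont (\<lambda>t. fderiv F (t, 0) (0, 1)) t"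
    using open_J tJ continuous_on_eq_continuous_at by blast
  then have lim: "((\<lambda>t. fderiv F (t, 0) (0, 1)) \<longlongrightarrow> fderiv F (t, 0) (0, 1)) (at t)" by (simp add: isCont_def)
  show ?thesis
  proof (cases "t = a")
    case True
    have "\<forall>\<^sub>F r in at_left t. fderiv F (r, 0) (0, 1) = 0"
      unfolding eventually_at_topological by (intro exI[of _ J]) (use open_J tJ out True in auto)
    then have "((\<lambda>t. fderiv F (t, 0) (0, 1)) \<longlongrightarrow> 0) (at_left t)" by (rule tendsto_eventually)
    moreover have "((\<lambda>t. fderiv F (t, 0) (0, 1)) \<longlongrightarrow> fderiv F (t, 0) (0, 1)) (at_left t)"
      using lim tendsto_within_subset by blast
    ultimately show ?thesis using tendsto_unique trivial_limit_at_left_real by blast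
  next
    case False
    then have tb: "t = b" using t by simp
    have "\<forall>\<^sub>F r in at_right t. fderiv F (r, 0) (0, 1) = 0"
      unfolding eventually_at_topological by (intro exI[of _ J]) (use open_J tJ out tb in auto)
    then have "((\<lambda>t. fderiv F (t, 0) (0, 1)) \<longlongrightarrow> 0) (at_right t)" by (rule tendsto_eventually)
    moreover have "((\<lambda>t. fderiv F (t, 0) (0, 1)) \<longlongrightarrow> fderiv F (t, 0) (0, 1)) (at_right t)"
      using lim tendsto_within_subset by blast
    ultimately show ?thesis using tendsto_unique trivial_limit_at_right_real by blast
  qed
qed

lemma Z_boundary:
  assumes "t \<in> {a, b}"
  shows "Z t = 0"
proof -
  have cP: "c t \<in> P" using assms ab by (intro c_in_P) auto
  have "fderiv \<rho> (c t) (vF t) = fderiv \<rho> (c t) 0"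
    unfolding vF_def fderiv_lift[OF cP] F_s_zero[OF assms] linear_0[OF smooth_on_linear_fderiv[OF smooth_rho cP]] ..
  from lift_unique[OF cP this] show ?thesis by (simp add: Z_def y0_def blinfun.zero_right)
qed

text \<open>At \<open>s = 0\<close> the squared length is positive because \<open>speed\<close> is
  non-zero. Compactness of \<open>{a..b}\<close> merges the neighbourhoods of the single points into
  a strip, on which the square root may be differentiated.\<close>

lemma sqlen_nbhd:
  obtains d where "0 < d" "d \<le> \<epsilon>" "\<And>t s. t \<in> {a..b} \<Longrightarrow> s \<in> {-d<..<d} \<Longrightarrow> sqlen (t, s) > 0"
    "smooth_on ({a..b} \<times> {-d<..<d}) sqlen"
proof -
  have "\<exists>N. open N \<and> (t0, 0) \<in> N \<and> N \<subseteq> J \<times> {-\<epsilon><..<\<epsilon>} \<and> smooth_on N sqlen \<and> (\<forall>z\<in>N. sqlen z > 0)" if t0: "t0 \<in> J" for t0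
  proof -
    obtain N p where Np: "open N" "(t0, 0) \<in> N" "N \<subseteq> J \<times> {-\<epsilon><..<\<epsilon>}" "smooth_on N p"
      "\<And>z. z \<in> N \<Longrightarrow> p z \<in> P" "\<And>z. z \<in> N \<Longrightarrow> \<rho> (p z) = F z" "\<And>t. (t, 0) \<in> N \<Longrightarrow> p (t, 0) = c t"
      by (rule chart[OF t0]) blast
    have sm: "smooth_on N sqlen" by (rule chart_smooth_sqlen[OF Np(1,3-7)])
    have "sqlen (t0, 0) > 0"
      using chart_sqlen[OF Np(1,3-7) Np(2)] chart_base[OF Np(1,3-7) Np(2)] Np(7)[OF Np(2)] speed_nz[OF t0]
      by (simp add: quad_def speed_def add_pos_nonneg)
    then have "open (N \<inter> sqlen -` {0<..})" "(t0, 0) \<in> N \<inter> sqlen -` {0<..}"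
      using continuous_open_preimage[OF smooth_on_continuous[OF sm] Np(1), of "{0<..}"] Np(2) by auto
    then show ?thesis
      using Np(3) smooth_on_subset[OF sm, of "N \<inter> sqlen -` {0<..}"] by (intro exI[of _ "N \<inter> sqlen -` {0<..}"]) auto
  qed
  then obtain N where N: "\<And>t. t \<in> J \<Longrightarrow> open (N t)" "\<And>t. t \<in> J \<Longrightarrow> (t, 0) \<in> N t"
    "\<And>t. t \<in> J \<Longrightarrow> smooth_on (N t) sqlen" "\<And>t z. t \<in> J \<Longrightarrow> z \<in> N t \<Longrightarrow> sqlen z > 0" by metis
  let ?S = "{a..b} \<times> {0::real}"
  obtain d0 where d0: "d0 > 0" "(\<Union>z\<in>?S. ball z d0) \<subseteq> (\<Union>t\<in>J. N t)"
  proof (rule compact_subset_open_imp_ball_epsilon_subset[of ?S "\<Union>t\<in>J. N t"])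
    show "compact ?S" by (intro compact_Times) auto
    show "open (\<Union>t\<in>J. N t)" using N(1) by blast
    show "?S \<subseteq> (\<Union>t\<in>J. N t)" using N(2) ab(2) by blast
  qed blast
  define d where "d = min d0 \<epsilon>"
  have d: "0 < d" "d \<le> d0" "d \<le> \<epsilon>" using d0(1) \<epsilon> by (auto simp: d_def)
  have cov: "\<exists>t'\<in>J. (t, s) \<in> N t'" if "t \<in> {a..b}" "s \<in> {-d<..<d}" for t s
  proof -
    have "(t, s) \<in> ball (t, 0) d0" using that(2) d(2) by (simp add: dist_Pair_Pair dist_real_def abs_if)
    then have "(t, s) \<in> (\<Union>z\<in>?S. ball z d0)" using that(1) by blast
    then show ?thesis using d0(2) by blast
  qed
  show ?thesis
  proof (rule that[OF d(1,3)])
    show "sqlen (t, s) > 0" if "t \<in> {a..b}" "s \<in> {-d<..<d}" for t s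
      using cov[OF that] N(4) by blast
    show "smooth_on ({a..b} \<times> {-d<..<d}) sqlen"
    proof (rule smooth_on_local)
      fix z assume "z \<in> {a..b} \<times> {-d<..<d}"
      then obtain t' where "t' \<in> J" "z \<in> N t'" using cov[of "fst z" "snd z"] by auto
      then show "\<exists>U. open U \<and> z \<in> U \<and> smooth_on U sqlen" using N(1,3) by blast
    qed
  qed
qed

text \<open>Differentiation under the integral sign. At \<open>s = 0\<close> the root in the
  denominator is the absolute value of \<open>speed\<close>, as
  \<open>\<theta>\<^sub>1(c') = 0\<close>.\<close>

lemma arclength_derivative:
  "((\<lambda>s. arclength (descended_metric P \<rho> e) a b (\<lambda>t. F (t, s))) has_real_derivative
    integral {a..b} (\<lambda>t. fderiv sqlen (t, 0) (0, 1) / (2 * \<bar>speed t\<bar>))) (at 0)"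
proof -
  obtain d where d: "0 < d" "d \<le> \<epsilon>" "\<And>t s. t \<in> {a..b} \<Longrightarrow> s \<in> {-d<..<d} \<Longrightarrow> sqlen (t, s) > 0"
    "smooth_on ({a..b} \<times> {-d<..<d}) sqlen" by (rule sqlen_nbhd) blast
  let ?U = "{-d<..<d}"
  have cont: "continuous_on ({a..b} \<times> ?U) sqlen" "continuous_on ({a..b} \<times> ?U) (\<lambda>z. fderiv sqlen z (0, 1))"
    using smooth_on_continuous[OF d(4)] smooth_on_continuous[OF smooth_on_fderiv_dir[OF d(4)]] by blast+
  have sqrt_eq: "inverse (sqrt x) / 2 * y = y / (2 * sqrt x)" for x y
    by (simp add: inverse_eq_divide)
  have sw: "continuous_on (?U \<times> {a..b}) (\<lambda>z. h (snd z, fst z))" if "continuous_on ({a..b} \<times> ?U) h"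
    for h :: "real \<times> real \<Rightarrow> real"
    by (rule continuous_on_compose2[OF that]) (auto intro!: continuous_intros)
  have "((\<lambda>s. integral (cbox a b) (\<lambda>t. sqrt (sqlen (t, s)))) has_field_derivative
      integral (cbox a b) (\<lambda>t. fderiv sqlen (t, 0) (0, 1) / (2 * sqrt (sqlen (t, 0))))) (at 0 within ?U)"
  proof (rule leibniz_rule_field_derivative[where f="\<lambda>s t. sqrt (sqlen (t, s))"
        and fx="\<lambda>s t. fderiv sqlen (t, s) (0, 1) / (2 * sqrt (sqlen (t, s)))"])
    fix s t assume s: "s \<in> ?U" and t: "t \<in> cbox a b"
    have "((\<lambda>s. sqlen (t, s)) has_real_derivative fderiv sqlen (t, s) (0, 1)) (at s)"
      using smooth_on_slice(2)[OF d(4), of t s] s t by (simp add: has_real_derivative_iff_has_vector_derivative)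
    moreover have pos: "sqlen (t, s) > 0" using d(3)[of t s] s t by simp
    ultimately have "((\<lambda>s. sqrt (sqlen (t, s))) has_real_derivative
        inverse (sqrt (sqlen (t, s))) / 2 * fderiv sqlen (t, s) (0, 1)) (at s)"
      by (intro DERIV_chain2[OF DERIV_real_sqrt])
    then show "((\<lambda>s. sqrt (sqlen (t, s))) has_real_derivative fderiv sqlen (t, s) (0, 1) / (2 * sqrt (sqlen (t, s)))) (at s within ?U)"
      unfolding sqrt_eq by (rule has_field_derivative_at_within)
  next
    fix s assume s: "s \<in> ?U"
    have "continuous_on {a..b} (\<lambda>t. sqlen (t, s))"
      by (rule continuous_on_compose2[OF cont(1)]) (use s in \<open>auto intro!: continuous_intros\<close>)
    then show "(\<lambda>t. sqrt (sqlen (t, s))) integrable_on cbox a b"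
      by (intro integrable_continuous) (auto intro!: continuous_intros)
  next
    have "continuous_on (?U \<times> {a..b}) (\<lambda>z. fderiv sqlen (snd z, fst z) (0, 1) / (2 * sqrt (sqlen (snd z, fst z))))"
      using d(3) by (intro continuous_intros sw cont) force
    then show "continuous_on (?U \<times> cbox a b) (\<lambda>(s, t). fderiv sqlen (t, s) (0, 1) / (2 * sqrt (sqlen (t, s))))"
      by (simp add: split_beta')
  qed (use d in auto)
  then have "((\<lambda>s. integral {a..b} (\<lambda>t. sqrt (sqlen (t, s)))) has_real_derivative
      integral {a..b} (\<lambda>t. fderiv sqlen (t, 0) (0, 1) / (2 * sqrt (sqlen (t, 0))))) (at 0)"
    using d(1) at_within_open[of 0 ?U] by simp
  moreover have "sqrt (sqlen (t, 0)) = \<bar>speed t\<bar>" if t: "t \<in> {a..b}" for t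
  proof -
    have tJ: "t \<in> J" using t ab by auto
    obtain N p where Np: "open N" "(t, 0) \<in> N" "N \<subseteq> J \<times> {-\<epsilon><..<\<epsilon>}" "smooth_on N p"
      "\<And>z. z \<in> N \<Longrightarrow> p z \<in> P" "\<And>z. z \<in> N \<Longrightarrow> \<rho> (p z) = F z" "\<And>t. (t, 0) \<in> N \<Longrightarrow> p (t, 0) = c t"
      by (rule chart[OF tJ]) blast
    have "sqlen (t, 0) = (speed t)\<^sup>2"
      using chart_sqlen[OF Np(1,3-7) Np(2)] chart_base[OF Np(1,3-7) Np(2)] Np(7)[OF Np(2)] theta_c'[OF tJ, of 1]
      by (simp add: quad_def speed_def)
    then show ?thesis by simp
  qed
  then have "integral {a..b} (\<lambda>t. fderiv sqlen (t, 0) (0, 1) / (2 * sqrt (sqlen (t, 0))))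
      = integral {a..b} (\<lambda>t. fderiv sqlen (t, 0) (0, 1) / (2 * \<bar>speed t\<bar>))"
    by (intro integral_cong) simp
  ultimately have "((\<lambda>s. integral {a..b} (\<lambda>t. sqrt (sqlen (t, s)))) has_real_derivative
      integral {a..b} (\<lambda>t. fderiv sqlen (t, 0) (0, 1) / (2 * \<bar>speed t\<bar>))) (at 0)" by simp
  then show ?thesis
  proof (rule has_field_derivative_transform_within_open[of _ _ _ ?U])
    fix s assume s: "s \<in> ?U"
    show "integral {a..b} (\<lambda>t. sqrt (sqlen (t, s))) = arclength (descended_metric P \<rho> e) a b (\<lambda>t. F (t, s))"
      unfolding arclength_def
    proof (rule integral_cong)
      fix t assume t: "t \<in> {a..b}"
      have "vector_derivative (\<lambda>t. F (t, s)) (at t) = fderiv F (t, s) (1, 0)"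
        by (rule vector_derivative_at[OF smooth_on_slice(1)[OF smooth_F]]) (use t s d ab in auto)
      then show "sqrt (sqlen (t, s)) = sqrt (descended_metric P \<rho> e (F (t, s)) (vector_derivative (\<lambda>t. F (t, s)) (at t)))"
        by (simp add: sqlen_def)
    qed
  qed (use d in auto)
qed

text \<open>\<open>Z\<close> vanishes at both endpoints, so its derivative integrates to zero; this
  trades the derivative of the length for the integral of the \<open>y0\<close> term.\<close>

lemma first_variation:
  "((\<lambda>s. arclength (descended_metric P \<rho> e) a b (\<lambda>t. F (t, s))) has_real_derivative
    integral {a..b} (\<lambda>t. 2 * \<bar>speed t\<bar> * (g1 (c t) - 2 * w0 (c t)) * y0 t)) (at 0)"
proof -
  have csp: "continuous_on {a..b} speed" using continuous_speed ab(2) continuous_on_subset by blast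
  \<comment> \<open>The length involves \<open>abs (speed t)\<close>, the derivative of
    \<open>Z\<close> involves \<open>speed t\<close>. As \<open>speed\<close> has no zero on the
    connected interval, the two differ by one constant sign, here called
    \<open>\<sigma>\<close>.\<close>
  obtain \<sigma> where \<sigma>: "\<sigma> \<noteq> 0" "\<And>t. t \<in> {a..b} \<Longrightarrow> \<bar>speed t\<bar> = \<sigma> * speed t" "\<sigma> * \<sigma> = 1"
  proof -
    have "(\<forall>t\<in>{a..b}. speed t > 0) \<or> (\<forall>t\<in>{a..b}. speed t < 0)"
    proof (rule ccontr)
      assume "\<not> ?thesis"
      then obtain s t where st: "s \<in> {a..b}" "t \<in> {a..b}" "speed s < 0" "speed t > 0"
        using speed_nz ab(2) by (metis linorder_neqE_linordered_idom subsetD)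
      have "connected (speed ` {a..b})" by (intro connected_continuous_image csp) simp
      then have "0 \<in> speed ` {a..b}" using connectedD_interval[of "speed ` {a..b}" "speed s" "speed t" 0] st by auto
      then show False using speed_nz ab(2) by auto
    qed
    then show ?thesis
    proof
      assume "\<forall>t\<in>{a..b}. speed t > 0"
      then show ?thesis by (intro that[of 1]) (auto simp: less_imp_le)
    next
      assume "\<forall>t\<in>{a..b}. speed t < 0"
      then show ?thesis by (intro that[of "-1"]) (auto simp: less_imp_le)
    qed
  qed
  define h where "h t = 2 * \<bar>speed t\<bar> * (g1 (c t) - 2 * w0 (c t)) * y0 t" for t
  define K where "K t = fderiv sqlen (t, 0) (0, 1) / (2 * \<bar>speed t\<bar>)" for t
  have cc: "continuous_on {a..b} (\<lambda>t. g (c t))" if "smooth_on P g" for g :: "real^5 \<Rightarrow> real"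
    by (rule continuous_on_compose2[OF smooth_on_continuous[OF that] continuous_on_subset[OF smooth_on_continuous[OF smooth_c] ab(2)]])
      (use c_in_P ab(2) in auto)
  have "continuous_on {a..b} h" unfolding h_def
    by (intro continuous_intros csp cc smooth_g1 smooth_w0 continuous_on_subset[OF continuous_y0 ab(2)])
  then have hi: "(h has_integral integral {a..b} h) {a..b}"
    by (intro integrable_integral integrable_continuous_real)
  have "((\<lambda>t. fderiv sqlen (t, 0) (0, 1) / (2 * speed t)
    - 2 * speed t * (g1 (c t) - 2 * w0 (c t)) * y0 t) has_integral Z b - Z a) {a..b}"
  proof (rule fundamental_theorem_of_calculus)
    fix t assume "t \<in> {a..b}"
    then have "t \<in> J" using ab(2) by blast
    from has_field_derivative_at_within[OF Z_derivative[OF this]]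
    show "(Z has_vector_derivative fderiv sqlen (t, 0) (0, 1) / (2 * speed t)
        - 2 * speed t * (g1 (c t) - 2 * w0 (c t)) * y0 t) (at t within {a..b})"
      by (simp only: has_real_derivative_iff_has_vector_derivative)
  qed (use ab in simp)
  then have "((\<lambda>t. \<sigma> * (fderiv sqlen (t, 0) (0, 1) / (2 * speed t)
    - 2 * speed t * (g1 (c t) - 2 * w0 (c t)) * y0 t)) has_integral \<sigma> * 0) {a..b}"
    by (intro has_integral_mult_right) (simp add: Z_boundary)
  then have "((\<lambda>t. \<sigma> * (fderiv sqlen (t, 0) (0, 1) / (2 * speed t)
    - 2 * speed t * (g1 (c t) - 2 * w0 (c t)) * y0 t) + h t) has_integral \<sigma> * 0 + integral {a..b} h) {a..b}"
    by (rule has_integral_add[OF _ hi])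
  then have "(K has_integral \<sigma> * 0 + integral {a..b} h) {a..b}"
  proof (rule has_integral_eq[rotated])
    fix t assume t: "t \<in> {a..b}"
    have sp: "speed t \<noteq> 0" using speed_nz t ab(2) by blast
    have "K t = \<sigma> * (fderiv sqlen (t, 0) (0, 1) / (2 * speed t))"
    proof -
      have 1: "1 / \<sigma> = \<sigma>" using \<sigma>(1,3) by (simp add: field_simps)
      have "x / (2 * (\<sigma> * y)) = 1 / \<sigma> * (x / (2 * y))" for x y by simp
      then show ?thesis unfolding K_def \<sigma>(2)[OF t] 1 .
    qed
    then show "\<sigma> * (fderiv sqlen (t, 0) (0, 1) / (2 * speed t) - 2 * speed t * (g1 (c t) - 2 * w0 (c t)) * y0 t) + h t = K t"
      unfolding h_def \<sigma>(2)[OF t] by (simp add: algebra_simps)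
  qed
  then have "integral {a..b} K = integral {a..b} h" by (simp add: integral_unique)
  with arclength_derivative show ?thesis unfolding K_def h_def by simp
qed

end

section \<open>Geodesics\<close>

text \<open>Straightening of \<open>Y\<close> to the constant field \<open>Y x0\<close>, normalised
  to have the identity as derivative at the origin, so that velocities at \<open>x0\<close> look the
  same in the new coordinates.\<close>

lemma smooth_on_flow_box:
  fixes Y :: "'a::euclidean_space \<Rightarrow> 'a"
  assumes U: "open U" "smooth_on U Y" "x0 \<in> U" and nz: "Y x0 \<noteq> 0"
  obtains U' V \<Psi> h where "open U'" "0 \<in> U'" "smooth_on U' \<Psi>" "\<Psi> ` U' \<subseteq> U" "open V" "x0 \<in> V"
    "homeomorphism U' V \<Psi> h" "smooth_on V h" "\<Psi> 0 = x0" "\<And>v. fderiv \<Psi> 0 v = v"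
    "\<And>\<xi>. \<xi> \<in> U' \<Longrightarrow> fderiv \<Psi> \<xi> (Y x0) = Y (\<Psi> \<xi>)"
proof -
  obtain \<delta> R \<Phi> where flow: "\<delta> > 0" "R > 0" "smooth_on ({-\<delta><..<\<delta>} \<times> ball x0 R) \<Phi>"
    "\<And>t x. t \<in> {-\<delta><..<\<delta>} \<Longrightarrow> x \<in> ball x0 R \<Longrightarrow> \<Phi> (t, x) \<in> U"
    "\<And>x. x \<in> ball x0 R \<Longrightarrow> \<Phi> (0, x) = x"
    "\<And>t x. t \<in> {-\<delta><..<\<delta>} \<Longrightarrow> x \<in> ball x0 R \<Longrightarrow> ((\<lambda>t. \<Phi> (t, x)) has_vector_derivative Y (\<Phi> (t, x))) (at t)"
    by (rule smooth_local_flow[OF U]) blast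
  let ?B = "{-\<delta><..<\<delta>} \<times> ball x0 R"
  have opB: "open ?B" by (intro open_Times) auto
  define y where "y = Y x0"
  define l where "l v = (v \<bullet> y) / (y \<bullet> y)" for v
  have yy: "y \<bullet> y \<noteq> 0" using nz by (simp add: y_def)
  have ly: "l y = 1" using yy by (simp add: l_def)
  have bl: "bounded_linear l" unfolding l_def
    by (intro bounded_linear_divide[THEN bounded_linear_compose] bounded_linear_inner_left)
  have linl: "linear l" using bl bounded_linear.linear by blast
  \<comment> \<open>The \<open>y\<close>-component of \<open>\<xi>\<close> becomes the flow time,
    the rest a starting point on the hyperplane through \<open>x0\<close> orthogonal to
    \<open>y\<close>.\<close>
  define k where "k \<xi> = (l \<xi>, x0 + (\<xi> - l \<xi> *\<^sub>R y))" for \<xi>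
  have k: "smooth_on S k" if "open S" for S unfolding k_def
    by (intro smooth_on_Pair smooth_on_add smooth_on_diff smooth_on_scaleR smooth_on_const smooth_on_id
        smooth_on_linear[OF bl] that)
  define W where "W = k -` ?B"
  have W: "open W" unfolding W_def
    by (rule open_vimage[OF opB smooth_on_continuous[OF k[OF open_UNIV]]])
  have k0: "k 0 = (0, x0)" using linear_0[OF linl] by (simp add: k_def)
  have W0: "0 \<in> W" using flow(1,2) by (simp add: W_def k0)
  define \<Psi> where "\<Psi> \<xi> = \<Phi> (k \<xi>)" for \<xi>
  have \<Psi>: "smooth_on W \<Psi>" unfolding \<Psi>_def
    by (rule smooth_on_compose[OF W opB k[OF W] _ flow(3)]) (auto simp: W_def)
  have \<Psi>U: "\<Psi> \<xi> \<in> U" if "\<xi> \<in> W" for \<xi>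
    using that flow(4)[of "fst (k \<xi>)" "snd (k \<xi>)"] by (auto simp: W_def \<Psi>_def mem_Times_iff)
  have D\<Psi>: "fderiv \<Psi> \<xi> v = fderiv \<Phi> (k \<xi>) (l v, v - l v *\<^sub>R y)" if "\<xi> \<in> W" for \<xi> v
  proof -
    have "(k has_derivative (\<lambda>v. (l v, 0 + (v - l v *\<^sub>R y)))) (at \<xi>)" unfolding k_def
      by (intro has_derivative_Pair has_derivative_add has_derivative_diff has_derivative_scaleR_left has_derivative_const
          has_derivative_ident bounded_linear_imp_has_derivative[OF bl])
    from fderiv_compose[OF this smooth_on_has_derivative[OF flow(3)]] show ?thesis
      using that by (simp add: \<Psi>_def[abs_def] W_def)
  qed
  have flow_dir: "fderiv \<Psi> \<xi> y = Y (\<Psi> \<xi>)" if "\<xi> \<in> W" for \<xi>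
  proof -
    have kB: "(fst (k \<xi>), snd (k \<xi>)) \<in> ?B" using that by (simp add: W_def)
    have "fderiv \<Phi> (fst (k \<xi>), snd (k \<xi>)) (1, 0) = Y (\<Phi> (fst (k \<xi>), snd (k \<xi>)))"
    proof (rule vector_derivative_unique_at)
      show "((\<lambda>t. \<Phi> (t, snd (k \<xi>))) has_vector_derivative Y (\<Phi> (fst (k \<xi>), snd (k \<xi>)))) (at (fst (k \<xi>)))"
        using kB by (intro flow(6)) auto
      note hd = smooth_on_has_derivative[OF flow(3) kB]
      have "((\<lambda>t. (t, snd (k \<xi>))) has_derivative (\<lambda>r. (r, 0))) (at (fst (k \<xi>)))"
        by (intro has_derivative_Pair has_derivative_ident has_derivative_const)
      from has_derivative_compose[OF this hd]
      have 1: "((\<lambda>t. \<Phi> (t, snd (k \<xi>))) has_derivative (\<lambda>r. fderiv \<Phi> (fst (k \<xi>), snd (k \<xi>)) (r, 0))) (at (fst (k \<xi>)))" .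
      have 2: "(\<lambda>r. fderiv \<Phi> (fst (k \<xi>), snd (k \<xi>)) (r, 0)) = (\<lambda>r. r *\<^sub>R fderiv \<Phi> (fst (k \<xi>), snd (k \<xi>)) (1, 0))"
      proof
        fix r show "fderiv \<Phi> (fst (k \<xi>), snd (k \<xi>)) (r, 0) = r *\<^sub>R fderiv \<Phi> (fst (k \<xi>), snd (k \<xi>)) (1, 0)"
          using linear_scale[OF has_derivative_linear[OF hd], of r "(1, 0)"] by simp
      qed
      show "((\<lambda>t. \<Phi> (t, snd (k \<xi>))) has_vector_derivative fderiv \<Phi> (fst (k \<xi>), snd (k \<xi>)) (1, 0)) (at (fst (k \<xi>)))"
        using 1 unfolding 2 has_vector_derivative_def .
    qed
    then show ?thesis using D\<Psi>[OF that, of y] ly by (simp add: \<Psi>_def)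
  qed
  have id: "fderiv \<Psi> 0 v = v" for v
  proof -
    have z: "(0, x0) \<in> ?B" using flow(1,2) by simp
    note hd = smooth_on_has_derivative[OF flow(3) z]
    note lin = has_derivative_linear[OF hd]
    have 1: "fderiv \<Phi> (0, x0) (1, 0) = y"
      using flow_dir[OF W0] D\<Psi>[OF W0, of y] ly flow(2,5) by (simp add: k0 \<Psi>_def y_def)
    have "((\<lambda>x. (0, x)) has_derivative (\<lambda>v. (0, v))) (at x0)"
      by (intro has_derivative_Pair has_derivative_ident has_derivative_const)
    from has_derivative_compose[OF this hd]
    have "((\<lambda>x. \<Phi> (0, x)) has_derivative (\<lambda>v. fderiv \<Phi> (0, x0) (0, v))) (at x0)" .
    then have "((\<lambda>x. x) has_derivative (\<lambda>v. fderiv \<Phi> (0, x0) (0, v))) (at x0)"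
      by (rule has_derivative_transform_within_open[OF _ open_ball, of _ _ _ _ x0 R]) (use flow in auto)
    then have 2: "(\<lambda>v. fderiv \<Phi> (0, x0) (0, v)) = (\<lambda>v. v)"
      using has_derivative_unique has_derivative_ident by blast
    have "fderiv \<Psi> 0 v = fderiv \<Phi> (0, x0) (l v *\<^sub>R (1, 0) + (0, v - l v *\<^sub>R y))"
      using D\<Psi>[OF W0, of v] by (simp add: k0)
    also have "\<dots> = l v *\<^sub>R y + (v - l v *\<^sub>R y)"
      unfolding linear_add[OF lin] linear_scale[OF lin] 1 using fun_cong[OF 2, of "v - l v *\<^sub>R y"] by simp
    finally show ?thesis by simp
  qed
  have \<Psi>0: "\<Psi> 0 = x0" using flow(2,5) by (simp add: \<Psi>_def k0)
  have "inj (fderiv \<Psi> 0)" using id by (simp add: inj_on_def)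
  then obtain U' V g where g: "open U'" "U' \<subseteq> W" "0 \<in> U'" "open V" "\<Psi> 0 \<in> V" "homeomorphism U' V \<Psi> g" "smooth_on V g"
    using smooth_local_diffeo[OF W \<Psi> W0] by blast
  show ?thesis
  proof (rule that[OF g(1,3) smooth_on_subset[OF \<Psi> g(2)] _ g(4) _ g(6,7) \<Psi>0 id])
    show "\<Psi> ` U' \<subseteq> U" using \<Psi>U g(2) by blast
    show "x0 \<in> V" using g(5) \<Psi>0 by simp
    show "fderiv \<Psi> \<xi> (Y x0) = Y (\<Psi> \<xi>)" if "\<xi> \<in> U'" for \<xi>
      using flow_dir[of \<xi>] that g(2) by (auto simp: y_def)
  qed
qed

lemma smooth_bump_bounded:
  fixes a b :: real
  assumes "a < b"
  obtains \<psi> :: "real \<Rightarrow> real" and K where "smooth_on UNIV \<psi>" "\<And>t. 0 \<le> \<psi> t" "\<And>t. a < t \<Longrightarrow> t < b \<Longrightarrow> 0 < \<psi> t"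
    "\<And>t. t \<notin> {a..b} \<Longrightarrow> \<psi> t = 0 \<and> fderiv \<psi> t 1 = 0" "0 < K" "\<And>t. \<bar>\<psi> t\<bar> \<le> K \<and> \<bar>fderiv \<psi> t 1\<bar> \<le> K"
proof -
  obtain \<psi> :: "real \<Rightarrow> real" where \<psi>: "smooth_on UNIV \<psi>" "\<And>t. 0 \<le> \<psi> t" "\<And>t. a < t \<Longrightarrow> t < b \<Longrightarrow> 0 < \<psi> t"
    "\<And>t. t \<notin> {a<..<b} \<Longrightarrow> \<psi> t = 0"
    by (rule smooth_bump[of a b]) blast
  have out: "\<psi> t = 0 \<and> fderiv \<psi> t 1 = 0" if "t \<notin> {a..b}" for t
  proof -
    have "fderiv \<psi> t = fderiv (\<lambda>_. 0) t"
      by (rule frechet_derivative_cong_open[of "- {a..b}"]) (use that \<psi>(4) in auto)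
    moreover have "t \<notin> {a<..<b}" using that by auto
    ultimately show ?thesis using \<psi>(4) by simp
  qed
  have "bounded (h ` {a..b})" if "smooth_on UNIV h" for h :: "real \<Rightarrow> real"
    by (intro compact_imp_bounded compact_continuous_image continuous_on_subset[OF smooth_on_continuous[OF that]]) auto
  from this[OF \<psi>(1)] this[OF smooth_on_fderiv_dir[OF \<psi>(1), of 1]]
  obtain K1 K2 where K: "K1 > 0" "\<And>t. t \<in> {a..b} \<Longrightarrow> \<bar>\<psi> t\<bar> \<le> K1" "K2 > 0" "\<And>t. t \<in> {a..b} \<Longrightarrow> \<bar>fderiv \<psi> t 1\<bar> \<le> K2"
    unfolding bounded_pos by (metis imageI real_norm_def)
  have "\<bar>\<psi> t\<bar> \<le> max K1 K2 \<and> \<bar>fderiv \<psi> t 1\<bar> \<le> max K1 K2" for t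
    using out[of t] K(1,3) K(2)[of t] K(4)[of t] by (cases "t \<in> {a..b}") auto
  then show ?thesis using that[OF \<psi>(1-3) out, of "max K1 K2"] K(1) by auto
qed

section \<open>The two directions of the equivalence\<close>

context path_coframe
begin

lemma path_inD:
  assumes "path_in P L J c"
  shows "open J" "is_interval J" "smooth_on J c" "\<And>t. t \<in> J \<Longrightarrow> c t \<in> P"
    "\<And>t. t \<in> J \<Longrightarrow> fderiv c t 1 \<noteq> 0" "\<And>t. t \<in> J \<Longrightarrow> fderiv c t 1 \<in> L (c t)"
  using assms smooth_on_vector_derivative(2)[of J c] by (auto simp: path_in_def)

lemma path_projection:
  assumes path: "path_in P L J c"
  shows "smooth_on J (\<rho> \<circ> c)"
    "\<And>t. t \<in> J \<Longrightarrow> fderiv (\<rho> \<circ> c) t 1 = fderiv \<rho> (c t) (fderiv c t 1)"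
    "contact_curve M D J (\<rho> \<circ> c)"
    "\<And>t. t \<in> J \<Longrightarrow> vector_derivative (\<rho> \<circ> c) (at t) \<noteq> 0"
proof -
  note p = path_inD[OF path]
  show sm: "smooth_on J (\<rho> \<circ> c)" unfolding o_def
    by (rule smooth_on_compose[OF p(1) open_P p(3) _ smooth_rho]) (use p(4) in auto)
  show D: "fderiv (\<rho> \<circ> c) t 1 = fderiv \<rho> (c t) (fderiv c t 1)" if "t \<in> J" for t
    unfolding o_def by (rule fderiv_compose[OF smooth_on_has_derivative[OF p(3) that] smooth_on_has_derivative[OF smooth_rho p(4)[OF that]]])
  have V: "vector_derivative (\<rho> \<circ> c) (at t) = fderiv \<rho> (c t) (fderiv c t 1)" if "t \<in> J" for t
    using smooth_on_vector_derivative(2)[OF sm that] D[OF that] by simp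
  have "fderiv \<rho> (c t) (fderiv c t 1) \<in> D (\<rho> (c t))" if "t \<in> J" for t
    using contact_iff[OF p(4)[OF that]] theta_L[OF p(4)[OF that] p(6)[OF that], of 0] by simp
  then show "contact_curve M D J (\<rho> \<circ> c)"
    unfolding contact_curve_def using p(1,2) sm V rho_in_M[OF p(4)] by auto
  show "vector_derivative (\<rho> \<circ> c) (at t) \<noteq> 0" if "t \<in> J" for t
    using transverse[OF p(4)[OF that]] p(5,6)[OF that] V[OF that] by (auto simp: vertical_def)
qed

lemma path_geodesic:
  assumes g: "\<And>p. p \<in> P \<Longrightarrow> g1 p = 2 * w0 p" and path: "path_in P L J c"
  shows "sub_riemannian_geodesic M D (descended_metric P \<rho> e) J (\<rho> \<circ> c)"
  unfolding sub_riemannian_geodesic_def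
proof (intro conjI allI impI ballI)
  fix a b \<epsilon> F assume var: "contact_variation M D J (\<rho> \<circ> c) a b \<epsilon> F"
  interpret path_variation P M D \<rho> L e w0 w1 g1 t1 t3 \<gamma> J c a b \<epsilon> F
    by unfold_locales (rule path var)+
  have "integral {a..b} (\<lambda>t. 2 * \<bar>speed t\<bar> * (g1 (c t) - 2 * w0 (c t)) * y0 t) = integral {a..b} (\<lambda>t. 0)"
    by (rule integral_cong) (use g c_in_P ab(2) in auto)
  then show "((\<lambda>s. arclength (descended_metric P \<rho> e) a b (\<lambda>t. F (t, s))) has_real_derivative 0) (at 0)"
    using first_variation by simp
qed (use path_projection[OF path] in auto)

lemma path_through:
  assumes p0: "p0 \<in> P"
  obtains \<delta> c where "\<delta> > 0" "path_in P L {-\<delta><..<\<delta>} c" "c 0 = p0"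
proof -
  obtain U X where X: "open U" "p0 \<in> U" "U \<subseteq> P" "smooth_on U X" "\<And>q. q \<in> U \<Longrightarrow> X q \<noteq> 0 \<and> L q = span {X q}"
    using line_field p0 unfolding line_field_def by metis
  obtain \<delta> R \<Phi> where flow: "\<delta> > 0" "R > 0" "smooth_on ({-\<delta><..<\<delta>} \<times> ball p0 R) \<Phi>"
    "\<And>t x. t \<in> {-\<delta><..<\<delta>} \<Longrightarrow> x \<in> ball p0 R \<Longrightarrow> \<Phi> (t, x) \<in> U"
    "\<And>x. x \<in> ball p0 R \<Longrightarrow> \<Phi> (0, x) = x"
    "\<And>t x. t \<in> {-\<delta><..<\<delta>} \<Longrightarrow> x \<in> ball p0 R \<Longrightarrow> ((\<lambda>t. \<Phi> (t, x)) has_vector_derivative X (\<Phi> (t, x))) (at t)"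
    by (rule smooth_local_flow[OF X(1,4,2)]) blast
  define c where "c t = \<Phi> (t, p0)" for t
  have p0R: "p0 \<in> ball p0 R" using flow(2) by simp
  have sm: "smooth_on {-\<delta><..<\<delta>} c" unfolding c_def
    by (rule smooth_on_compose[OF _ _ smooth_on_Pair[OF _ smooth_on_id smooth_on_const] _ flow(3)])
      (use p0R in \<open>auto intro!: open_Times\<close>)
  have "vector_derivative c (at t) = X (c t)" if "t \<in> {-\<delta><..<\<delta>}" for t
    unfolding c_def using vector_derivative_at[OF flow(6)[OF that p0R]] by simp
  moreover have "c t \<in> U" if "t \<in> {-\<delta><..<\<delta>}" for t unfolding c_def by (rule flow(4)[OF that p0R])
  ultimately have "path_in P L {-\<delta><..<\<delta>} c"
    unfolding path_in_def using sm X(3,5) by (auto simp: is_interval_oo span_base)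
  then show ?thesis using that[OF flow(1)] flow(5)[OF p0R] by (simp add: c_def)
qed

text \<open>
  After straightening a Legendrian vector field \<open>Y\<close> transverse to the projected path, a curve is
  contact iff it solves an equation that involves the coordinate along \<open>Y\<close> but not its
  derivative. So the other two coordinates can be varied at will, here by a bump in a direction
  transverse to the contact plane.
\<close>

lemma positive_contact_variation:
  assumes \<delta>: "\<delta> > 0" and path: "path_in P L {-\<delta><..<\<delta>} c"
  obtains \<delta>0 \<epsilon> F where "0 < \<delta>0" "\<delta>0 \<le> \<delta>"
    "contact_variation M D {-\<delta>0<..<\<delta>0} (\<rho> \<circ> c) (- \<delta>0 / 2) (\<delta>0 / 2) \<epsilon> F"
    "\<And>t. t \<in> {-\<delta>0<..<\<delta>0} \<Longrightarrow> 0 \<le> th 0 (c t) (lift (c t) (fderiv F (t, 0) (0, 1)))"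
    "0 < th 0 (c 0) (lift (c 0) (fderiv F (0, 0) (0, 1)))"
proof -
  let ?I = "{-\<delta><..<\<delta>}"
  note p = path_inD[OF path] and pr = path_projection[OF path]
  have I0: "0 \<in> ?I" using \<delta> by simp
  define x0 where "x0 = \<rho> (c 0)"
  note p0 = p(4)[OF I0]
  obtain U and \<eta> :: "real^3 \<Rightarrow> (real^3) covector"
    where U: "open U" "\<rho> (c 0) \<in> U" "U \<subseteq> M" "smooth_on U \<eta>" "\<And>y. y \<in> U \<Longrightarrow> D y = {w. blinfun_apply (\<eta> y) w = 0}"
    by (rule contact_form_near[OF p0]) blast
  have x0U: "x0 \<in> U" using U(2) by (simp add: x0_def)
  obtain z1 where z1: "sg (c 0) z1 = 0" "th 0 (c 0) z1 = 0" "th 1 (c 0) z1 = 1" using dual_vector[OF p0] by blast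
  obtain n' where n': "th 0 (c 0) n' = 1" using dual_vector[OF p0] by blast
  define X0 where "X0 = fderiv c 0 1"
  have X0: "th 0 (c 0) X0 = 0" "th 1 (c 0) X0 = 0" "sg (c 0) X0 \<noteq> 0"
  proof -
    have X0L: "X0 \<in> L (c 0)" "X0 \<noteq> 0" using p(5,6)[OF I0] by (simp_all add: X0_def)
    then show "th 0 (c 0) X0 = 0" "th 1 (c 0) X0 = 0" using theta_L[OF p0, of X0] by auto
    then show "sg (c 0) X0 \<noteq> 0"
      using coframe_zero[OF p0, of X0] theta_L[OF p0 X0L(1), of 2] theta_L[OF p0 X0L(1), of 3] X0L(2) by auto
  qed
  define n where "n = fderiv \<rho> (c 0) n'"
  define d0 where "d0 = fderiv \<rho> (c 0) X0"
  define Y0 where "Y0 = fderiv \<rho> (c 0) z1"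
  define n0 where "n0 = blinfun_apply (\<eta> x0) n"
  note iff0 = theta0_zero_iff[OF p0 U(5)[OF U(2)]]
  have \<eta>0: "blinfun_apply (\<eta> x0) Y0 = 0" "blinfun_apply (\<eta> x0) d0 = 0" "n0 \<noteq> 0"
    using iff0 z1 X0 n' by (auto simp: x0_def Y0_def d0_def n0_def n_def)
  \<comment> \<open>\<open>d\<theta>\<^sub>0(z1, X0) = - \<sigma>(X0)\<close> is non-zero, and
    \<open>d_theta0_d_eta\<close> carries this over to \<open>\<eta>\<close>. It will make the
    contact equation solvable for the coordinate along \<open>Y\<close>.\<close>
  have d\<eta>: "blinfun_apply (blinfun_apply (ext_d \<eta> x0) Y0) d0 \<noteq> 0"
  proof -
    have "blinfun_apply (blinfun_apply (ext_d (theta e 0) (c 0)) z1) X0 * n0 = blinfun_apply (blinfun_apply (ext_d \<eta> x0) Y0) d0"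
      using d_theta0_d_eta[OF p0 U(1,2,4,5) z1(2) X0(1), of n'] n' by (simp add: n0_def n_def x0_def Y0_def d0_def)
    then show ?thesis using z1 X0 \<eta>0(3) by (auto simp: d_theta0_apply[OF p0])
  qed
  \<comment> \<open>A combination of two fixed vectors that lies in the kernel of
    \<open>\<eta>\<close> at every point; at \<open>x0\<close> it is the multiple
    \<open>n0 *\<^sub>R Y0\<close>, since \<open>Y0\<close> is Legendrian there.\<close>
  define Y where "Y x = blinfun_apply (\<eta> x) n *\<^sub>R Y0 - blinfun_apply (\<eta> x) Y0 *\<^sub>R n" for x
  have Y: "smooth_on U Y" unfolding Y_def
    by (intro smooth_on_diff smooth_on_scaleR smooth_on_blinfun_apply U smooth_on_const)
  have \<eta>Y: "blinfun_apply (\<eta> x) (Y x) = 0" for x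
    by (simp add: Y_def blinfun.diff_right blinfun.scaleR_right)
  define Y1 where "Y1 = Y x0"
  have Y1: "Y1 = n0 *\<^sub>R Y0" using \<eta>0 by (simp add: Y1_def Y_def n0_def)
  have d\<eta>1: "blinfun_apply (blinfun_apply (ext_d \<eta> x0) Y1) d0 \<noteq> 0"
    using d\<eta> \<eta>0(3) by (simp add: Y1 blinfun.scaleR_right blinfun.scaleR_left)
  then have Y1nz: "Y x0 \<noteq> 0" by (auto simp: Y1_def[symmetric] blinfun.zero_right)
  obtain U' V \<Psi> h where fb: "open U'" "0 \<in> U'" "smooth_on U' \<Psi>" "\<Psi> ` U' \<subseteq> U" "open V" "x0 \<in> V"
    "homeomorphism U' V \<Psi> h" "smooth_on V h" "\<Psi> 0 = x0" "\<And>v. fderiv \<Psi> 0 v = v"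
    "\<And>\<xi>. \<xi> \<in> U' \<Longrightarrow> fderiv \<Psi> \<xi> Y1 = Y (\<Psi> \<xi>)"
    unfolding Y1_def by (rule smooth_on_flow_box[OF U(1) Y x0U Y1nz]) blast
  \<comment> \<open>The contact form in the straightened coordinates. The constant vector
    \<open>Y1\<close> is in its kernel at every point of \<open>U'\<close>.\<close>
  define \<omega> where "\<omega> \<xi> w = blinfun_apply (\<eta> (\<Psi> \<xi>)) (fderiv \<Psi> \<xi> w)" for \<xi> w
  have lin\<omega>: "\<omega> \<xi> (v + w) = \<omega> \<xi> v + \<omega> \<xi> w" "\<omega> \<xi> (r *\<^sub>R v) = r * \<omega> \<xi> v" if "\<xi> \<in> U'" for \<xi> v w r
    using smooth_on_linear_fderiv[OF fb(3) that]
    by (simp_all add: \<omega>_def linear_add linear_scale blinfun.add_right blinfun.scaleR_right)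
  have \<omega>Y: "\<omega> \<xi> Y1 = 0" if "\<xi> \<in> U'" for \<xi>
    using fb(11)[OF that] \<eta>Y by (simp add: \<omega>_def)
  have \<omega>0: "\<omega> 0 w = blinfun_apply (\<eta> x0) w" for w by (simp add: \<omega>_def fb)
  have \<omega>_smooth: "smooth_on S (\<lambda>z. \<omega> (f z) (g z))"
    if "open S" "smooth_on S f" "f ` S \<subseteq> U'" "smooth_on S g" for S :: "'z::euclidean_space set" and f g
  proof -
    have s1: "smooth_on S (\<lambda>z. \<Psi> (f z))" by (rule smooth_on_compose[OF that(1) fb(1) that(2,3) fb(3)])
    have "smooth_on S (\<lambda>z. \<eta> (\<Psi> (f z)))"
      by (rule smooth_on_compose[OF that(1) U(1) s1 _ U(4)]) (use that(3) fb(4) in auto)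
    then show ?thesis unfolding \<omega>_def
      by (intro smooth_on_blinfun_apply that(1) smooth_on_fderiv[OF that(1) fb(1,3) that(2,3,4)])
  qed
  define Jh where "Jh = ?I \<inter> (\<rho> \<circ> c) -` V"
  have Jh: "open Jh" unfolding Jh_def
    by (rule continuous_open_preimage[OF smooth_on_continuous[OF pr(1)] _ fb(5)]) simp
  have Jh0: "0 \<in> Jh" using I0 fb(6) by (simp add: Jh_def x0_def)
  define \<xi>0 where "\<xi>0 t = h ((\<rho> \<circ> c) t)" for t
  have \<xi>0: "smooth_on Jh \<xi>0" unfolding \<xi>0_def
    by (rule smooth_on_compose[OF Jh fb(5) smooth_on_subset[OF pr(1)] _ fb(8)]) (auto simp: Jh_def)
  have \<Psi>\<xi>0: "\<xi>0 t \<in> U'" "\<Psi> (\<xi>0 t) = \<rho> (c t)" if "t \<in> Jh" for t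
    using that fb(7) by (auto simp: Jh_def \<xi>0_def homeomorphism_def)
  have \<xi>00: "\<xi>0 0 = 0"
    using homeomorphism_apply1[OF fb(7,2)] fb(9) by (simp add: \<xi>0_def x0_def)
  have D\<Psi>\<xi>0: "fderiv \<Psi> (\<xi>0 t) (fderiv \<xi>0 t 1) = fderiv \<rho> (c t) (fderiv c t 1)" if "t \<in> Jh" for t
  proof -
    have "fderiv (\<lambda>t. \<Psi> (\<xi>0 t)) t 1 = fderiv \<Psi> (\<xi>0 t) (fderiv \<xi>0 t 1)"
      by (rule fderiv_compose[OF smooth_on_has_derivative[OF \<xi>0 that] smooth_on_has_derivative[OF fb(3) \<Psi>\<xi>0(1)[OF that]]])
    moreover have "fderiv (\<lambda>t. \<Psi> (\<xi>0 t)) t = fderiv (\<rho> \<circ> c) t"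
      by (rule frechet_derivative_cong_open[OF Jh that]) (simp add: \<Psi>\<xi>0)
    ultimately show ?thesis using pr(2)[of t] that by (simp add: Jh_def)
  qed
  have \<xi>0': "fderiv \<xi>0 0 1 = d0" using D\<Psi>\<xi>0[OF Jh0] by (simp add: \<xi>00 fb d0_def X0_def)
  have in_U: "\<rho> (c t) \<in> U" if "t \<in> Jh" for t using \<Psi>\<xi>0[OF that] fb(4) by force
  have \<omega>\<xi>0: "\<omega> (\<xi>0 t) (fderiv \<xi>0 t 1) = 0" if t: "t \<in> Jh" for t
  proof -
    have tI: "t \<in> ?I" using t by (simp add: Jh_def)
    show ?thesis unfolding \<omega>_def D\<Psi>\<xi>0[OF t] \<Psi>\<xi>0(2)[OF t]
      using theta0_zero_iff[OF p(4)[OF tI] U(5)[OF in_U[OF t]]] theta_L[OF p(4)[OF tI] p(6)[OF tI], of 0] by simp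
  qed
  \<comment> \<open>A curve \<open>\<zeta> + \<mu> Y1\<close> has velocity
    \<open>\<zeta>' + \<mu>' Y1\<close>, and \<open>\<omega>\<close> annihilates \<open>Y1\<close>.
    So the curve is contact iff \<open>Q (\<mu>, \<zeta>, \<zeta>') = 0\<close>, with no
    \<open>\<mu>'\<close>.\<close>
  define Q where "Q z = \<omega> (fst (snd z) + fst z *\<^sub>R Y1) (snd (snd z))" for z :: "real \<times> (real^3) \<times> (real^3)"
  define m where "m z = fst (snd z) + fst z *\<^sub>R Y1" for z :: "real \<times> (real^3) \<times> (real^3)"
  define S where "S = m -` U'"
  have m: "smooth_on A m" if "open A" for A unfolding m_def
    by (intro smooth_on_add smooth_on_scaleR smooth_on_const that smooth_on_linear bounded_linear_intros)
  have S: "open S" unfolding S_def by (rule open_vimage[OF fb(1) smooth_on_continuous[OF m[OF open_UNIV]]])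
  have Q: "smooth_on S Q" unfolding Q_def m_def[symmetric]
    by (rule \<omega>_smooth[OF S m[OF S]]) (auto simp: S_def intro!: smooth_on_linear bounded_linear_intros)
  define zb where "zb = (0 :: real, 0 :: real^3, d0)"
  have zbS: "zb \<in> S" using fb(2) by (simp add: S_def m_def zb_def)
  have Qzb: "Q zb = 0" using \<eta>0(2) by (simp add: Q_def zb_def \<omega>0)
  define \<kappa> where "\<kappa> = fderiv Q zb (1, 0, 0)"
  \<comment> \<open>As \<open>\<omega>\<close> annihilates the constant field \<open>Y1\<close>, the
    value of its exterior derivative on \<open>Y1\<close> and \<open>d0\<close> reduces to the
    derivative of \<open>\<omega> \<xi> d0\<close> along \<open>Y1\<close>, which is
    \<open>\<kappa>\<close>; it equals \<open>d\<eta>(Y1, d0)\<close> at \<open>x0\<close>.\<close>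
  have \<kappa>: "\<kappa> \<noteq> 0"
  proof -
    have "fderiv (\<lambda>\<xi>. \<omega> \<xi> d0) 0 Y1 - fderiv (\<lambda>\<xi>. \<omega> \<xi> Y1) 0 d0 = blinfun_apply (blinfun_apply (ext_d \<eta> x0) Y1) d0"
      using ext_d_pullback[OF fb(1,3,2) smooth_on_has_derivative[OF U(4)], of d0 Y1] fb(9,10) x0U
      by (simp add: \<omega>_def[abs_def])
    moreover have "fderiv (\<lambda>\<xi>. \<omega> \<xi> Y1) 0 = fderiv (\<lambda>\<xi>. 0) 0"
      by (rule frechet_derivative_cong_open[OF fb(1,2) \<omega>Y])
    ultimately have 1: "fderiv (\<lambda>\<xi>. \<omega> \<xi> d0) 0 Y1 \<noteq> 0" using d\<eta>1 by simp
    have \<omega>d0: "smooth_on U' (\<lambda>\<xi>. \<omega> \<xi> d0)"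
      by (rule \<omega>_smooth[OF fb(1) smooth_on_id]) auto
    have l1: "((\<lambda>r. r *\<^sub>R Y1) has_derivative (\<lambda>r. r *\<^sub>R Y1)) (at 0)" by (auto intro!: derivative_eq_intros)
    have "((\<lambda>\<xi>. \<omega> \<xi> d0) has_derivative fderiv (\<lambda>\<xi>. \<omega> \<xi> d0) 0) (at (0 *\<^sub>R Y1))"
      using smooth_on_has_derivative[OF \<omega>d0 fb(2)] by simp
    from fderiv_compose[OF l1 this, of 1]
    have 2: "fderiv (\<lambda>r. \<omega> (r *\<^sub>R Y1) d0) 0 1 = fderiv (\<lambda>\<xi>. \<omega> \<xi> d0) 0 Y1" by simp
    have l2: "((\<lambda>r. (r, 0 :: real^3, d0)) has_derivative (\<lambda>r. (r, 0, 0))) (at 0)"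
      by (intro has_derivative_Pair has_derivative_ident has_derivative_const)
    have "(Q has_derivative fderiv Q zb) (at (0, 0, d0))"
      using smooth_on_has_derivative[OF Q zbS] by (simp add: zb_def)
    from fderiv_compose[OF l2 this, of 1]
    have "fderiv (\<lambda>r. \<omega> (r *\<^sub>R Y1) d0) 0 1 = \<kappa>" by (simp add: \<kappa>_def Q_def)
    with 1 2 show ?thesis by simp
  qed
  \<comment> \<open>A right inverse of the derivative of \<open>Q\<close> that moves the first
    coordinate only, so that solving \<open>Q = 0\<close> leaves \<open>\<zeta>\<close> and
    \<open>w\<close> untouched.\<close>
  define A where "A r = (r / \<kappa>, 0 :: real^3, 0 :: real^3)" for r :: real
  have A: "linear A" unfolding A_def by (intro linearI) (auto simp: add_divide_distrib)
  have QA: "fderiv Q zb (A r) = r" for r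
  proof -
    have "A r = (r / \<kappa>) *\<^sub>R (1, 0, 0)" by (simp add: A_def)
    then show ?thesis using linear_scale[OF smooth_on_linear_fderiv[OF Q zbS], of "r / \<kappa>" "(1, 0, 0)"] \<kappa>
      by (simp add: \<kappa>_def)
  qed
  obtain N \<Lambda> where \<Lambda>: "open N" "(Q zb, zb) \<in> N" "smooth_on N \<Lambda>" "\<Lambda> ` N \<subseteq> S"
    "\<And>x q. (x, q) \<in> N \<Longrightarrow> Q (\<Lambda> (x, q)) = x"
    "\<And>x q. (x, q) \<in> N \<Longrightarrow> \<Lambda> (x, q) - q \<in> range A"
    "\<And>x q. (x, q) \<in> N \<Longrightarrow> Q q = x \<Longrightarrow> \<Lambda> (x, q) = q"
    by (rule smooth_submersion_lift[OF S Q zbS A QA]) blast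
  \<comment> \<open>Target value \<open>0\<close> of \<open>Q\<close>, initial guess
    \<open>\<mu> = 0\<close>, then the data \<open>\<zeta>\<close> and \<open>w\<close>.\<close>
  define emb where "emb z = (0 :: real, 0 :: real, z)" for z :: "(real^3) \<times> (real^3)"
  have emb: "smooth_on B emb" if "open B" for B unfolding emb_def
    by (intro smooth_on_Pair smooth_on_const smooth_on_id that)
  have "open (emb -` N)" by (rule open_vimage[OF \<Lambda>(1) smooth_on_continuous[OF emb[OF open_UNIV]]])
  moreover have "(0, d0) \<in> emb -` N" using \<Lambda>(2) unfolding Qzb by (simp add: emb_def zb_def)
  ultimately obtain r where r: "r > 0" "\<And>x y. dist 0 x < r \<Longrightarrow> dist d0 y < r \<Longrightarrow> (x, y) \<in> emb -` N"
    using smooth_pair_nbhd by blast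
  \<comment> \<open>The third claim matters for the support: if the data already satisfy the
    equation with \<open>\<mu> = 0\<close>, this is the solution selected.\<close>
  have sol: "fst (\<Lambda> (emb (\<zeta>, w))) *\<^sub>R Y1 + \<zeta> \<in> U'" "\<omega> (\<zeta> + fst (\<Lambda> (emb (\<zeta>, w))) *\<^sub>R Y1) w = 0"
    "\<zeta> \<in> U' \<Longrightarrow> \<omega> \<zeta> w = 0 \<Longrightarrow> fst (\<Lambda> (emb (\<zeta>, w))) = 0"
    if "emb (\<zeta>, w) \<in> N" for \<zeta> w
  proof -
    have N': "(0, 0, \<zeta>, w) \<in> N" using that by (simp add: emb_def)
    obtain s where "\<Lambda> (0, 0, \<zeta>, w) - (0, \<zeta>, w) = A s" using \<Lambda>(6)[OF N'] by blast
    then have "\<Lambda> (0, 0, \<zeta>, w) = (0, \<zeta>, w) + A s" by (simp add: algebra_simps)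
    then have L: "snd (\<Lambda> (0, 0, \<zeta>, w)) = (\<zeta>, w)" by (simp add: A_def)
    have "\<Lambda> (0, 0, \<zeta>, w) \<in> S" using \<Lambda>(4) N' by blast
    then show "fst (\<Lambda> (emb (\<zeta>, w))) *\<^sub>R Y1 + \<zeta> \<in> U'" using L by (simp add: S_def m_def emb_def add.commute)
    show "\<omega> (\<zeta> + fst (\<Lambda> (emb (\<zeta>, w))) *\<^sub>R Y1) w = 0"
      using \<Lambda>(5)[OF N'] L by (simp add: Q_def emb_def)
    show "fst (\<Lambda> (emb (\<zeta>, w))) = 0" if "\<zeta> \<in> U'" "\<omega> \<zeta> w = 0"
      using \<Lambda>(7)[OF N'] that by (simp add: Q_def emb_def)
  qed
  \<comment> \<open>The factors that convert \<open>\<eta>\<close> of the variation field into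
    \<open>\<theta>\<^sub>0(V)\<close>: the result will be \<open>\<psi> * fB * fC / fA\<close>. At
    \<open>0\<close> their values are \<open>n0\<close>, \<open>1\<close>, \<open>n0\<close>, so the
    sign is right on a short interval, whatever the sign of \<open>n0\<close>.\<close>
  define fA where "fA t = blinfun_apply (\<eta> (\<rho> (c t))) (fderiv \<rho> (c t) n')" for t
  define fB where "fB t = th 0 (c t) n'" for t
  define fC where "fC t = \<omega> (\<xi>0 t) n" for t
  have cJh: "smooth_on Jh c" using smooth_on_subset[OF p(3)] by (auto simp: Jh_def)
  have cP: "c ` Jh \<subseteq> P" using p(4) by (auto simp: Jh_def)
  have smA: "smooth_on Jh fA" unfolding fA_def
  proof (intro smooth_on_blinfun_apply Jh smooth_on_fderiv[OF Jh open_P smooth_rho cJh cP smooth_on_const])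
    show "smooth_on Jh (\<lambda>t. \<eta> (\<rho> (c t)))"
      by (rule smooth_on_compose[OF Jh U(1) smooth_on_compose[OF Jh open_P cJh cP smooth_rho] _ U(4)])
        (use in_U in auto)
  qed
  have smB: "smooth_on Jh fB" unfolding fB_def
    by (intro smooth_on_blinfun_apply Jh smooth_on_compose[OF Jh open_P cJh cP smooth_theta0] smooth_on_const)
  have smC: "smooth_on Jh fC" unfolding fC_def
    by (rule \<omega>_smooth[OF Jh \<xi>0]) (use \<Psi>\<xi>0(1) in auto)
  have cont0: "isCont g 0" if "smooth_on Jh g" for g :: "real \<Rightarrow> 'z::real_normed_vector"
    using smooth_on_continuous[OF that] Jh Jh0 continuous_on_eq_continuous_at by blast
  have ABC0: "fA 0 = n0" "fB 0 = 1" "fC 0 = n0"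
    using n' by (simp_all add: fA_def fB_def fC_def n0_def n_def x0_def \<xi>00 \<omega>0)
  have n0sq: "n0 * n0 > 0" using \<eta>0(3) by (metis not_real_square_gt_zero)
  have nhds0: "(g \<longlongrightarrow> g 0) (nhds 0)" if "isCont g 0" for g :: "real \<Rightarrow> real"
    using that by (simp add: isCont_def tendsto_at_iff_tendsto_nhds)
  have evs: "\<forall>\<^sub>F t in nhds 0. g t < r / 2" if "isCont g 0" "g 0 = 0" for g :: "real \<Rightarrow> real"
    using that(2) r(1) by (intro order_tendstoD(2)[OF nhds0[OF that(1)]]) simp
  have evp: "\<forall>\<^sub>F t in nhds 0. g t > 0" if "isCont g 0" "g 0 > 0" for g :: "real \<Rightarrow> real"
    by (rule order_tendstoD(1)[OF nhds0[OF that(1)] that(2)])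
  have "\<forall>\<^sub>F t in nhds 0. t \<in> Jh \<and> norm (\<xi>0 t) < r / 2 \<and> norm (fderiv \<xi>0 t 1 - d0) < r / 2 \<and>
      fA t * n0 > 0 \<and> fB t > 0 \<and> fC t * n0 > 0"
    by (intro eventually_conj eventually_nhds_in_open Jh Jh0 evs evp continuous_intros cont0 \<xi>0 smA smB smC
        smooth_on_fderiv_dir) (use \<xi>00 \<xi>0' ABC0 n0sq in auto)
  then obtain \<delta>0 where \<delta>0: "\<delta>0 > 0" "\<And>t. t \<in> {-\<delta>0<..<\<delta>0} \<Longrightarrow> t \<in> Jh \<and> norm (\<xi>0 t) < r / 2 \<and>
      norm (fderiv \<xi>0 t 1 - d0) < r / 2 \<and> fA t * n0 > 0 \<and> fB t > 0 \<and> fC t * n0 > 0"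
    unfolding eventually_nhds_metric by (auto simp: dist_real_def abs_less_iff)
  let ?J = "{-\<delta>0<..<\<delta>0}"
  have J: "t \<in> Jh" if "t \<in> ?J" for t using \<delta>0(2)[OF that] by blast
  have \<delta>0\<delta>: "\<delta>0 \<le> \<delta>"
  proof (rule ccontr)
    assume "\<not> \<delta>0 \<le> \<delta>"
    then have "\<delta> \<in> ?J" using \<delta> by auto
    then show False using J by (auto simp: Jh_def)
  qed
  have half: "- \<delta>0 / 2 < \<delta>0 / 2" using \<delta>0(1) by simp
  obtain \<psi> :: "real \<Rightarrow> real" and K where \<psi>: "smooth_on UNIV \<psi>" "\<And>t. 0 \<le> \<psi> t" "\<And>t. - \<delta>0 / 2 < t \<Longrightarrow> t < \<delta>0 / 2 \<Longrightarrow> 0 < \<psi> t"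
    "\<And>t. t \<notin> {- \<delta>0 / 2..\<delta>0 / 2} \<Longrightarrow> \<psi> t = 0 \<and> fderiv \<psi> t 1 = 0" "0 < K" "\<And>t. \<bar>\<psi> t\<bar> \<le> K \<and> \<bar>fderiv \<psi> t 1\<bar> \<le> K"
    by (rule smooth_bump_bounded[OF half]) blast
  \<comment> \<open>\<open>B\<close> bounds both \<open>\<psi> n\<close> and
    \<open>\<psi>' n\<close>. For \<open>abs s < \<epsilon>\<close> position and velocity change by
    less than \<open>r / 2\<close>, and the choice of \<open>\<delta>0\<close> leaves another
    \<open>r / 2\<close> before the domain of the solution is left.\<close>
  define B where "B = K * (norm n + 1)"
  define \<epsilon> where "\<epsilon> = r / (2 * B)"
  have B: "B > 0" using \<psi>(5) by (simp add: B_def add_nonneg_pos)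
  have \<epsilon>: "\<epsilon> > 0" using r(1) B by (simp add: \<epsilon>_def)
  let ?O = "?J \<times> {-\<epsilon><..<\<epsilon>}"
  have O: "open ?O" by (intro open_Times) auto
  \<comment> \<open>The freely prescribed part of the variation, displaced in the direction
    \<open>n\<close> transverse to the contact plane; \<open>W\<close> below is its derivative in
    \<open>t\<close>.\<close>
  define \<zeta> where "\<zeta> z = \<xi>0 (fst z) + (snd z * \<psi> (fst z)) *\<^sub>R n" for z :: "real \<times> real"
  define W where "W z = fderiv \<xi>0 (fst z) 1 + (snd z * fderiv \<psi> (fst z) 1) *\<^sub>R n" for z :: "real \<times> real"
  have fstO: "smooth_on ?O (\<lambda>z. g (fst z))" if "smooth_on Jh g" for g :: "real \<Rightarrow> 'z::real_normed_vector"
    by (rule smooth_on_compose[OF O Jh smooth_on_linear[OF bounded_linear_fst] _ that]) (use J in auto)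
  have \<psi>Jh: "smooth_on Jh \<psi>" "smooth_on Jh (\<lambda>t. fderiv \<psi> t 1)"
    using smooth_on_subset[OF \<psi>(1)] smooth_on_subset[OF smooth_on_fderiv_dir[OF \<psi>(1)]] by blast+
  have \<zeta>: "smooth_on ?O \<zeta>" unfolding \<zeta>_def
    by (intro smooth_on_add smooth_on_scaleR smooth_on_mult O fstO \<xi>0 \<psi>Jh smooth_on_const smooth_on_linear[OF bounded_linear_snd])
  have W: "smooth_on ?O W" unfolding W_def
    by (intro smooth_on_add smooth_on_scaleR smooth_on_mult O fstO smooth_on_fderiv_dir \<xi>0 \<psi>Jh smooth_on_const smooth_on_linear[OF bounded_linear_snd])
  have small: "norm ((s * x) *\<^sub>R n) < r / 2" if "s \<in> {-\<epsilon><..<\<epsilon>}" "\<bar>x\<bar> \<le> K" for s x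
  proof -
    have "norm ((s * x) *\<^sub>R n) \<le> \<bar>s\<bar> * B"
      unfolding B_def using that(2) \<psi>(5) by (simp add: abs_mult mult.assoc mult_left_mono mult_mono)
    also have "\<dots> < \<epsilon> * B" using that(1) B by (intro mult_strict_right_mono) auto
    also have "\<dots> = r / 2" using B by (simp add: \<epsilon>_def)
    finally show ?thesis .
  qed
  have inN: "emb (\<zeta> z, W z) \<in> N" if z: "z \<in> ?O" for z
  proof -
    have t: "fst z \<in> ?J" and s: "snd z \<in> {-\<epsilon><..<\<epsilon>}" using z by auto
    have "norm (\<zeta> z) < r / 2 + r / 2" unfolding \<zeta>_def
      using norm_triangle_lt[OF add_strict_mono] \<delta>0(2)[OF t] small[OF s] \<psi>(6) by blast
    moreover have "norm (fderiv \<xi>0 (fst z) 1 - d0 + (snd z * fderiv \<psi> (fst z) 1) *\<^sub>R n) < r / 2 + r / 2"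
      using norm_triangle_lt[OF add_strict_mono] \<delta>0(2)[OF t] small[OF s] \<psi>(6) by blast
    ultimately show ?thesis
      using r(2)[of "\<zeta> z" "W z"] by (simp add: dist_norm W_def norm_minus_commute algebra_simps)
  qed
  define \<mu> where "\<mu> z = fst (\<Lambda> (emb (\<zeta> z, W z)))" for z
  have \<mu>: "smooth_on ?O \<mu>" unfolding \<mu>_def
  proof (rule smooth_on_bounded_linear[OF bounded_linear_fst O])
    have "smooth_on ?O (\<lambda>z. emb (\<zeta> z, W z))"
      by (rule smooth_on_compose[OF O open_UNIV smooth_on_Pair[OF O \<zeta> W] _ emb]) auto
    then show "smooth_on ?O (\<lambda>z. \<Lambda> (emb (\<zeta> z, W z)))"
      by (rule smooth_on_compose[OF O \<Lambda>(1) _ _ \<Lambda>(3)]) (use inN in auto)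
  qed
  define \<xi> where "\<xi> z = \<zeta> z + \<mu> z *\<^sub>R Y1" for z
  have \<xi>: "smooth_on ?O \<xi>" unfolding \<xi>_def by (intro smooth_on_add smooth_on_scaleR O \<zeta> \<mu> smooth_on_const)
  have \<xi>U: "\<xi> z \<in> U'" if "z \<in> ?O" for z using sol(1)[OF inN[OF that]] by (simp add: \<xi>_def \<mu>_def add.commute)
  have \<omega>W: "\<omega> (\<xi> z) (W z) = 0" if "z \<in> ?O" for z using sol(2)[OF inN[OF that]] by (simp add: \<xi>_def \<mu>_def)
  define F where "F z = \<Psi> (\<xi> z)" for z
  have F: "smooth_on ?O F" unfolding F_def by (rule smooth_on_compose[OF O fb(1) \<xi> _ fb(3)]) (use \<xi>U in auto)
  have FU: "F z \<in> U" if "z \<in> ?O" for z using \<xi>U[OF that] fb(4) by (auto simp: F_def)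
  \<comment> \<open>The correction \<open>\<mu> Y1\<close> contributes nothing, as \<open>Y1\<close>
    is in the kernel of \<open>\<omega>\<close>. Hence neither the contact condition nor
    \<open>\<theta>\<^sub>0(V)\<close> contains a derivative of the implicitly defined
    \<open>\<mu>\<close>.\<close>
  have DF: "blinfun_apply (\<eta> (F z)) (fderiv F z v) = \<omega> (\<xi> z) (fderiv \<zeta> z v)" if z: "z \<in> ?O" for z v
  proof -
    have "fderiv F z v = fderiv \<Psi> (\<xi> z) (fderiv \<xi> z v)" unfolding F_def[abs_def]
      by (rule fderiv_compose[OF smooth_on_has_derivative[OF \<xi> z] smooth_on_has_derivative[OF fb(3) \<xi>U[OF z]]])
    moreover have "fderiv \<xi> z = (\<lambda>v. fderiv \<zeta> z v + fderiv \<mu> z v *\<^sub>R Y1)"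
      unfolding \<xi>_def[abs_def]
      by (rule frechet_derivative_at[symmetric])
        (intro has_derivative_add has_derivative_scaleR_left smooth_on_has_derivative[OF \<zeta> z] smooth_on_has_derivative[OF \<mu> z])
    ultimately have "blinfun_apply (\<eta> (F z)) (fderiv F z v) = \<omega> (\<xi> z) (fderiv \<zeta> z v + fderiv \<mu> z v *\<^sub>R Y1)"
      by (simp add: \<omega>_def F_def)
    then show ?thesis using \<omega>Y[OF \<xi>U[OF z]] by (simp add: lin\<omega>[OF \<xi>U[OF z]])
  qed
  have D\<zeta>: "fderiv \<zeta> (t, s) (1, 0) = W (t, s)" "fderiv \<zeta> (t, s) (0, 1) = \<psi> t *\<^sub>R n" if z: "(t, s) \<in> ?O" for t s
  proof -
    have tJ: "t \<in> Jh" using J z by auto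
    have 1: "((\<lambda>t. \<zeta> (t, s)) has_vector_derivative W (t, s)) (at t)"
    proof -
      have "((\<lambda>t. \<psi> t) has_real_derivative fderiv \<psi> t 1) (at t)"
        using smooth_on_vector_derivative(1)[OF \<psi>(1)] by (simp add: has_real_derivative_iff_has_vector_derivative)
      then have "((\<lambda>t. s * \<psi> t) has_real_derivative s * fderiv \<psi> t 1) (at t)" by (rule DERIV_cmult)
      then have "((\<lambda>t. (s * \<psi> t) *\<^sub>R n) has_vector_derivative (s * fderiv \<psi> t 1) *\<^sub>R n) (at t)"
        by (intro has_vector_derivative_scaleR[where g="\<lambda>_. n" and g'=0, simplified])
      then show ?thesis
        using has_vector_derivative_add[OF smooth_on_vector_derivative(1)[OF \<xi>0 tJ]] by (simp add: \<zeta>_def W_def)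
    qed
    show "fderiv \<zeta> (t, s) (1, 0) = W (t, s)"
      by (rule vector_derivative_unique_at[OF smooth_on_slice(1)[OF \<zeta> z] 1])
    have 2: "((\<lambda>s. \<zeta> (t, s)) has_vector_derivative \<psi> t *\<^sub>R n) (at s)"
      unfolding \<zeta>_def by (auto intro!: derivative_eq_intros simp: has_vector_derivative_def)
    show "fderiv \<zeta> (t, s) (0, 1) = \<psi> t *\<^sub>R n"
      by (rule vector_derivative_unique_at[OF smooth_on_slice(2)[OF \<zeta> z] 2])
  qed
  \<comment> \<open>Where the data are those of the path, \<open>\<mu> = 0\<close>. This yields both
    the value at \<open>s = 0\<close> and the compact support, for which \<open>\<psi>\<close> and
    its derivative must vanish together.\<close>
  have unchanged: "\<xi> (t, s) = \<xi>0 t" if t: "t \<in> ?J" and s: "s \<in> {-\<epsilon><..<\<epsilon>}" and "s * \<psi> t = 0" "s * fderiv \<psi> t 1 = 0" for t s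
  proof -
    have "\<zeta> (t, s) = \<xi>0 t" "W (t, s) = fderiv \<xi>0 t 1" using that by (simp_all add: \<zeta>_def W_def)
    then have "\<mu> (t, s) = 0" unfolding \<mu>_def
      using sol(3)[OF inN[of "(t, s)"]] t s \<Psi>\<xi>0(1)[OF J[OF t]] \<omega>\<xi>0[OF J[OF t]] by simp
    then show ?thesis using \<open>\<zeta> (t, s) = \<xi>0 t\<close> by (simp add: \<xi>_def)
  qed
  have F0: "F (t, s) = \<rho> (c t)" if "t \<in> ?J" "s \<in> {-\<epsilon><..<\<epsilon>}" "s * \<psi> t = 0" "s * fderiv \<psi> t 1 = 0" for t s
    using unchanged[OF that] \<Psi>\<xi>0(2)[OF J[OF that(1)]] by (simp add: F_def)
  have var: "contact_variation M D ?J (\<rho> \<circ> c) (- \<delta>0 / 2) (\<delta>0 / 2) \<epsilon> F"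
    unfolding contact_variation_def
  proof (intro conjI ballI)
    show "contact_curve M D ?J (\<lambda>t. F (t, s))" if s: "s \<in> {-\<epsilon><..<\<epsilon>}" for s
      unfolding contact_curve_def
    proof (intro conjI ballI)
      show "smooth_on ?J (\<lambda>t. F (t, s))"
        by (rule smooth_on_compose[OF _ O smooth_on_Pair[OF _ smooth_on_id smooth_on_const] _ F]) (use s in auto)
      fix t assume t: "t \<in> ?J"
      then have z: "(t, s) \<in> ?O" using s by simp
      show "F (t, s) \<in> M" using FU[OF z] U(3) by blast
      have "vector_derivative (\<lambda>t. F (t, s)) (at t) = fderiv F (t, s) (1, 0)"
        by (rule vector_derivative_at[OF smooth_on_slice(1)[OF F z]])
      moreover have "blinfun_apply (\<eta> (F (t, s))) (fderiv F (t, s) (1, 0)) = 0"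
        using DF[OF z] D\<zeta>(1)[OF z] \<omega>W[OF z] by simp
      ultimately show "vector_derivative (\<lambda>t. F (t, s)) (at t) \<in> D (F (t, s))" using U(5)[OF FU[OF z]] by simp
    qed (auto simp: is_interval_oo)
    show "F (t, 0) = (\<rho> \<circ> c) t" if "t \<in> ?J" for t using F0[OF that] \<epsilon> by simp
    show "F (t, s) = (\<rho> \<circ> c) t" if "s \<in> {-\<epsilon><..<\<epsilon>}" "t \<in> ?J - {- \<delta>0 / 2..\<delta>0 / 2}" for t s
      using F0[of t s] that \<psi>(4)[of t] by simp
  qed (use \<delta>0(1) \<epsilon> F in auto)
  have y: "th 0 (c t) (lift (c t) (fderiv F (t, 0) (0, 1))) = \<psi> t * (fB t * (fC t / fA t))" "fC t / fA t > 0" "fB t > 0" if t: "t \<in> ?J" for t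
  proof -
    have tI: "t \<in> ?I" and tJ: "t \<in> Jh" using J[OF t] by (auto simp: Jh_def)
    have z: "(t, 0) \<in> ?O" using t \<epsilon> by simp
    have ABC: "fA t * n0 > 0" "fB t > 0" "fC t * n0 > 0" using \<delta>0(2)[OF t] by blast+
    then have "fA t \<noteq> 0" by auto
    have "(fC t * n0) / (fA t * n0) > 0" using ABC by (intro divide_pos_pos)
    then show "fC t / fA t > 0" using \<eta>0(3) by simp
    show "fB t > 0" by (rule ABC)
    let ?v = "lift (c t) (fderiv F (t, 0) (0, 1))"
    have "fderiv \<rho> (c t) ?v = fderiv F (t, 0) (0, 1)" by (rule fderiv_lift[OF p(4)[OF tI]])
    then have "blinfun_apply (\<eta> (\<rho> (c t))) (fderiv \<rho> (c t) ?v) = \<psi> t * fC t"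
      using DF[OF z, of "(0, 1)"] D\<zeta>(2)[OF z] F0[OF t, of 0] unchanged[OF t, of 0] \<epsilon> lin\<omega>(2)[OF \<Psi>\<xi>0(1)[OF tJ]]
      by (simp add: fC_def)
    then have "th 0 (c t) ?v * fA t = fB t * (\<psi> t * fC t)"
      using theta0_proportional[OF p(4)[OF tI] U(5)[OF in_U[OF tJ]], of ?v n'] by (simp add: fA_def fB_def)
    then show "th 0 (c t) ?v = \<psi> t * (fB t * (fC t / fA t))" using \<open>fA t \<noteq> 0\<close> by (simp add: field_simps)
  qed
  show ?thesis
  proof (rule that[OF \<delta>0(1) \<delta>0\<delta> var])
    show "0 \<le> th 0 (c t) (lift (c t) (fderiv F (t, 0) (0, 1)))" if "t \<in> ?J" for t
      unfolding y(1)[OF that]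
      by (intro mult_nonneg_nonneg \<psi>(2) less_imp_le[OF y(2)[OF that]] less_imp_le[OF y(3)[OF that]])
    have "0 \<in> ?J" using \<delta>0(1) by simp
    then show "0 < th 0 (c 0) (lift (c 0) (fderiv F (0, 0) (0, 1)))"
      unfolding y(1)[OF \<open>0 \<in> ?J\<close>] using \<delta>0(1)
      by (intro mult_pos_pos \<psi>(3) y(2,3)) auto
  qed
qed

lemma path_in_subset:
  assumes "path_in P L J c" "J' \<subseteq> J" "open J'" "is_interval J'"
  shows "path_in P L J' c"
  using assms smooth_on_subset[of J c J'] unfolding path_in_def by blast

lemma geodesics_imp_g1:
  assumes geo: "\<And>J c. path_in P L J c \<Longrightarrow> sub_riemannian_geodesic M D (descended_metric P \<rho> e) J (\<rho> \<circ> c)"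
    and p0: "p0 \<in> P"
  shows "g1 p0 = 2 * w0 p0"
proof (rule ccontr)
  assume neq: "g1 p0 \<noteq> 2 * w0 p0"
  define k where "k p = g1 p - 2 * w0 p" for p
  obtain \<delta> c where c: "\<delta> > 0" "path_in P L {-\<delta><..<\<delta>} c" "c 0 = p0" by (rule path_through[OF p0]) blast
  \<comment> \<open>Multiplication by the constant \<open>k p0\<close> makes the function positive
    at \<open>t = 0\<close> and treats both signs of \<open>k p0\<close> alike.\<close>
  have smk: "smooth_on {-\<delta><..<\<delta>} (\<lambda>t. k (c t) * k p0)" unfolding k_def
    using path_inD(4)[OF c(2)]
    by (intro smooth_on_mult smooth_on_diff smooth_on_const smooth_on_compose[OF _ open_P path_inD(3)[OF c(2)] _ smooth_g1]
        smooth_on_compose[OF _ open_P path_inD(3)[OF c(2)] _ smooth_w0]) auto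
  have "isCont (\<lambda>t. k (c t) * k p0) 0"
    using smooth_on_continuous[OF smk] c(1) by (simp add: continuous_on_eq_continuous_at)
  moreover have "k (c 0) * k p0 > 0"
  proof -
    have "k p0 \<noteq> 0" using neq by (simp add: k_def)
    then show ?thesis unfolding c(3) by (metis not_real_square_gt_zero)
  qed
  ultimately obtain d where "d > 0" "\<And>t. dist t 0 < d \<Longrightarrow> dist (k (c t) * k p0) (k (c 0) * k p0) < k (c 0) * k p0"
    unfolding continuous_at_eps_delta by blast
  then have "\<exists>d>0. \<forall>t. \<bar>t\<bar> < d \<longrightarrow> k (c t) * k p0 > 0"
    by (intro exI[of _ d]) (force simp: dist_real_def abs_less_iff)
  then obtain \<delta>1 where \<delta>1: "\<delta>1 > 0" "\<And>t. \<bar>t\<bar> < \<delta>1 \<Longrightarrow> k (c t) * k p0 > 0"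
    by blast
  define \<delta>2 where "\<delta>2 = min \<delta> \<delta>1"
  have \<delta>2: "\<delta>2 > 0" using c(1) \<delta>1(1) by (simp add: \<delta>2_def)
  have path2: "path_in P L {-\<delta>2<..<\<delta>2} c"
    by (rule path_in_subset[OF c(2)]) (auto simp: \<delta>2_def is_interval_oo)
  obtain \<delta>0 \<epsilon> F where var: "0 < \<delta>0" "\<delta>0 \<le> \<delta>2"
    "contact_variation M D {-\<delta>0<..<\<delta>0} (\<rho> \<circ> c) (- \<delta>0 / 2) (\<delta>0 / 2) \<epsilon> F"
    "\<And>t. t \<in> {-\<delta>0<..<\<delta>0} \<Longrightarrow> 0 \<le> th 0 (c t) (lift (c t) (fderiv F (t, 0) (0, 1)))"
    "0 < th 0 (c 0) (lift (c 0) (fderiv F (0, 0) (0, 1)))"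
    by (rule positive_contact_variation[OF \<delta>2 path2]) blast
  have path0: "path_in P L {-\<delta>0<..<\<delta>0} c"
    by (rule path_in_subset[OF path2]) (use var(2) in \<open>auto simp: is_interval_oo\<close>)
  interpret path_variation P M D \<rho> L e w0 w1 g1 t1 t3 \<gamma> "{-\<delta>0<..<\<delta>0}" c "- \<delta>0 / 2" "\<delta>0 / 2" \<epsilon> F
    by unfold_locales (rule path0 var(3))+
  let ?a = "- \<delta>0 / 2" and ?b = "\<delta>0 / 2"
  define f where "f t = 2 * \<bar>speed t\<bar> * (g1 (c t) - 2 * w0 (c t)) * y0 t" for t
  have "((\<lambda>s. arclength (descended_metric P \<rho> e) ?a ?b (\<lambda>t. F (t, s))) has_real_derivative 0) (at 0)"
    using geo[OF path0] var(3) unfolding sub_riemannian_geodesic_def by blast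
  then have "integral {?a..?b} f = 0"
    using DERIV_unique[OF first_variation] unfolding f_def by blast
  have cc: "continuous_on {?a..?b} (\<lambda>t. g (c t))" if "smooth_on P g" for g :: "real^5 \<Rightarrow> real"
    by (rule continuous_on_compose2[OF smooth_on_continuous[OF that] continuous_on_subset[OF smooth_on_continuous[OF smooth_c] ab(2)]])
      (use c_in_P ab(2) in auto)
  have contf: "continuous_on {?a..?b} f" unfolding f_def
    by (intro continuous_intros cc smooth_g1 smooth_w0 continuous_on_subset[OF continuous_y0 ab(2)]
        continuous_on_subset[OF continuous_speed ab(2)])
  have fi: "((\<lambda>t. f t * k p0) has_integral 0) (cbox ?a ?b)"
    using has_integral_mult_left[OF integrable_integral[OF integrable_continuous_real[OF contf]], of "k p0"] \<open>integral {?a..?b} f = 0\<close>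
    by simp
  have sign: "0 < x \<Longrightarrow> 0 \<le> y \<Longrightarrow> 0 \<le> 2 * \<bar>s\<bar> * x * y" "s \<noteq> 0 \<Longrightarrow> 0 < x \<Longrightarrow> 0 < y \<Longrightarrow> 0 < 2 * \<bar>s\<bar> * x * y"
    for x y s :: real by simp_all
  have "f 0 * k p0 = 0"
  proof (rule has_integral_0_cbox_imp_0[OF _ _ fi])
    show "continuous_on (cbox ?a ?b) (\<lambda>t. f t * k p0)" using contf by (auto intro!: continuous_intros)
    fix t assume "t \<in> box ?a ?b"
    then have t: "t \<in> {-\<delta>0<..<\<delta>0}" using ab(2) by (auto simp: box_real)
    have "k (c t) * k p0 > 0" using \<delta>1(2)[of t] t var(2) by (auto simp: \<delta>2_def)
    moreover have "0 \<le> y0 t" using var(4)[OF t] by (simp add: y0_def vF_def)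
    ultimately have "0 \<le> 2 * \<bar>speed t\<bar> * (k (c t) * k p0) * y0 t" by (rule sign(1))
    also have "\<dots> = f t * k p0" by (simp add: f_def k_def)
    finally show "0 \<le> f t * k p0" .
  qed (use var(1) in auto)
  moreover have "0 < f 0 * k p0"
  proof -
    have "speed 0 \<noteq> 0" by (rule speed_nz) (use var(1) in simp)
    moreover have "0 < y0 0" using var(5) by (simp add: y0_def vF_def)
    moreover have "k (c 0) * k p0 > 0" using \<delta>1(2)[of 0] \<delta>1(1) by simp
    ultimately have "0 < 2 * \<bar>speed 0\<bar> * (k (c 0) * k p0) * y0 0" by (intro sign(2))
    also have "\<dots> = f 0 * k p0" by (simp add: f_def k_def)
    finally show ?thesis .
  qed
  ultimately show False by linarith
qed

theorem paths_geodesic_iff: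
  "(\<forall>J c. path_in P L J c \<longrightarrow> sub_riemannian_geodesic M D (descended_metric P \<rho> e) J (\<rho> \<circ> c))
    \<longleftrightarrow> (\<forall>p\<in>P. g1 p = 2 * w0 p)"
  using path_geodesic geodesics_imp_g1 by blast

end

section \<open>Pulling back the canonical structure\<close>

text \<open>Multiplication by \<open>f y\<close> is an invertible linear map of the real line, so
  the result on families of inverses applies.\<close>

lemma smooth_on_inverse:
  fixes f :: "'a::real_normed_vector \<Rightarrow> real"
  assumes "open S" "smooth_on S f" "\<And>x. x \<in> S \<Longrightarrow> f x \<noteq> 0"
  shows "smooth_on S (\<lambda>x. inverse (f x))"
proof (rule smooth_onI)
  fix k
  have "Ck_on k S (\<lambda>y. inverse (f y) * 1)"
  proof (rule Ck_on_inverse_family[OF assms(1), where A="\<lambda>y v. f y * v" and B="\<lambda>y v. inverse (f y) * v"])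
    show "Ck_on k S (\<lambda>y. f y * v)" for v
      by (rule Ck_on_bounded_linear[OF bounded_linear_mult_left assms(1) smooth_onD[OF assms(2)]])
  qed (use assms(3) in \<open>auto intro!: linearI simp: algebra_simps\<close>)
  then show "Ck_on k S (\<lambda>x. inverse (f x))" by simp
qed

lemma UNIV_5: "(UNIV :: 5 set) = {1, 2, 3, 4, 5}"
  using index5 by auto

lemma sum_5: "(\<Sum>i\<in>UNIV. f (i::5)) = f 1 + (f 2 + (f 3 + (f 4 + f 5)))"
  unfolding UNIV_5 by simp

section \<open>The structure group in coordinates\<close>

lemma nilp_entries:
  "nilp c = (\<chi> i j. if i = 3 \<and> j = 2 then c else if i = 4 \<and> j = 3 then 4 / 3 * c else if i = 5 \<and> j = 4 then c else 0)"
proof -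
  have "nilp c $ i $ j = (if i = 3 \<and> j = 2 then c else if i = 4 \<and> j = 3 then 4 / 3 * c else if i = 5 \<and> j = 4 then c else 0)" for i j
    using index5[of i] index5[of j] by (elim disjE) (simp_all add: nilp_def vector_def)
  then show ?thesis by (simp add: vec_eq_iff)
qed

text \<open>The closed form of the exponential, whose series stops after the cubic term:
  \<open>2 / 3\<close> is \<open>4 / 3\<close> divided by \<open>2!\<close>, and
  \<open>2 / 9\<close> is \<open>4 / 3\<close> divided by \<open>3!\<close>.\<close>

definition unip :: "real \<Rightarrow> real^5^5" where
  "unip c = (\<chi> i j. if i = j then 1 else if i = 3 \<and> j = 2 then c else if i = 4 \<and> j = 3 then 4 / 3 * c
     else if i = 5 \<and> j = 4 then c else if i = 4 \<and> j = 2 then 2 / 3 * c\<^sup>2 else if i = 5 \<and> j = 3 then 2 / 3 * c\<^sup>2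
     else if i = 5 \<and> j = 2 then 2 / 9 * c ^ 3 else 0)"

lemma mat_exp_nilp: "mat_exp (nilp c) = unip c"
proof -
  let ?N = "nilp c"
  let ?t = "\<lambda>k. ((**) ?N ^^ k) (mat 1)"
  have t0: "?t 0 = mat 1" and t1: "?t 1 = ?N" by (simp_all add: One_nat_def)
  have e2: "(?N ** ?N) $ i $ j = (if i = 4 \<and> j = 2 then 4 / 3 * c\<^sup>2 else if i = 5 \<and> j = 3 then 4 / 3 * c\<^sup>2 else 0)" for i j
    using index5[of i] index5[of j]
    unfolding matrix_matrix_mult_def nilp_entries vec_lambda_beta sum_5
    by (elim disjE) (simp_all add: power2_eq_square)
  have e3: "(?N ** (?N ** ?N)) $ i $ j = (if i = 5 \<and> j = 2 then 4 / 3 * c ^ 3 else 0)" for i j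
    using index5[of i] index5[of j]
    unfolding matrix_matrix_mult_def[of ?N "?N ** ?N"] vec_lambda_beta sum_5 e2 unfolding nilp_entries vec_lambda_beta
    by (elim disjE) (simp_all add: power2_eq_square power3_eq_cube)
  have e4: "?N ** (?N ** (?N ** ?N)) = 0"
  proof -
    have "(?N ** (?N ** (?N ** ?N))) $ i $ j = 0" for i j
      using index5[of i] index5[of j]
      unfolding matrix_matrix_mult_def[of ?N "?N ** (?N ** ?N)"] vec_lambda_beta sum_5 e3 unfolding nilp_entries vec_lambda_beta
      by (elim disjE) simp_all
    then show ?thesis by (simp add: vec_eq_iff)
  qed
  have t2: "?t 2 = ?N ** ?N" and t3: "?t 3 = ?N ** (?N ** ?N)"
    by (simp_all add: numeral_2_eq_2 numeral_3_eq_3)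
  have tk: "?t (Suc (Suc (Suc (Suc k)))) = 0" for k
    by (induction k) (simp_all add: e4)
  have tz: "?t k = 0" if "k \<notin> {0, 1, 2, 3}" for k
  proof -
    have "k \<noteq> 0" "k \<noteq> 1" "k \<noteq> 2" "k \<noteq> 3" using that by auto
    then have "k = Suc (Suc (Suc (Suc (k - 4))))" by linarith
    then show ?thesis using tk[of "k - 4"] by metis
  qed
  have "mat_exp ?N = (\<Sum>k\<in>{0, 1, 2, 3}. (1 / fact k) *\<^sub>R ?t k)"
    unfolding mat_exp_def by (rule suminf_finite) (auto simp: tz)
  also have "\<dots> = mat 1 + (?N + ((1 / 2) *\<^sub>R (?N ** ?N) + (1 / 6) *\<^sub>R (?N ** (?N ** ?N))))"
    using t0 t1 t2 t3 by (simp add: fact_numeral One_nat_def)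
  also have "\<dots> = unip c"
  proof -
    have "(mat 1 + (?N + ((1 / 2) *\<^sub>R (?N ** ?N) + (1 / 6) *\<^sub>R (?N ** (?N ** ?N))))) $ i $ j = unip c $ i $ j" for i j
      using index5[of i] index5[of j]
      unfolding vector_add_component vector_scaleR_component e2 e3
      unfolding nilp_entries unip_def mat_def vec_lambda_beta
      by (elim disjE) simp_all
    then show ?thesis by (simp add: vec_eq_iff)
  qed
  finally show ?thesis .
qed

lemma diag5_mult: "(diag5 xs ** A) $ i $ j = vector xs $ i * A $ i $ j"
  by (simp add: matrix_matrix_mult_def diag5_def if_distrib[of "\<lambda>x. x * _"] cong: if_cong)

text \<open>The triangular shape with non-zero diagonal factors transfers the adapted conditions
  from \<open>s\<close> to every other section of \<open>B1\<close>.\<close>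

lemma coframe_at_components:
  fixes s :: "real^5 \<Rightarrow> ((real^5) covector)^5"
  shows "coframe_at s (p, a, b, c) $ 1 = a *\<^sub>R s p $ 1"
    "coframe_at s (p, a, b, c) $ 2 = b *\<^sub>R s p $ 2"
    "coframe_at s (p, a, b, c) $ 3 = (b / a) *\<^sub>R (s p $ 3 + c *\<^sub>R s p $ 2)"
    "coframe_at s (p, a, b, c) $ 4 = (b / a^2) *\<^sub>R (s p $ 4 + (4 / 3 * c) *\<^sub>R s p $ 3 + (2 / 3 * c\<^sup>2) *\<^sub>R s p $ 2)"
    "coframe_at s (p, a, b, c) $ 5 = (b / a^3) *\<^sub>R (s p $ 5 + c *\<^sub>R s p $ 4 + (2 / 3 * c\<^sup>2) *\<^sub>R s p $ 3 + (2 / 9 * c ^ 3) *\<^sub>R s p $ 2)"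
proof -
  have G: "G1_mat (a, b, c) $ i $ j = vector [a, b, b / a, b / a^2, b / a^3] $ i * unip c $ i $ j" for i j
    by (simp add: G1_mat_def mat_exp_nilp diag5_mult)
  show "coframe_at s (p, a, b, c) $ 1 = a *\<^sub>R s p $ 1"
    "coframe_at s (p, a, b, c) $ 2 = b *\<^sub>R s p $ 2"
    "coframe_at s (p, a, b, c) $ 3 = (b / a) *\<^sub>R (s p $ 3 + c *\<^sub>R s p $ 2)"
    "coframe_at s (p, a, b, c) $ 4 = (b / a^2) *\<^sub>R (s p $ 4 + (4 / 3 * c) *\<^sub>R s p $ 3 + (2 / 3 * c\<^sup>2) *\<^sub>R s p $ 2)"
    "coframe_at s (p, a, b, c) $ 5 = (b / a^3) *\<^sub>R (s p $ 5 + c *\<^sub>R s p $ 4 + (2 / 3 * c\<^sup>2) *\<^sub>R s p $ 3 + (2 / 9 * c ^ 3) *\<^sub>R s p $ 2)"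
    unfolding coframe_at_def mat_col_def vec_lambda_beta sum_5 snd_conv fst_conv G unip_def
    by (simp_all add: vector_def scaleR_add_right add_ac)
qed

lemma open_B1: "open P \<Longrightarrow> open (B1 P)"
  unfolding B1_def G1_params_def by (intro open_Times) (auto intro!: open_Diff)

lemma smooth_coframe_at:
  assumes P: "open P" and s: "smooth_on P s" and i: "i \<in> {1, 2, 3}"
  shows "smooth_on (B1 P) (\<lambda>x. coframe_at s x $ i)"
proof -
  note op = open_B1[OF P]
  let ?a = "\<lambda>x::total. fst (snd x)" and ?b = "\<lambda>x::total. fst (snd (snd x))" and ?c = "\<lambda>x::total. snd (snd (snd x))"
  have abc: "smooth_on (B1 P) ?a" "smooth_on (B1 P) ?b" "smooth_on (B1 P) ?c"
    by (intro smooth_on_linear bounded_linear_intros)+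
  have ia: "smooth_on (B1 P) (\<lambda>x. inverse (?a x))"
    by (rule smooth_on_inverse[OF op abc(1)]) (auto simp: B1_def G1_params_def)
  have "smooth_on (B1 P) (\<lambda>x. s (fst x))"
    by (rule smooth_on_compose[OF op P smooth_on_linear[OF bounded_linear_fst] _ s]) (auto simp: B1_def)
  then have sj: "smooth_on (B1 P) (\<lambda>x. s (fst x) $ j)" for j
    by (rule smooth_on_bounded_linear[OF bounded_linear_vec_nth op])
  consider "i = 1" | "i = 2" | "i = 3" using i by auto
  then show ?thesis
  proof cases
    case 1
    have "smooth_on (B1 P) (\<lambda>x. ?a x *\<^sub>R s (fst x) $ 1)" by (intro smooth_on_scaleR op abc sj)
    moreover have "(\<lambda>x. ?a x *\<^sub>R s (fst x) $ 1) = (\<lambda>x. coframe_at s x $ i)"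
      using coframe_at_components(1) by (auto simp: 1 fun_eq_iff)
    ultimately show ?thesis by simp
  next
    case 2
    have "smooth_on (B1 P) (\<lambda>x. ?b x *\<^sub>R s (fst x) $ 2)" by (intro smooth_on_scaleR op abc sj)
    moreover have "(\<lambda>x. ?b x *\<^sub>R s (fst x) $ 2) = (\<lambda>x. coframe_at s x $ i)"
      using coframe_at_components(2) by (auto simp: 2 fun_eq_iff)
    ultimately show ?thesis by simp
  next
    case 3
    have "smooth_on (B1 P) (\<lambda>x. (?b x * inverse (?a x)) *\<^sub>R (s (fst x) $ 3 + ?c x *\<^sub>R s (fst x) $ 2))"
      by (intro smooth_on_scaleR smooth_on_add smooth_on_mult op abc ia sj)
    moreover have "(\<lambda>x. (?b x * inverse (?a x)) *\<^sub>R (s (fst x) $ 3 + ?c x *\<^sub>R s (fst x) $ 2)) = (\<lambda>x. coframe_at s x $ i)"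
      using coframe_at_components(3) by (auto simp: 3 fun_eq_iff divide_inverse)
    ultimately show ?thesis by simp
  qed
qed

lemma smooth_tautological:
  assumes "open P" "smooth_on P s" "i \<in> {1, 2, 3}"
  shows "smooth_on (B1 P) (\<lambda>x. tautological s x $ i)"
proof -
  have "bounded_linear (\<lambda>\<phi> :: (real^5) covector. \<phi> o\<^sub>L (fst_blinfun :: total \<Rightarrow>\<^sub>L (real^5)))"
    by (rule bounded_bilinear.bounded_linear_left[OF bounded_bilinear_blinfun_compose])
  from smooth_on_bounded_linear[OF this open_B1[OF assms(1)] smooth_coframe_at[OF assms]]
  show ?thesis by (simp add: tautological_def)
qed

text \<open>Functions on \<open>B2\<close> have smooth extensions only locally; along a section with
  values in \<open>B2\<close> the extensions agree with the functions themselves.\<close>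

lemma smooth_along_section:
  assumes P: "open P" and k: "smooth_on P k" and B: "\<And>p. p \<in> P \<Longrightarrow> section_of k p \<in> B" and f: "smooth_along B f"
  shows "smooth_on P (\<lambda>p. f (section_of k p))"
proof (rule smooth_on_local)
  fix p assume p: "p \<in> P"
  obtain U F where U: "open U" "section_of k p \<in> U" "smooth_on U F" "\<forall>y\<in>U \<inter> B. F y = f y"
    using f B[OF p] unfolding smooth_along_def by blast
  have sec: "smooth_on P (section_of k)"
    unfolding section_of_def[abs_def] by (intro smooth_on_Pair P smooth_on_id k)
  let ?V = "P \<inter> section_of k -` U"
  have V: "open ?V" by (rule continuous_open_preimage[OF smooth_on_continuous[OF sec] P U(1)])
  have "smooth_on ?V (\<lambda>p. F (section_of k p))"
    by (rule smooth_on_compose[OF V U(1) smooth_on_subset[OF sec] _ U(3)]) auto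
  then have "smooth_on ?V (\<lambda>p. f (section_of k p))"
    by (rule smooth_on_cong[OF V, rotated]) (use U(4) B in auto)
  then show "\<exists>U. open U \<and> p \<in> U \<and> smooth_on U (\<lambda>p. f (section_of k p))"
    using V p U(2) by blast
qed

lemma span_vanish:
  fixes S :: "'a::real_normed_vector covector set"
  assumes "\<phi> \<in> span S" "\<And>\<psi>. \<psi> \<in> S \<Longrightarrow> blinfun_apply \<psi> v = 0"
  shows "blinfun_apply \<phi> v = 0"
proof -
  have "subspace {\<phi> :: 'a covector. blinfun_apply \<phi> v = 0}"
    by (auto simp: subspace_def blinfun.add_left blinfun.scaleR_left blinfun.zero_left)
  then have "span S \<subseteq> {\<phi>. blinfun_apply \<phi> v = 0}"
    using assms(2) by (intro span_minimal) auto
  then show ?thesis using assms(1) by blast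
qed

text \<open>The structure on \<open>B1\<close> is pulled back by \<open>S p = (p, k p)\<close>. The
  formulas for \<open>\<beta>\<close> and \<open>\<gamma>\<close> hold on tangent vectors of
  \<open>B2\<close> only, so the derivative of \<open>S\<close> has to be shown tangent before they
  can be used.\<close>

lemma section_path_coframe:
  fixes P :: "(real^5) set" and M :: "(real^3) set"
    and D :: "real^3 \<Rightarrow> (real^3) set"
    and \<rho> :: "real^5 \<Rightarrow> real^3"
    and L :: "real^5 \<Rightarrow> (real^5) set"
    and s :: "real^5 \<Rightarrow> ((real^5) covector)^5"
    and \<alpha> \<beta> \<gamma> :: "total \<Rightarrow> total covector"
    and I T W G :: "nat \<Rightarrow> total \<Rightarrow> real" and H :: "total \<Rightarrow> real"
    and k :: "real^5 \<Rightarrow> real \<times> real \<times> real"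
  assumes cpg: "contact_path_geometry P M D \<rho> L"
    and can: "canonical_structure P D \<rho> L s \<alpha> \<beta> \<gamma> I T"
    and var: "variational P I T"
    and B2f: "B2_functions P s \<alpha> \<beta> \<gamma> T W G H"
    and W2: "\<forall>x\<in>B2 P T. W 2 x = 0"
    and sec: "canonical_section P \<alpha> \<beta> T k"
  shows "path_coframe P M D \<rho> L (section_coframe s k) (\<lambda>p. W 0 (section_of k p)) (\<lambda>p. W 1 (section_of k p))
    (\<lambda>p. G 1 (section_of k p)) (\<lambda>p. T 1 (section_of k p)) (\<lambda>p. T 3 (section_of k p))
    (\<lambda>p. Blinfun (\<lambda>u. blinfun_apply (\<gamma> (section_of k p)) (fderiv (section_of k) p u)))"
proof -
  have fib: "fibration P M \<rho>" using cpg by (simp add: contact_path_geometry_def)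
  then have P: "open P" by (simp add: fibration_def)
  note opB = open_B1[OF P]
  have ac: "adapted_coframe P D \<rho> L s" using can by (simp add: canonical_structure_def)
  then have s: "smooth_on P s" by (simp add: adapted_coframe_def)
  have str: "structure_equations (B1 P) (sigma (tautological s)) (theta (tautological s)) \<alpha> \<beta> \<gamma> I T"
    using can by (simp add: canonical_structure_def)
  define S where "S = section_of k"
  define e where "e = section_coframe s k"
  have k: "smooth_on P k" using sec by (simp add: canonical_section_def)
  have S_smooth: "smooth_on P S"
    unfolding S_def section_of_def[abs_def] by (intro smooth_on_Pair P smooth_on_id k)
  have SB2: "S p \<in> B2 P T" if "p \<in> P" for p using sec that by (simp add: canonical_section_def S_def)
  then have SB1: "S p \<in> B1 P" if "p \<in> P" for p using that by (auto simp: B2_def)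
  have ek: "e p = coframe_at s (S p)" for p by (simp add: e_def section_coframe_def S_def)
  have fstDS: "fst (fderiv S p u) = u" if p: "p \<in> P" for p u
  proof -
    have "((\<lambda>p. fst (S p)) has_derivative (\<lambda>u. fst (fderiv S p u))) (at p)"
      by (rule has_derivative_fst[OF smooth_on_has_derivative[OF S_smooth p]])
    moreover have "(\<lambda>p. fst (S p)) = (\<lambda>p. p)" by (simp add: S_def section_of_def)
    ultimately have "((\<lambda>p. p) has_derivative (\<lambda>u. fst (fderiv S p u))) (at p)" by simp
    from has_derivative_unique[OF this has_derivative_ident] show ?thesis by (rule fun_cong)
  qed
  \<comment> \<open>The reproducing property of tautological forms: a section pulls them back to its
    own coframe.\<close>
  have taut: "blinfun_apply (tautological s (S p) $ i) (fderiv S p u) = blinfun_apply (e p $ i) u" if "p \<in> P" for p i u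
    using fstDS[OF that] by (simp add: tautological_def ek)
  have ts: "blinfun_apply (sigma (tautological s) (S p)) (fderiv S p u) = blinfun_apply (sigma e p) u"
    and tt: "blinfun_apply (theta (tautological s) i (S p)) (fderiv S p u) = blinfun_apply (theta e i p) u" if "p \<in> P" for p i u
    using taut[OF that] by (simp_all add: sigma_def theta_def)
  have e_smooth: "smooth_on P (\<lambda>p. e p $ i)" if "i \<in> {1, 2, 3}" for i unfolding ek
    by (rule smooth_on_compose[OF P opB S_smooth _ smooth_coframe_at[OF P s that]]) (use SB1 in auto)
  have pull: "blinfun_apply (blinfun_apply (ext_d (\<lambda>p. e p $ i) p) u) v
      = blinfun_apply (blinfun_apply (ext_d (\<lambda>x. tautological s x $ i) (S p)) (fderiv S p u)) (fderiv S p v)"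
    if i: "i \<in> {1, 2, 3}" and p: "p \<in> P" for i p u v
  proof -
    have 1: "fderiv (\<lambda>q. blinfun_apply (tautological s (S q) $ i) (fderiv S q v)) p u
        = blinfun_apply (fderiv (\<lambda>p. e p $ i) p u) v" for u v
    proof -
      have "fderiv (\<lambda>q. blinfun_apply (tautological s (S q) $ i) (fderiv S q v)) p = fderiv (\<lambda>q. blinfun_apply (e q $ i) v) p"
        by (rule frechet_derivative_cong_open[OF P p taut])
      moreover have "fderiv (\<lambda>q. blinfun_apply (e q $ i) v) p = (\<lambda>u. blinfun_apply (fderiv (\<lambda>p. e p $ i) p u) v)"
        by (rule frechet_derivative_at[symmetric])
          (rule bounded_linear.has_derivative[OF blinfun.bounded_linear_left smooth_on_has_derivative[OF e_smooth[OF i] p]])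
      ultimately show ?thesis by simp
    qed
    from ext_d_pullback[OF P S_smooth p smooth_on_has_derivative[OF smooth_tautological[OF P s i] SB1[OF p]], of v u]
    show ?thesis unfolding 1 by (simp add: ext_d_apply[OF smooth_on_differentiable[OF e_smooth[OF i] p]])
  qed
  have sig_e: "sigma e = (\<lambda>p. e p $ 1)" "theta e 0 = (\<lambda>p. e p $ 2)" "theta e 1 = (\<lambda>p. e p $ 3)"
    "sigma (tautological s) = (\<lambda>p. tautological s p $ 1)" "theta (tautological s) 0 = (\<lambda>p. tautological s p $ 2)"
    "theta (tautological s) 1 = (\<lambda>p. tautological s p $ 3)"
    by (simp_all add: sigma_def theta_def fun_eq_iff)
  \<comment> \<open>\<open>T 2\<close> and \<open>T 4\<close> are constant along the section, so the
    chain rule puts its derivative in both kernels.\<close>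
  have tangent: "fderiv S p u \<in> tangent_B2 T (S p)" if p: "p \<in> P" for p u
  proof -
    have "fderiv (T i) (S p) (fderiv S p u) = 0" if i: "i \<in> {1..8}" and c: "\<And>p. p \<in> P \<Longrightarrow> T i (S p) = c" for i c
    proof -
      have Ti: "smooth_on (B1 P) (T i)" using can i by (simp add: canonical_structure_def)
      have "fderiv (\<lambda>p. T i (S p)) p u = fderiv (T i) (S p) (fderiv S p u)"
        by (rule fderiv_compose[OF smooth_on_has_derivative[OF S_smooth p] smooth_on_has_derivative[OF Ti SB1[OF p]]])
      moreover have "fderiv (\<lambda>p. T i (S p)) p = fderiv (\<lambda>_. c) p"
        by (rule frechet_derivative_cong_open[OF P p c])
      ultimately show ?thesis by simp
    qed
    from this[of 2 0] this[of 4 "-1"] show ?thesis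
      using SB2 by (simp add: tangent_B2_def B2_def)
  qed
  define w where "w p u = W 0 (S p) * blinfun_apply (theta e 0 p) u + W 1 (S p) * blinfun_apply (theta e 1 p) u" for p u
  have conn: "blinfun_apply (\<alpha> (S p)) (fderiv S p u) = - 2 * w p u"
      "blinfun_apply (\<beta> (S p)) (fderiv S p u) = - 3 * w p u"
      "blinfun_apply (\<gamma> (S p)) (fderiv S p u) = H (S p) * blinfun_apply (sigma e p) u
        - 3 * (G 0 (S p) * blinfun_apply (theta e 0 p) u + G 1 (S p) * blinfun_apply (theta e 1 p) u
          + G 2 (S p) * blinfun_apply (theta e 2 p) u + G 3 (S p) * blinfun_apply (theta e 3 p) u)"
    if p: "p \<in> P" for p u
  proof -
    have set2: "{..2::nat} = {0, 1, 2}" and set3: "{..3::nat} = {0, 1, 2, 3}" by auto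
    have "\<forall>x\<in>B2 P T. \<forall>v\<in>tangent_B2 T x.
        blinfun_apply (\<beta> x) v =
          blinfun_apply (2 *\<^sub>R \<alpha> x + (\<Sum>i\<le>2. W i x *\<^sub>R theta (tautological s) i x)) v \<and>
        blinfun_apply (\<gamma> x) v =
          blinfun_apply (H x *\<^sub>R sigma (tautological s) x
                         - 3 *\<^sub>R (\<Sum>i\<le>3. G i x *\<^sub>R theta (tautological s) i x)) v"
      using B2f unfolding B2_functions_def by (elim conjE)
    from bspec[OF bspec[OF this SB2[OF p]] tangent[OF p, of u]]
    have 1: "blinfun_apply (\<beta> (S p)) (fderiv S p u) = 2 * blinfun_apply (\<alpha> (S p)) (fderiv S p u) + w p u"
      and 2: "blinfun_apply (\<gamma> (S p)) (fderiv S p u) = H (S p) * blinfun_apply (sigma e p) u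
        - 3 * (G 0 (S p) * blinfun_apply (theta e 0 p) u + (G 1 (S p) * blinfun_apply (theta e 1 p) u
          + (G 2 (S p) * blinfun_apply (theta e 2 p) u + G 3 (S p) * blinfun_apply (theta e 3 p) u)))"
      using W2 SB2[OF p]
      by (simp_all add: set2 set3 blinfun.add_left blinfun.diff_left blinfun.scaleR_left ts[OF p] tt[OF p] w_def)
    \<comment> \<open>Since \<open>W 2\<close> vanishes, the relations are
      \<open>\<beta> = 2 \<alpha> + w\<close> and \<open>3 \<alpha> = 2 \<beta>\<close>, with
      solution \<open>\<alpha> = - 2 w\<close>, \<open>\<beta> = - 3 w\<close>.\<close>
    have 3: "3 * blinfun_apply (\<alpha> (S p)) (fderiv S p u) = 2 * blinfun_apply (\<beta> (S p)) (fderiv S p u)"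
      using sec p by (simp add: canonical_section_def S_def blinfun.diff_left blinfun.scaleR_left)
    show "blinfun_apply (\<alpha> (S p)) (fderiv S p u) = - 2 * w p u"
      "blinfun_apply (\<beta> (S p)) (fderiv S p u) = - 3 * w p u" using 1 3 by linarith+
    show "blinfun_apply (\<gamma> (S p)) (fderiv S p u) = H (S p) * blinfun_apply (sigma e p) u
        - 3 * (G 0 (S p) * blinfun_apply (theta e 0 p) u + G 1 (S p) * blinfun_apply (theta e 1 p) u
          + G 2 (S p) * blinfun_apply (theta e 2 p) u + G 3 (S p) * blinfun_apply (theta e 3 p) u)"
      using 2 by simp
  qed
  define \<gamma>P where "\<gamma>P p = Blinfun (\<lambda>u. blinfun_apply (\<gamma> (S p)) (fderiv S p u))" for p
  have \<gamma>P: "blinfun_apply (\<gamma>P p) u = blinfun_apply (\<gamma> (S p)) (fderiv S p u)" if p: "p \<in> P" for p u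
  proof -
    have "bounded_linear (\<lambda>u. blinfun_apply (\<gamma> (S p)) (fderiv S p u))"
      by (rule bounded_linear_compose[OF blinfun.bounded_linear_right has_derivative_bounded_linear[OF smooth_on_has_derivative[OF S_smooth p]]])
    then show ?thesis by (simp add: \<gamma>P_def bounded_linear_Blinfun_apply)
  qed
  note bl = wedge_apply blinfun.add_left blinfun.diff_left blinfun.scaleR_left blinfun.minus_left
  have at_S: "T 2 (S p) = 0" "T 4 (S p) = -1" "T 5 (S p) = 0" if "p \<in> P" for p
    using SB2[OF that] SB1[OF that] var by (auto simp: B2_def variational_def)
  have str_S: "ext_d (sigma (tautological s)) (S p) = \<alpha> (S p) \<and>\<^sub>w sigma (tautological s) (S p)
       + theta (tautological s) 0 (S p) \<and>\<^sub>w (T 1 (S p) *\<^sub>R theta (tautological s) 1 (S p) + T 2 (S p) *\<^sub>R theta (tautological s) 2 (S p)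
          + T 3 (S p) *\<^sub>R theta (tautological s) 3 (S p))
       + theta (tautological s) 1 (S p) \<and>\<^sub>w (T 4 (S p) *\<^sub>R theta (tautological s) 2 (S p) + T 5 (S p) *\<^sub>R theta (tautological s) 3 (S p))"
     "ext_d (theta (tautological s) 0) (S p) = \<beta> (S p) \<and>\<^sub>w theta (tautological s) 0 (S p)
       + sigma (tautological s) (S p) \<and>\<^sub>w theta (tautological s) 1 (S p)"
     "ext_d (theta (tautological s) 1) (S p) = (\<beta> (S p) - \<alpha> (S p)) \<and>\<^sub>w theta (tautological s) 1 (S p)
       + \<gamma> (S p) \<and>\<^sub>w theta (tautological s) 0 (S p) + sigma (tautological s) (S p) \<and>\<^sub>w theta (tautological s) 2 (S p)"
    if "p \<in> P" for p
    using str SB1[OF that] by (simp_all add: structure_equations_def)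
  have adapted: "(\<forall>v. fderiv \<rho> p v \<in> D (\<rho> p) \<longleftrightarrow> blinfun_apply (theta s 0 p) v = 0)"
      "span (range (\<lambda>i. s p $ i)) = UNIV" "sysI \<rho> L p = span {theta s 0 p, theta s 1 p}"
      "annihilator (L p) = span {theta s 0 p, theta s 1 p, theta s 2 p, theta s 3 p}"
    if "p \<in> P" for p
    using ac that by (auto simp: adapted_coframe_def)
  have th_s: "theta s 0 p = s p $ 2" "theta s 1 p = s p $ 3" "theta s 2 p = s p $ 4" "theta s 3 p = s p $ 5" for p
    by (simp_all add: theta_def)
  have th_e: "theta e 0 p = e p $ 2" "theta e 1 p = e p $ 3" "theta e 2 p = e p $ 4" "theta e 3 p = e p $ 5" for p
    by (simp_all add: theta_def)
  define ka kb kc where "ka p = fst (k p)" and "kb p = fst (snd (k p))" and "kc p = snd (snd (k p))" for p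
  then have kabc: "k p = (ka p, kb p, kc p)" for p by simp
  have nz: "ka p \<noteq> 0" "kb p \<noteq> 0" if "p \<in> P" for p
    using SB1[OF that] by (auto simp: B1_def G1_params_def S_def section_of_def kabc)
  have comps: "e p $ 1 = ka p *\<^sub>R s p $ 1" "e p $ 2 = kb p *\<^sub>R s p $ 2"
    "e p $ 3 = (kb p / ka p) *\<^sub>R (s p $ 3 + kc p *\<^sub>R s p $ 2)"
    "e p $ 4 = (kb p / ka p^2) *\<^sub>R (s p $ 4 + (4 / 3 * kc p) *\<^sub>R s p $ 3 + (2 / 3 * (kc p)\<^sup>2) *\<^sub>R s p $ 2)"
    "e p $ 5 = (kb p / ka p^3) *\<^sub>R (s p $ 5 + kc p *\<^sub>R s p $ 4 + (2 / 3 * (kc p)\<^sup>2) *\<^sub>R s p $ 3 + (2 / 9 * kc p ^ 3) *\<^sub>R s p $ 2)" for p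
    unfolding ek S_def section_of_def kabc by (rule coframe_at_components)+
  have in_I: "s p $ i \<in> sysI \<rho> L p" if "p \<in> P" "i \<in> {2, 3}" for p i
    unfolding adapted(3)[OF that(1)] th_s using that(2) by (auto intro: span_base)
  have in_L: "s p $ i \<in> annihilator (L p)" if "p \<in> P" "i \<in> {2, 3, 4, 5}" for p i
    unfolding adapted(4)[OF that(1)] th_s using that(2) by (auto intro: span_base)
  have "path_coframe P M D \<rho> L e (\<lambda>p. W 0 (S p)) (\<lambda>p. W 1 (S p)) (\<lambda>p. G 1 (S p)) (\<lambda>p. T 1 (S p)) (\<lambda>p. T 3 (S p)) \<gamma>P"
  proof
    show "contact_structure M D" "fibration P M \<rho>" "line_field P L"
      using cpg by (simp_all add: contact_path_geometry_def)
    show "L p \<inter> vertical \<rho> p = {0}" if "p \<in> P" for p using cpg that by (simp add: contact_path_geometry_def)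
    show "smooth_on P (sigma e)" "smooth_on P (theta e 0)" "smooth_on P (theta e 1)"
      unfolding sig_e by (rule e_smooth; simp)+
    have sa: "smooth_along (B2 P T) (W 0)" "smooth_along (B2 P T) (W 1)" "smooth_along (B2 P T) (G 1)"
      using B2f by (simp_all add: B2_functions_def)
    show "smooth_on P (\<lambda>p. W 0 (S p))" "smooth_on P (\<lambda>p. W 1 (S p))" "smooth_on P (\<lambda>p. G 1 (S p))"
      unfolding S_def by (rule smooth_along_section[OF P k _ sa(1)] smooth_along_section[OF P k _ sa(2)]
        smooth_along_section[OF P k _ sa(3)]; use SB2 S_def in simp)+
  next
    fix p v assume p: "p \<in> P"
    show "fderiv \<rho> p v \<in> D (\<rho> p) \<longleftrightarrow> blinfun_apply (theta e 0 p) v = 0"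
      using adapted(1)[OF p] nz[OF p] by (simp add: th_s th_e comps blinfun.scaleR_left)
    show "blinfun_apply (theta e 0 p) v = 0" "blinfun_apply (theta e 1 p) v = 0" if "v \<in> vertical \<rho> p"
      using in_I[OF p, of 2] in_I[OF p, of 3] that
      by (simp_all add: sysI_def annihilator_def th_e comps blinfun.scaleR_left blinfun.add_left)
    show "v = 0" if v: "\<And>i. blinfun_apply (e p $ i) v = 0"
    proof -
      have 1: "blinfun_apply (s p $ 1) v = 0" using v[of 1] nz[OF p] by (simp add: comps blinfun.scaleR_left)
      have 2: "blinfun_apply (s p $ 2) v = 0" using v[of 2] nz[OF p] by (simp add: comps blinfun.scaleR_left)
      have 3: "blinfun_apply (s p $ 3) v = 0" using v[of 3] nz[OF p] 2 by (simp add: comps blinfun.scaleR_left blinfun.add_left)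
      have 4: "blinfun_apply (s p $ 4) v = 0" using v[of 4] nz[OF p] 2 3 by (simp add: comps blinfun.scaleR_left blinfun.add_left)
      have 5: "blinfun_apply (s p $ 5) v = 0" using v[of 5] nz[OF p] 2 3 4 by (simp add: comps blinfun.scaleR_left blinfun.add_left)
      have "blinfun_apply (s p $ i) v = 0" for i using index5[of i] 1 2 3 4 5 by auto
      \<comment> \<open>The covector \<open>v \<bullet> _\<close> lies in the span of the coframe,
        and all forms of the coframe vanish on \<open>v\<close>; so
        \<open>v \<bullet> v = 0\<close>.\<close>
      then have "blinfun_apply (blinfun_inner_right v) v = 0"
        using span_vanish[of "blinfun_inner_right v" "range (\<lambda>i. s p $ i)" v] adapted(2)[OF p] by auto
      then show ?thesis by simp
    qed
    show "blinfun_apply (theta e i p) v = 0" if "v \<in> L p" "i \<le> 3" for i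
    proof -
      have "blinfun_apply (s p $ j) v = 0" if "j \<in> {2, 3, 4, 5}" for j
        using in_L[OF p that] \<open>v \<in> L p\<close> by (simp add: annihilator_def)
      from this[of 2] this[of 3] this[of 4] this[of 5]
      have "blinfun_apply (theta e 0 p) v = 0" "blinfun_apply (theta e 1 p) v = 0"
        "blinfun_apply (theta e 2 p) v = 0" "blinfun_apply (theta e 3 p) v = 0"
        by (simp_all add: th_e comps blinfun.scaleR_left blinfun.add_left)
      moreover have "i = 0 \<or> i = 1 \<or> i = 2 \<or> i = 3" using that(2) by linarith
      ultimately show ?thesis by auto
    qed
    show "blinfun_apply (\<gamma>P p) v = - 3 * G 1 (S p) * blinfun_apply (theta e 1 p) v"
      if "blinfun_apply (sigma e p) v = 0" "blinfun_apply (theta e 0 p) v = 0"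
        "blinfun_apply (theta e 2 p) v = 0" "blinfun_apply (theta e 3 p) v = 0"
      using that by (simp add: \<gamma>P[OF p] conn[OF p])
  next
    fix p assume p: "p \<in> P"
    show "ext_d (sigma e) p =
      (- 2 *\<^sub>R (W 0 (S p) *\<^sub>R theta e 0 p + W 1 (S p) *\<^sub>R theta e 1 p)) \<and>\<^sub>w sigma e p
      + theta e 0 p \<and>\<^sub>w (T 1 (S p) *\<^sub>R theta e 1 p + T 3 (S p) *\<^sub>R theta e 3 p) - theta e 1 p \<and>\<^sub>w theta e 2 p"
    proof (intro blinfun_eqI)
      fix u v
      have "blinfun_apply (blinfun_apply (ext_d (sigma e) p) u) v
          = blinfun_apply (blinfun_apply (ext_d (sigma (tautological s)) (S p)) (fderiv S p u)) (fderiv S p v)"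
        unfolding sig_e by (rule pull[OF _ p]) simp
      then show "blinfun_apply (blinfun_apply (ext_d (sigma e) p) u) v = blinfun_apply (blinfun_apply
        ((- 2 *\<^sub>R (W 0 (S p) *\<^sub>R theta e 0 p + W 1 (S p) *\<^sub>R theta e 1 p)) \<and>\<^sub>w sigma e p
        + theta e 0 p \<and>\<^sub>w (T 1 (S p) *\<^sub>R theta e 1 p + T 3 (S p) *\<^sub>R theta e 3 p) - theta e 1 p \<and>\<^sub>w theta e 2 p) u) v"
        by (simp add: str_S(1)[OF p] bl ts[OF p] tt[OF p] conn[OF p] at_S[OF p] w_def)
    qed
    show "ext_d (theta e 0) p =
      (- 3 *\<^sub>R (W 0 (S p) *\<^sub>R theta e 0 p + W 1 (S p) *\<^sub>R theta e 1 p)) \<and>\<^sub>w theta e 0 p + sigma e p \<and>\<^sub>w theta e 1 p"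
    proof (intro blinfun_eqI)
      fix u v
      have "blinfun_apply (blinfun_apply (ext_d (theta e 0) p) u) v
          = blinfun_apply (blinfun_apply (ext_d (theta (tautological s) 0) (S p)) (fderiv S p u)) (fderiv S p v)"
        unfolding sig_e by (rule pull[OF _ p]) simp
      then show "blinfun_apply (blinfun_apply (ext_d (theta e 0) p) u) v = blinfun_apply (blinfun_apply
        ((- 3 *\<^sub>R (W 0 (S p) *\<^sub>R theta e 0 p + W 1 (S p) *\<^sub>R theta e 1 p)) \<and>\<^sub>w theta e 0 p + sigma e p \<and>\<^sub>w theta e 1 p) u) v"
        by (simp add: str_S(2)[OF p] bl ts[OF p] tt[OF p] conn[OF p] w_def)
    qed
    show "ext_d (theta e 1) p =
      (- (W 0 (S p) *\<^sub>R theta e 0 p + W 1 (S p) *\<^sub>R theta e 1 p)) \<and>\<^sub>w theta e 1 p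
      + \<gamma>P p \<and>\<^sub>w theta e 0 p + sigma e p \<and>\<^sub>w theta e 2 p"
    proof (intro blinfun_eqI)
      fix u v
      have "blinfun_apply (blinfun_apply (ext_d (theta e 1) p) u) v
          = blinfun_apply (blinfun_apply (ext_d (theta (tautological s) 1) (S p)) (fderiv S p u)) (fderiv S p v)"
        unfolding sig_e by (rule pull[OF _ p]) simp
      then show "blinfun_apply (blinfun_apply (ext_d (theta e 1) p) u) v = blinfun_apply (blinfun_apply
        ((- (W 0 (S p) *\<^sub>R theta e 0 p + W 1 (S p) *\<^sub>R theta e 1 p)) \<and>\<^sub>w theta e 1 p
        + \<gamma>P p \<and>\<^sub>w theta e 0 p + sigma e p \<and>\<^sub>w theta e 2 p) u) v"
        by (simp add: str_S(3)[OF p] bl ts[OF p] tt[OF p] \<gamma>P[OF p] conn(1,2)[OF p] w_def)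
    qed
  qed
  then show ?thesis by (simp add: e_def S_def \<gamma>P_def[abs_def])
qed

theorem theorem2:
  fixes P :: "(real^5) set" and M :: "(real^3) set"
    and D :: "real^3 \<Rightarrow> (real^3) set"
    and \<rho> :: "real^5 \<Rightarrow> real^3"
    and L :: "real^5 \<Rightarrow> (real^5) set"
    and s :: "real^5 \<Rightarrow> ((real^5) covector)^5"
    and \<alpha> \<beta> \<gamma> :: "total \<Rightarrow> total covector"
    and I T W G :: "nat \<Rightarrow> total \<Rightarrow> real" and H :: "total \<Rightarrow> real"
    and k :: "real^5 \<Rightarrow> real \<times> real \<times> real"
  assumes "contact_path_geometry P M D \<rho> L"
    and "canonical_structure P D \<rho> L s \<alpha> \<beta> \<gamma> I T"
    and "variational P I T"
    and "definite P T"
    and "B2_functions P s \<alpha> \<beta> \<gamma> T W G H"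
    and "\<forall>x\<in>B2 P T. W 2 x = 0"
    and "canonical_section P \<alpha> \<beta> T k"
  shows "(\<forall>J c. path_in P L J c \<longrightarrow>
            sub_riemannian_geodesic M D (descended_metric P \<rho> (section_coframe s k)) J (\<rho> \<circ> c))
         \<longleftrightarrow> (\<forall>p\<in>P. G 1 (section_of k p) = 2 * W 0 (section_of k p))"
  by (rule path_coframe.paths_geodesic_iff[OF section_path_coframe[OF assms(1-3,5-7)]])

end
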